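(* For every $\varepsilon>0$ there exists an integer $N>0$ such that for every $n\ge N$ and every symmetric convex body of revolution $K\subset\mathbb{R}^n$, $$d_{BM}(I^2K,B_2^n)\le 1+\varepsilon,$$ where $I^2K=I(IK)$ is the double intersection body of $K$ and $B_2^n$ is the Euclidean unit ball of $\mathbb{R}^n$.
   Context: A body in $\mathbb{R}^n$ is a compact set equal to the closure of its interior; a set is symmetric if $S=-S$. All bodies of revolution have the $e_1$-axis as axis of revolution. For a star-shaped set $K$, $\rho_K(u)=\sup\{\lambda\ge0:\lambda u\in K\}$ for $u\in\mathbb{S}^{n-1}$. The intersection body $IK$ of a star body $K$ is the star body with radial function $\rho_{IK}(u)=|K\cap u^\perp|$ (the $(n-1)$-dimensional volume) for $u\in\mathbb{S}^{n-1}$. The Banach–Mazur distance between symmetric bodies $K,L\subset\mathbb{R}^n$ is $d_{BM}(K,L)=\inf\{r\ge 1: K\subset TL\subset rK\text{ for some }T\in GL(n)\}$. *)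

theory Defs
  imports "HOL-Analysis.Analysis" "HOL-Library.Function_Algebras"
begin

text \<open>
  The dimension is quantified inside the statement, so it cannot be a type. We use the library
  topology \<^const>\<open>Euclidean_space\<close>, whose points are the real sequences \<open>x\<close> with \<open>x i = 0\<close> for all
  \<open>i \<ge> n\<close>. The coordinates of a point are \<open>x 0, \<dots>, x (n - 1)\<close>, so the vector usually
  written \<open>e\<^sub>1\<close> is the unit vector with index \<open>0\<close>. The pointwise vector space structure on
  sequences makes \<^const>\<open>convex\<close> and \<^const>\<open>linear\<close> available.
\<close>

instantiation "fun" :: (type, real_vector) real_vector
begin

definition scaleR_fun_def: "r *\<^sub>R f = (\<lambda>x. r *\<^sub>R f x)"

instance
  by standard (auto simp: scaleR_fun_def fun_eq_iff plus_fun_def algebra_simps)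

end

abbreviation carrier_E :: "nat \<Rightarrow> (nat \<Rightarrow> real) set" where
  "carrier_E n \<equiv> topspace (Euclidean_space n)"

definition dot :: "nat \<Rightarrow> (nat \<Rightarrow> real) \<Rightarrow> (nat \<Rightarrow> real) \<Rightarrow> real" where
  "dot n x y = (\<Sum>i<n. x i * y i)"

definition enorm :: "nat \<Rightarrow> (nat \<Rightarrow> real) \<Rightarrow> real" where
  "enorm n x = sqrt (dot n x x)"

definition unit_sphere :: "nat \<Rightarrow> (nat \<Rightarrow> real) set" where
  "unit_sphere n = {u \<in> carrier_E n. enorm n u = 1}"

definition unit_ball :: "nat \<Rightarrow> (nat \<Rightarrow> real) set" where
  "unit_ball n = {x \<in> carrier_E n. enorm n x \<le> 1}"

definition e1 :: "nat \<Rightarrow> real" where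
  "e1 = (\<lambda>i. if i = 0 then 1 else 0)"

text \<open>
  Elements of \<open>GL(n)\<close> are represented by linear maps on all sequences; only the restriction to
  \<^term>\<open>carrier_E n\<close> matters, and every linear map on \<^term>\<open>carrier_E n\<close> has a linear extension.
\<close>

definition GL :: "nat \<Rightarrow> ((nat \<Rightarrow> real) \<Rightarrow> (nat \<Rightarrow> real)) set" where
  "GL n = {T. linear T \<and> bij_betw T (carrier_E n) (carrier_E n)}"

definition orthogonal_maps :: "nat \<Rightarrow> ((nat \<Rightarrow> real) \<Rightarrow> (nat \<Rightarrow> real)) set" where
  "orthogonal_maps n = {T \<in> GL n. \<forall>x\<in>carrier_E n. \<forall>y\<in>carrier_E n. dot n (T x) (T y) = dot n x y}"

text \<open>Nonemptiness has to be required, since the empty set is the closure of its interior.\<close>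

definition body :: "nat \<Rightarrow> (nat \<Rightarrow> real) set \<Rightarrow> bool" where
  "body n K \<longleftrightarrow> K \<noteq> {} \<and> compactin (Euclidean_space n) K \<and>
     K = Euclidean_space n closure_of (Euclidean_space n interior_of K)"

text \<open>On sets, prefix minus is the complement; the reflected set is the image under \<^const>\<open>uminus\<close>.\<close>

definition symmetric_set :: "(nat \<Rightarrow> real) set \<Rightarrow> bool" where
  "symmetric_set K \<longleftrightarrow> K = uminus ` K"

definition of_revolution :: "nat \<Rightarrow> (nat \<Rightarrow> real) set \<Rightarrow> bool" where
  "of_revolution n K \<longleftrightarrow> (\<forall>T\<in>orthogonal_maps n. T e1 = e1 \<longrightarrow> T ` K = K)"

definition radial_function :: "(nat \<Rightarrow> real) set \<Rightarrow> (nat \<Rightarrow> real) \<Rightarrow> real" where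
  "radial_function K u = Sup {r. 0 \<le> r \<and> r *\<^sub>R u \<in> K}"

definition orthonormal_basis_of_perp :: "nat \<Rightarrow> (nat \<Rightarrow> real) \<Rightarrow> (nat \<Rightarrow> (nat \<Rightarrow> real)) \<Rightarrow> bool" where
  "orthonormal_basis_of_perp n u b \<longleftrightarrow>
     (\<forall>i<n - 1. b i \<in> carrier_E n \<and> dot n (b i) u = 0) \<and>
     (\<forall>i<n - 1. \<forall>j<n - 1. dot n (b i) (b j) = (if i = j then 1 else 0))"

text \<open>
  For \<open>u\<close> in the unit sphere this is the \<open>(n - 1)\<close>-dimensional volume of \<open>K \<inter> u\<^sup>\<bottom>\<close>: Lebesgue measure
  on the hyperplane, transported from \<open>(n - 1)\<close>-dimensional coordinate space along an orthonormal
  basis. The choice of the basis does not matter, because Lebesgue measure is invariant under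
  orthogonal maps.
\<close>

definition section_volume :: "nat \<Rightarrow> (nat \<Rightarrow> real) set \<Rightarrow> (nat \<Rightarrow> real) \<Rightarrow> real" where
  "section_volume n K u =
     (let b = (SOME b. orthonormal_basis_of_perp n u b); M = (\<Pi>\<^sub>M i\<in>{..<n - 1}. lborel)
      in measure M {c \<in> space M. (\<Sum>i<n - 1. c i *\<^sub>R b i) \<in> K})"

text \<open>
  The star body with radial function \<^term>\<open>section_volume n K\<close>, cf.
  \<open>radial_function_intersection_body\<close> below.
\<close>

definition intersection_body :: "nat \<Rightarrow> (nat \<Rightarrow> real) set \<Rightarrow> (nat \<Rightarrow> real) set" where
  "intersection_body n K =
     {r *\<^sub>R u | r u. u \<in> unit_sphere n \<and> 0 \<le> r \<and> r \<le> section_volume n K u}"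

lemma dot_scaleR: "dot n (r *\<^sub>R x) (s *\<^sub>R y) = r * s * dot n x y"
  by (simp add: dot_def scaleR_fun_def sum_distrib_left mult_ac)

lemma enorm_scaleR: "enorm n (r *\<^sub>R x) = \<bar>r\<bar> * enorm n x"
  by (simp add: enorm_def dot_scaleR real_sqrt_mult)

lemma section_volume_nonneg: "0 \<le> section_volume n K u"
  by (simp add: section_volume_def Let_def)

lemma scaleR_in_intersection_body_iff:
  assumes "u \<in> unit_sphere n" "0 < r"
  shows "r *\<^sub>R u \<in> intersection_body n K \<longleftrightarrow> r \<le> section_volume n K u"
proof
  assume "r *\<^sub>R u \<in> intersection_body n K"
  then obtain s v where sv: "r *\<^sub>R u = s *\<^sub>R v" "v \<in> unit_sphere n" "0 \<le> s" "s \<le> section_volume n K v"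
    unfolding intersection_body_def by blast
  have "\<bar>r\<bar> * enorm n u = \<bar>s\<bar> * enorm n v"
    using sv(1) by (metis enorm_scaleR)
  then have "r = s"
    using assms sv by (simp add: unit_sphere_def)
  then have "u = v"
    using sv(1) assms(2) by simp
  with \<open>r = s\<close> show "r \<le> section_volume n K u"
    using sv by simp
next
  assume "r \<le> section_volume n K u"
  then show "r *\<^sub>R u \<in> intersection_body n K"
    unfolding intersection_body_def using assms by (auto intro!: exI[of _ r] exI[of _ u])
qed

lemma radial_function_intersection_body:
  assumes "u \<in> unit_sphere n"
  shows "radial_function (intersection_body n K) u = section_volume n K u"
proof -
  have "0 *\<^sub>R u \<in> intersection_body n K"
    unfolding intersection_body_def using assms section_volume_nonneg[of n K u] by blast
  then have "{r. 0 \<le> r \<and> r *\<^sub>R u \<in> intersection_body n K} = {0..section_volume n K u}"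
    using scaleR_in_intersection_body_iff[OF assms, of _ K] section_volume_nonneg[of n K u]
    by (auto simp: le_less)
  then show ?thesis
    using section_volume_nonneg[of n K u] by (simp add: radial_function_def)
qed

text \<open>
  The infimum is taken in the extended reals, so that it is \<open>\<infinity>\<close> and not an unspecified real
  number when no admissible pair \<open>(r, T)\<close> exists.
\<close>

definition banach_mazur_dist :: "nat \<Rightarrow> (nat \<Rightarrow> real) set \<Rightarrow> (nat \<Rightarrow> real) set \<Rightarrow> ereal" where
  "banach_mazur_dist n K L =
     Inf {ereal r | r. 1 \<le> r \<and> (\<exists>T\<in>GL n. K \<subseteq> T ` L \<and> T ` L \<subseteq> (\<lambda>x. r *\<^sub>R x) ` K)}"

end

theory Submission
  imports Defs
begin

text \<open>
  Put \<open>q = n - 1\<close> and describe a body of revolution by its profile \<open>G\<close>: a point with coordinate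
  \<open>x\<^sub>0\<close> on the axis and distance \<open>r > 0\<close> from it belongs to the body iff \<open>r \<le> G (x\<^sub>0 / r)\<close>.
  In polar coordinates on hyperplane sections, the intersection body has, up to a constant, the
  profile \<open>J m = \<integral> G(u)\<^sup>q (1 - m\<^sup>2 u\<^sup>2)\<^sub>+ powr ((q - 3) / 2) du\<close>. For a convex body \<open>1 / G\<close> is
  convex, so \<open>G\<^sup>q\<close> decays at least like a log-concave weight, and its moments of orders 0, 2, 4 are
  comparable uniformly in \<open>q\<close>. Hence \<open>J m / J 0\<close> is \<open>1 - \<mu> m\<^sup>2\<close> up to a quartic error, and \<open>J\<^sup>q\<close> is
  nearly Gaussian on the scale that matters for the second intersection body. The transform of a
  Gaussian weight is the profile of an ellipsoid. Uniformity over all bodies and all directions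
  comes from sandwiching the integrand between two envelopes that depend on \<open>q\<close> only.
\<close>

section \<open>Rotation invariance and scaling of the product Lebesgue measure\<close>

text \<open>The slope \<open>x 0 / perp_norm n x\<close> is the natural variable because
  \<open>1 / G\<close> is then the gauge of the body along the points (m, 1), hence convex. Bodies
  may be arbitrarily long or flat, so no compactness argument gives uniformity; every estimate is
  made relative to a free width \<open>t\<close> that cancels from the final constants. For the
  second body the integrand is a power \<open>q\<close> of
  \<open>transform m / sqrt (1 + \<alpha>\<^sup>2 * \<sigma>\<^sup>2)\<close>. The root contributes
  about exp(- q \<alpha>^2 \<sigma>^2 / 2) and the transform about exp(- q \<mu> \<beta>^2
  \<sigma>^2). The product is a Gaussian in \<sigma> whose rate is a quadratic form in (\<alpha>,
  \<beta>), so its integral is a constant over the root of that form, which is the radial function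
  of an ellipsoid. Rescaling \<sigma> by this root removes body and direction from the comparison.
  The integral is kept in \<sigma> here: the slope variable brings a factor 1 / \<beta> that blows
  up at the axis, where the bounds still have to be uniform.\<close>

lemma nn_integral_plane_rotation:
  fixes F :: "real \<times> real \<Rightarrow> ennreal"
  assumes [measurable]: "F \<in> borel_measurable borel"
  shows "(\<integral>\<^sup>+x. \<integral>\<^sup>+y. F (p * x + s * y, x\<^sup>2 + y\<^sup>2) \<partial>lborel \<partial>lborel)
       = (\<integral>\<^sup>+x. \<integral>\<^sup>+y. F (sqrt (p\<^sup>2 + s\<^sup>2) * x, x\<^sup>2 + y\<^sup>2) \<partial>lborel \<partial>lborel)"
proof (cases "p = 0")
  case True
  have "(\<integral>\<^sup>+x. \<integral>\<^sup>+y. F (s * y, x\<^sup>2 + y\<^sup>2) \<partial>lborel \<partial>lborel)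
      = (\<integral>\<^sup>+y. \<integral>\<^sup>+x. F (s * y, x\<^sup>2 + y\<^sup>2) \<partial>lborel \<partial>lborel)"
    by (rule lborel_pair.Fubini'[symmetric]) measurable
  also have "\<dots> = (\<integral>\<^sup>+y. \<integral>\<^sup>+x. F (\<bar>s\<bar> * y, x\<^sup>2 + y\<^sup>2) \<partial>lborel \<partial>lborel)"
  proof (cases "s \<ge> 0")
    case False
    then show ?thesis
      by (subst nn_integral_real_affine[of _ "-1" 0]) auto
  qed simp
  finally show ?thesis using True by (simp add: add.commute)
next
  case False
  define \<beta> where "\<beta> = sqrt (p\<^sup>2 + s\<^sup>2)"
  have \<beta>: "\<beta> > 0" and \<beta>2: "\<beta>\<^sup>2 = p\<^sup>2 + s\<^sup>2"
    using False unfolding \<beta>_def by (auto simp: sum_power2_gt_zero_iff)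
  \<comment> \<open>Two shears replace the rotation. Substituting (\<beta> x - s y) / p for x turns
    the linear form into \<open>\<beta> * x\<close>; this identity completes the square in y, so
    that the shift \<open>s * x / \<beta> + p / \<beta> * y\<close> restores the sum of squares. The
    Jacobians \<beta> / p and p / \<beta> cancel.\<close>
  have id1: "(- (s * y / p) + \<beta> / p * x)\<^sup>2 + y\<^sup>2 = x\<^sup>2 + (\<beta>\<^sup>2 / p\<^sup>2) * (y - s * x / \<beta>)\<^sup>2" for x y
  proof -
    have "p\<^sup>2 * ((- (s * y / p) + \<beta> / p * x)\<^sup>2 + y\<^sup>2) = (\<beta> * x - s * y)\<^sup>2 + p\<^sup>2 * y\<^sup>2"
      using False by (simp add: field_simps power2_eq_square)
    also have "\<dots> = \<beta>\<^sup>2 * x\<^sup>2 - 2 * \<beta> * s * x * y + (p\<^sup>2 + s\<^sup>2) * y\<^sup>2"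
      by (simp add: algebra_simps power2_eq_square)
    also have "\<dots> = p\<^sup>2 * x\<^sup>2 + s\<^sup>2 * x\<^sup>2 - 2 * \<beta> * s * x * y + \<beta>\<^sup>2 * y\<^sup>2"
      unfolding \<beta>2 by (simp add: algebra_simps)
    also have "\<dots> = p\<^sup>2 * (x\<^sup>2 + (\<beta>\<^sup>2 / p\<^sup>2) * (y - s * x / \<beta>)\<^sup>2)"
      using False \<beta> by (simp add: field_simps power2_eq_square)
    finally show ?thesis using False by simp
  qed
  have "(\<integral>\<^sup>+x. \<integral>\<^sup>+y. F (p * x + s * y, x\<^sup>2 + y\<^sup>2) \<partial>lborel \<partial>lborel)
      = (\<integral>\<^sup>+y. \<integral>\<^sup>+x. F (p * x + s * y, x\<^sup>2 + y\<^sup>2) \<partial>lborel \<partial>lborel)"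
    by (rule lborel_pair.Fubini'[symmetric]) measurable
  also have "\<dots> = (\<integral>\<^sup>+y. ennreal \<bar>\<beta> / p\<bar> * (\<integral>\<^sup>+x. F (\<beta> * x, x\<^sup>2 + (\<beta>\<^sup>2 / p\<^sup>2) * (y - s * x / \<beta>)\<^sup>2) \<partial>lborel) \<partial>lborel)"
  proof (rule nn_integral_cong)
    fix y :: real
    have "(\<integral>\<^sup>+x. F (p * x + s * y, x\<^sup>2 + y\<^sup>2) \<partial>lborel) = ennreal \<bar>\<beta> / p\<bar> *
       (\<integral>\<^sup>+x. F (p * (- (s * y / p) + \<beta> / p * x) + s * y, (- (s * y / p) + \<beta> / p * x)\<^sup>2 + y\<^sup>2) \<partial>lborel)"
      using False \<beta> by (intro nn_integral_real_affine) auto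
    also have "\<dots> = ennreal \<bar>\<beta> / p\<bar> * (\<integral>\<^sup>+x. F (\<beta> * x, x\<^sup>2 + (\<beta>\<^sup>2 / p\<^sup>2) * (y - s * x / \<beta>)\<^sup>2) \<partial>lborel)"
      unfolding id1 using False by (simp add: right_diff_distrib)
    finally show "(\<integral>\<^sup>+x. F (p * x + s * y, x\<^sup>2 + y\<^sup>2) \<partial>lborel)
      = ennreal \<bar>\<beta> / p\<bar> * (\<integral>\<^sup>+x. F (\<beta> * x, x\<^sup>2 + (\<beta>\<^sup>2 / p\<^sup>2) * (y - s * x / \<beta>)\<^sup>2) \<partial>lborel)" .
  qed
  also have "\<dots> = ennreal \<bar>\<beta> / p\<bar> *
      (\<integral>\<^sup>+y. \<integral>\<^sup>+x. F (\<beta> * x, x\<^sup>2 + (\<beta>\<^sup>2 / p\<^sup>2) * (y - s * x / \<beta>)\<^sup>2) \<partial>lborel \<partial>lborel)"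
    by (rule nn_integral_cmult) measurable
  also have "(\<integral>\<^sup>+y. \<integral>\<^sup>+x. F (\<beta> * x, x\<^sup>2 + (\<beta>\<^sup>2 / p\<^sup>2) * (y - s * x / \<beta>)\<^sup>2) \<partial>lborel \<partial>lborel)
      = (\<integral>\<^sup>+x. \<integral>\<^sup>+y. F (\<beta> * x, x\<^sup>2 + (\<beta>\<^sup>2 / p\<^sup>2) * (y - s * x / \<beta>)\<^sup>2) \<partial>lborel \<partial>lborel)"
    by (rule lborel_pair.Fubini') measurable
  also have "\<dots> = (\<integral>\<^sup>+x. ennreal \<bar>p / \<beta>\<bar> * (\<integral>\<^sup>+y. F (\<beta> * x, x\<^sup>2 + y\<^sup>2) \<partial>lborel) \<partial>lborel)"
  proof (rule nn_integral_cong)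
    fix x :: real
    have "(\<integral>\<^sup>+y. F (\<beta> * x, x\<^sup>2 + (\<beta>\<^sup>2 / p\<^sup>2) * (y - s * x / \<beta>)\<^sup>2) \<partial>lborel) = ennreal \<bar>p / \<beta>\<bar> *
       (\<integral>\<^sup>+y. F (\<beta> * x, x\<^sup>2 + (\<beta>\<^sup>2 / p\<^sup>2) * ((s * x / \<beta> + p / \<beta> * y) - s * x / \<beta>)\<^sup>2) \<partial>lborel)"
      using False \<beta> by (intro nn_integral_real_affine) auto
    also have "\<dots> = ennreal \<bar>p / \<beta>\<bar> * (\<integral>\<^sup>+y. F (\<beta> * x, x\<^sup>2 + y\<^sup>2) \<partial>lborel)"
      using False \<beta> by (simp add: power_mult_distrib power_divide)
    finally show "(\<integral>\<^sup>+y. F (\<beta> * x, x\<^sup>2 + (\<beta>\<^sup>2 / p\<^sup>2) * (y - s * x / \<beta>)\<^sup>2) \<partial>lborel)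
      = ennreal \<bar>p / \<beta>\<bar> * (\<integral>\<^sup>+y. F (\<beta> * x, x\<^sup>2 + y\<^sup>2) \<partial>lborel)" .
  qed
  also have "\<dots> = ennreal \<bar>p / \<beta>\<bar> * (\<integral>\<^sup>+x. \<integral>\<^sup>+y. F (\<beta> * x, x\<^sup>2 + y\<^sup>2) \<partial>lborel \<partial>lborel)"
    by (rule nn_integral_cmult) measurable
  finally show ?thesis
    using False \<beta> by (simp add: \<beta>_def[symmetric] mult.assoc[symmetric] ennreal_mult[symmetric])
qed

text \<open>A rotation that sends the coefficient vector to a coordinate axis preserves the sum of
  squares, so only the length of \<open>a\<close> survives. It is assembled from plane rotations:
  the induction hypothesis is applied to \<open>F\<close> shifted by the new coordinate, which
  \<open>nn_integral_plane_rotation\<close> then merges with \<open>t\<close>. The separate index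
  \<open>i\<close> provides the coordinate \<open>t\<close> even when \<open>I\<close> is
  empty.\<close>

lemma nn_integral_PiM_linear_form:
  fixes F :: "real \<times> real \<Rightarrow> ennreal"
  assumes "finite I" "i \<notin> I" and "F \<in> borel_measurable borel"
  shows "(\<integral>\<^sup>+c. F (\<Sum>k\<in>insert i I. c k * a k, \<Sum>k\<in>insert i I. (c k)\<^sup>2) \<partial>(\<Pi>\<^sub>M k\<in>insert i I. lborel))
     = (\<integral>\<^sup>+z. \<integral>\<^sup>+t. F (sqrt (\<Sum>k\<in>insert i I. (a k)\<^sup>2) * t, t\<^sup>2 + (\<Sum>k\<in>I. (z k)\<^sup>2)) \<partial>lborel
         \<partial>(\<Pi>\<^sub>M k\<in>I. lborel))"
  using assms
proof (induction I arbitrary: F rule: finite_induct)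
  case empty
  note [measurable] = empty.prems(2)
  interpret product_sigma_finite "\<lambda>_. lborel :: real measure" by standard
  have "(\<integral>\<^sup>+t. F (t * a i, t\<^sup>2) \<partial>lborel) = (\<integral>\<^sup>+t. F (\<bar>a i\<bar> * t, t\<^sup>2) \<partial>lborel)"
  proof (cases "a i \<ge> 0")
    case False
    then show ?thesis
      by (subst nn_integral_real_affine[of _ "-1" 0]) (auto simp: mult.commute)
  qed (simp add: mult.commute)
  then show ?case
    by (subst product_nn_integral_insert) (auto simp: nn_integral_empty)
next
  case (insert k I)
  note [measurable] = insert.prems(2)
  interpret product_sigma_finite "\<lambda>_. lborel :: real measure" by standard
  have ki: "i \<noteq> k" "i \<notin> I" "k \<notin> I" using insert by auto
  let ?M = "\<lambda>I. \<Pi>\<^sub>M k\<in>I. (lborel :: real measure)"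
  define \<beta> where "\<beta> = sqrt (\<Sum>k\<in>insert i I. (a k)\<^sup>2)"
  have \<beta>2: "\<beta>\<^sup>2 = (\<Sum>k\<in>insert i I. (a k)\<^sup>2)"
    unfolding \<beta>_def by (intro real_sqrt_pow2 sum_nonneg) auto
  have sq: "sqrt (\<beta>\<^sup>2 + (a k)\<^sup>2) = sqrt (\<Sum>k\<in>insert i (insert k I). (a k)\<^sup>2)"
    unfolding \<beta>2 using insert ki by (simp add: add_ac)
  have "(\<integral>\<^sup>+c. F (\<Sum>k\<in>insert i (insert k I). c k * a k, \<Sum>k\<in>insert i (insert k I). (c k)\<^sup>2) \<partial>?M (insert i (insert k I)))
     = (\<integral>\<^sup>+c. F (\<Sum>k\<in>insert k (insert i I). c k * a k, \<Sum>k\<in>insert k (insert i I). (c k)\<^sup>2) \<partial>?M (insert k (insert i I)))"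
    by (simp only: insert_commute)
  also have "\<dots> = (\<integral>\<^sup>+y. \<integral>\<^sup>+c. F (\<Sum>j\<in>insert k (insert i I). (c(k := y)) j * a j,
       \<Sum>j\<in>insert k (insert i I). ((c(k := y)) j)\<^sup>2) \<partial>?M (insert i I) \<partial>lborel)"
    using insert ki by (intro product_nn_integral_insert_rev) auto
  also have "\<dots> = (\<integral>\<^sup>+y. \<integral>\<^sup>+c. F (y * a k + (\<Sum>j\<in>insert i I. c j * a j),
       y\<^sup>2 + (\<Sum>j\<in>insert i I. (c j)\<^sup>2)) \<partial>?M (insert i I) \<partial>lborel)"
  proof (intro nn_integral_cong)
    fix y :: real and c :: "'a \<Rightarrow> real"
    have "(\<Sum>j\<in>insert i I. (c(k := y)) j * a j) = (\<Sum>j\<in>insert i I. c j * a j)"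
      "(\<Sum>j\<in>insert i I. ((c(k := y)) j)\<^sup>2) = (\<Sum>j\<in>insert i I. (c j)\<^sup>2)"
      using ki by (auto intro!: sum.cong)
    moreover have "finite (insert i I)" "k \<notin> insert i I" using insert ki by auto
    ultimately have
      "(\<Sum>j\<in>insert k (insert i I). (c(k := y)) j * a j) = y * a k + (\<Sum>j\<in>insert i I. c j * a j)"
      "(\<Sum>j\<in>insert k (insert i I). ((c(k := y)) j)\<^sup>2) = y\<^sup>2 + (\<Sum>j\<in>insert i I. (c j)\<^sup>2)"
      by (metis (no_types, lifting) fun_upd_same sum.insert)+
    then show "F (\<Sum>j\<in>insert k (insert i I). (c(k := y)) j * a j,
       \<Sum>j\<in>insert k (insert i I). ((c(k := y)) j)\<^sup>2) = F (y * a k + (\<Sum>j\<in>insert i I. c j * a j),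
       y\<^sup>2 + (\<Sum>j\<in>insert i I. (c j)\<^sup>2))"
      by simp
  qed
  also have "\<dots> = (\<integral>\<^sup>+y. \<integral>\<^sup>+z. \<integral>\<^sup>+t. F (y * a k + \<beta> * t, y\<^sup>2 + (t\<^sup>2 + (\<Sum>j\<in>I. (z j)\<^sup>2)))
       \<partial>lborel \<partial>?M I \<partial>lborel)"
  proof (rule nn_integral_cong)
    fix y :: real
    have "(\<lambda>w. F (y * a k + fst w, y\<^sup>2 + snd w)) \<in> borel_measurable borel"
      by (rule measurable_compose[OF _ insert.prems(2)])
         (auto simp: borel_prod[symmetric] intro!: borel_measurable_Pair)
    from insert.IH[OF \<open>i \<notin> I\<close> this]
    show "(\<integral>\<^sup>+c. F (y * a k + (\<Sum>j\<in>insert i I. c j * a j), y\<^sup>2 + (\<Sum>j\<in>insert i I. (c j)\<^sup>2)) \<partial>?M (insert i I))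
      = (\<integral>\<^sup>+z. \<integral>\<^sup>+t. F (y * a k + \<beta> * t, y\<^sup>2 + (t\<^sup>2 + (\<Sum>j\<in>I. (z j)\<^sup>2))) \<partial>lborel \<partial>?M I)"
      by (simp add: \<beta>_def)
  qed
  also have "\<dots> = (\<integral>\<^sup>+z. \<integral>\<^sup>+y. \<integral>\<^sup>+t. F (y * a k + \<beta> * t, y\<^sup>2 + (t\<^sup>2 + (\<Sum>j\<in>I. (z j)\<^sup>2)))
       \<partial>lborel \<partial>lborel \<partial>?M I)"
  proof -
    interpret I: finite_product_sigma_finite "\<lambda>_. lborel :: real measure" I
      by standard (rule insert)
    interpret P: pair_sigma_finite "?M I" "lborel :: real measure"
      by standard
    show ?thesis
      by (rule P.Fubini') measurable
  qed
  also have "\<dots> = (\<integral>\<^sup>+z. \<integral>\<^sup>+y. \<integral>\<^sup>+t. F (sqrt (\<beta>\<^sup>2 + (a k)\<^sup>2) * y, y\<^sup>2 + (t\<^sup>2 + (\<Sum>j\<in>I. (z j)\<^sup>2)))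
       \<partial>lborel \<partial>lborel \<partial>?M I)"
  proof (rule nn_integral_cong)
    fix z :: "'a \<Rightarrow> real"
    let ?S = "\<Sum>j\<in>I. (z j)\<^sup>2"
    have "(\<lambda>w. F (fst w, snd w + ?S)) \<in> borel_measurable borel"
      by (rule measurable_compose[OF _ insert.prems(2)])
         (auto simp: borel_prod[symmetric] intro!: borel_measurable_Pair)
    from nn_integral_plane_rotation[OF this, of "a k" \<beta>]
    show "(\<integral>\<^sup>+y. \<integral>\<^sup>+t. F (y * a k + \<beta> * t, y\<^sup>2 + (t\<^sup>2 + ?S)) \<partial>lborel \<partial>lborel)
      = (\<integral>\<^sup>+y. \<integral>\<^sup>+t. F (sqrt (\<beta>\<^sup>2 + (a k)\<^sup>2) * y, y\<^sup>2 + (t\<^sup>2 + ?S)) \<partial>lborel \<partial>lborel)"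
      by (simp add: mult.commute[of "a k"] add.assoc add.commute[of "(a k)\<^sup>2"])
  qed
  also have "\<dots> = (\<integral>\<^sup>+z. \<integral>\<^sup>+t. \<integral>\<^sup>+y. F (sqrt (\<beta>\<^sup>2 + (a k)\<^sup>2) * y, y\<^sup>2 + (t\<^sup>2 + (\<Sum>j\<in>I. (z j)\<^sup>2)))
       \<partial>lborel \<partial>lborel \<partial>?M I)"
    by (intro nn_integral_cong lborel_pair.Fubini') measurable
  also have "\<dots> = (\<integral>\<^sup>+z. \<integral>\<^sup>+t. F (sqrt (\<beta>\<^sup>2 + (a k)\<^sup>2) * t, t\<^sup>2 + (\<Sum>j\<in>insert k I. (z j)\<^sup>2))
       \<partial>lborel \<partial>?M (insert k I))"
  proof -
    have "(\<Sum>j\<in>I. (if j = k then t else z j)\<^sup>2) = (\<Sum>j\<in>I. (z j)\<^sup>2)" for t and z :: "'a \<Rightarrow> real"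
      using ki by (intro sum.cong) auto
    then show ?thesis
      using insert ki by (subst product_nn_integral_insert) (auto simp: fun_upd_def)
  qed
  finally show ?case unfolding sq .
qed

text \<open>Each coordinate is rescaled on its own and contributes one factor \<open>g\<close>; this
  is how the dimension of the slices of a section becomes an exponent.\<close>

lemma nn_integral_PiM_scale:
  fixes h :: "real \<Rightarrow> ennreal"
  assumes "finite I" "h \<in> borel_measurable borel" and g: "g > 0"
  shows "(\<integral>\<^sup>+z. h (\<Sum>k\<in>I. (z k)\<^sup>2) \<partial>(\<Pi>\<^sub>M k\<in>I. lborel))
    = ennreal (g ^ card I) * (\<integral>\<^sup>+z. h (g\<^sup>2 * (\<Sum>k\<in>I. (z k)\<^sup>2)) \<partial>(\<Pi>\<^sub>M k\<in>I. lborel))"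
  using assms(1,2)
proof (induction I arbitrary: h rule: finite_induct)
  case empty
  interpret product_sigma_finite "\<lambda>_. lborel :: real measure" by standard
  show ?case by (simp add: nn_integral_empty)
next
  case (insert k I)
  note [measurable] = insert.prems
  interpret product_sigma_finite "\<lambda>_. lborel :: real measure" by standard
  let ?M = "\<lambda>I. \<Pi>\<^sub>M k\<in>I. (lborel :: real measure)"
  have eq: "(\<Sum>j\<in>I. (if j = k then t else z j)\<^sup>2) = (\<Sum>j\<in>I. (z j)\<^sup>2)" for t and z :: "'a \<Rightarrow> real"
    using insert by (intro sum.cong) auto
  have "(\<integral>\<^sup>+z. h (\<Sum>k\<in>insert k I. (z k)\<^sup>2) \<partial>?M (insert k I))
      = (\<integral>\<^sup>+y. \<integral>\<^sup>+z. h (y\<^sup>2 + (\<Sum>k\<in>I. (z k)\<^sup>2)) \<partial>?M I \<partial>lborel)"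
    using insert by (subst product_nn_integral_insert_rev) (auto simp: fun_upd_def eq)
  also have "\<dots> = (\<integral>\<^sup>+y. ennreal (g ^ card I) * (\<integral>\<^sup>+z. h (y\<^sup>2 + g\<^sup>2 * (\<Sum>k\<in>I. (z k)\<^sup>2)) \<partial>?M I) \<partial>lborel)"
    by (intro nn_integral_cong insert.IH) simp
  also have "\<dots> = ennreal (g ^ card I) * (\<integral>\<^sup>+y. (\<integral>\<^sup>+z. h (y\<^sup>2 + g\<^sup>2 * (\<Sum>k\<in>I. (z k)\<^sup>2)) \<partial>?M I) \<partial>lborel)"
  proof -
    interpret I: finite_product_sigma_finite "\<lambda>_. lborel :: real measure" I
      by standard (rule insert)
    show ?thesis
      by (rule nn_integral_cmult) measurable
  qed
  also have "(\<integral>\<^sup>+y. (\<integral>\<^sup>+z. h (y\<^sup>2 + g\<^sup>2 * (\<Sum>k\<in>I. (z k)\<^sup>2)) \<partial>?M I) \<partial>lborel)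
     = ennreal g * (\<integral>\<^sup>+y. (\<integral>\<^sup>+z. h (g\<^sup>2 * (y\<^sup>2 + (\<Sum>k\<in>I. (z k)\<^sup>2))) \<partial>?M I) \<partial>lborel)"
  proof -
    interpret I: finite_product_sigma_finite "\<lambda>_. lborel :: real measure" I
      by standard (rule insert)
    have "(\<integral>\<^sup>+y. (\<integral>\<^sup>+z. h (y\<^sup>2 + g\<^sup>2 * (\<Sum>k\<in>I. (z k)\<^sup>2)) \<partial>?M I) \<partial>lborel)
      = ennreal \<bar>g\<bar> * (\<integral>\<^sup>+y. (\<integral>\<^sup>+z. h ((0 + g * y)\<^sup>2 + g\<^sup>2 * (\<Sum>k\<in>I. (z k)\<^sup>2)) \<partial>?M I) \<partial>lborel)"
    proof (rule nn_integral_real_affine)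
      have "(\<lambda>y. \<integral>\<^sup>+z. h (y\<^sup>2 + g\<^sup>2 * (\<Sum>k\<in>I. (z k)\<^sup>2)) \<partial>?M I) \<in> borel_measurable lborel"
        by measurable
      then show "(\<lambda>y. \<integral>\<^sup>+z. h (y\<^sup>2 + g\<^sup>2 * (\<Sum>k\<in>I. (z k)\<^sup>2)) \<partial>?M I) \<in> borel_measurable borel"
        by simp
    qed (use g in simp)
    then show ?thesis using g by (simp add: power_mult_distrib distrib_left)
  qed
  also have "(\<integral>\<^sup>+y. (\<integral>\<^sup>+z. h (g\<^sup>2 * (y\<^sup>2 + (\<Sum>k\<in>I. (z k)\<^sup>2))) \<partial>?M I) \<partial>lborel)
     = (\<integral>\<^sup>+z. h (g\<^sup>2 * (\<Sum>k\<in>insert k I. (z k)\<^sup>2)) \<partial>?M (insert k I))"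
    using insert by (subst product_nn_integral_insert_rev) (auto simp: fun_upd_def eq)
  finally show ?case
    using insert g by (simp add: mult.assoc[symmetric] ennreal_mult[symmetric] mult.commute)
qed

section \<open>Sections of bodies of revolution\<close>

lemma sum_fun_apply: "(\<Sum>i\<in>I. f i) k = (\<Sum>i\<in>I. f i k)" for f :: "'i \<Rightarrow> 'a \<Rightarrow> real"
  by (induction I rule: infinite_finite_induct) (auto simp: zero_fun_def plus_fun_def)

lemma mem_carrier_E: "x \<in> carrier_E n \<longleftrightarrow> (\<forall>i\<ge>n. x i = 0)"
  by (simp add: topspace_Euclidean_space)

text \<open>Bessel's inequality, obtained from the squared distance of a unit vector to its
  projection, bounds every column by 1. Columns and rows have the same total \<open>n\<close>, so no
  column can stay strictly below 1.\<close>

lemma orthonormal_columns: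
  fixes v :: "nat \<Rightarrow> nat \<Rightarrow> real"
  assumes on: "\<And>i j. i < n \<Longrightarrow> j < n \<Longrightarrow> dot n (v i) (v j) = (if i = j then 1 else 0)"
    and k: "k < n"
  shows "(\<Sum>i<n. (v i k)\<^sup>2) = 1"
proof -
  have le: "(\<Sum>i<n. (v i k)\<^sup>2) \<le> 1" if k: "k < n" for k
  proof -
    let ?e = "\<lambda>l. if l = k then 1 else 0 :: real"
    have "0 \<le> (\<Sum>l<n. (?e l - (\<Sum>i<n. v i k * v i l))\<^sup>2)"
      by (intro sum_nonneg) auto
    also have "\<dots> = (\<Sum>l<n. (?e l)\<^sup>2 - 2 * (?e l * (\<Sum>i<n. v i k * v i l)) + (\<Sum>i<n. v i k * v i l)\<^sup>2)"
      by (intro sum.cong) (auto simp: power2_eq_square algebra_simps)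
    also have "\<dots> = (\<Sum>l<n. (?e l)\<^sup>2) - 2 * (\<Sum>l<n. ?e l * (\<Sum>i<n. v i k * v i l))
        + (\<Sum>l<n. (\<Sum>i<n. v i k * v i l)\<^sup>2)"
      by (simp add: sum.distrib sum_subtractf sum_distrib_left)
    also have "(\<Sum>l<n. (?e l)\<^sup>2) = (\<Sum>l<n. ?e l)"
      by (intro sum.cong) auto
    also have "\<dots> = 1" using k by simp
    also have "(\<Sum>l<n. ?e l * (\<Sum>i<n. v i k * v i l)) = (\<Sum>l<n. if l = k then \<Sum>i<n. v i k * v i k else 0)"
      by (intro sum.cong) auto
    also have "\<dots> = (\<Sum>i<n. (v i k)\<^sup>2)" using k by (simp add: power2_eq_square)
    also have "(\<Sum>l<n. (\<Sum>i<n. v i k * v i l)\<^sup>2) = (\<Sum>l<n. \<Sum>i<n. \<Sum>j<n. v i k * v j k * (v i l * v j l))"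
      by (simp add: power2_eq_square sum_product algebra_simps)
    also have "\<dots> = (\<Sum>i<n. \<Sum>l<n. \<Sum>j<n. v i k * v j k * (v i l * v j l))"
      by (rule sum.swap)
    also have "\<dots> = (\<Sum>i<n. \<Sum>j<n. v i k * v j k * dot n (v i) (v j))"
    proof (rule sum.cong[OF refl])
      fix i
      show "(\<Sum>l<n. \<Sum>j<n. v i k * v j k * (v i l * v j l)) = (\<Sum>j<n. v i k * v j k * dot n (v i) (v j))"
        by (subst sum.swap) (simp add: dot_def sum_distrib_left)
    qed
    also have "\<dots> = (\<Sum>i<n. \<Sum>j<n. if j = i then v i k * v i k else 0)"
      by (intro sum.cong) (auto simp: on)
    also have "\<dots> = (\<Sum>i<n. (v i k)\<^sup>2)"
      by (simp add: power2_eq_square)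
    finally show ?thesis by simp
  qed
  have "(\<Sum>k<n. \<Sum>i<n. (v i k)\<^sup>2) = (\<Sum>i<n. dot n (v i) (v i))"
    by (subst sum.swap) (simp add: dot_def power2_eq_square)
  also have "\<dots> = (\<Sum>k<n. 1)" by (intro sum.cong) (auto simp: on)
  finally show ?thesis
    using k le by (intro sum_mono_inv[where I = "{..<n}" and g = "\<lambda>_. 1"]) auto
qed

text \<open>For \<open>u\<close> other than \<open>e1\<close>, the reflection along
  \<open>w = u - e1\<close> maps \<open>e1\<close> to \<open>u\<close> and therefore the remaining
  unit vectors to an orthonormal basis of the hyperplane. Since w has squared length
  \<open>2 * t\<close>, the usual coefficient 2 (w, y) / (w, w) becomes (w, y) / t.\<close>

lemma orthonormal_basis_of_perp_exists:
  assumes u: "u \<in> unit_sphere n"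
  shows "\<exists>b. orthonormal_basis_of_perp n u b"
proof -
  have un: "(\<Sum>l<n. (u l)\<^sup>2) = 1" and uz: "\<And>i. i \<ge> n \<Longrightarrow> u i = 0"
    using u by (auto simp: unit_sphere_def enorm_def dot_def power2_eq_square mem_carrier_E)
  have n: "n > 0" using un by (cases n) auto
  show ?thesis
  proof (cases "u 0 = 1")
    case True
    have "(\<Sum>l\<in>{..<n} - {0}. (u l)\<^sup>2) = 0"
      using un n True by (subst (asm) sum.remove[of _ 0]) auto
    then have u0: "u i = 0" if "i \<noteq> 0" for i
      using uz[of i] that by (cases "i < n") (auto simp: sum_nonneg_eq_0_iff)
    have "orthonormal_basis_of_perp n u (\<lambda>i l. if l = Suc i then 1 else 0)"
      unfolding orthonormal_basis_of_perp_def mem_carrier_E dot_def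
      using u0 by (auto simp: if_distrib[of "\<lambda>x. x * _"] cong: if_cong)
    then show ?thesis by blast
  next
    case False
    define w where "w l = u l - (if l = 0 then 1 else 0)" for l :: nat
    define t where "t = 1 - u 0"
    have t: "t \<noteq> 0" using False by (simp add: t_def)
    have ww: "(\<Sum>l<n. w l * w l) = 2 * t" and wu: "(\<Sum>l<n. w l * u l) = t"
    proof -
      have "(\<Sum>l<n. w l * u l) = (\<Sum>l<n. (u l)\<^sup>2 - (if l = 0 then u 0 else 0))"
        by (intro sum.cong) (auto simp: w_def algebra_simps power2_eq_square)
      then show wu: "(\<Sum>l<n. w l * u l) = t"
        using un n by (simp add: sum_subtractf t_def)
      have "(\<Sum>l<n. w l * w l) = (\<Sum>l<n. w l * u l - (if l = 0 then w 0 else 0))"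
        by (intro sum.cong) (auto simp: w_def algebra_simps)
      then show "(\<Sum>l<n. w l * w l) = 2 * t"
        using wu n by (simp add: sum_subtractf) (simp add: w_def t_def)
    qed
    define b where "b i l = (if l = Suc i then 1 else 0) - (u (Suc i) / t) * w l" for i l
    have wS: "w (Suc i) = u (Suc i)" for i by (simp add: w_def)
    have "dot n (b i) u = 0" if "i < n - 1" for i
    proof -
      have "dot n (b i) u = (\<Sum>l<n. (if l = Suc i then u (Suc i) else 0) - (u (Suc i) / t) * (w l * u l))"
        unfolding dot_def by (intro sum.cong) (auto simp: b_def algebra_simps)
      also have "\<dots> = u (Suc i) - (u (Suc i) / t) * t"
        unfolding sum_subtractf sum_distrib_left[symmetric] wu using that by simp
      finally show ?thesis using t by simp
    qed
    moreover have "dot n (b i) (b j) = (if i = j then 1 else 0)" if "i < n - 1" "j < n - 1" for i j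
    proof -
      have lt: "Suc i < n" "Suc j < n" using that by auto
      have "dot n (b i) (b j) = (\<Sum>l<n. (if l = Suc i then (if i = j then 1 else 0) - (u (Suc j) / t) * w (Suc i) else 0)
          - (if l = Suc j then (u (Suc i) / t) * w (Suc j) else 0)
          + (u (Suc i) / t) * (u (Suc j) / t) * (w l * w l))"
        unfolding dot_def by (intro sum.cong) (auto simp: b_def algebra_simps)
      also have "\<dots> = ((if i = j then 1 else 0) - (u (Suc j) / t) * w (Suc i)) - (u (Suc i) / t) * w (Suc j)
          + (u (Suc i) / t) * (u (Suc j) / t) * (2 * t)"
        unfolding sum.distrib sum_subtractf sum_distrib_left[symmetric] ww using lt by simp
      also have "(u (Suc i) / t) * (u (Suc j) / t) * (2 * t) = 2 * ((u (Suc i) / t) * u (Suc j))"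
        using t by simp
      finally show ?thesis by (simp add: wS mult.commute)
    qed
    moreover have "b i \<in> carrier_E n" if "i < n - 1" for i
      using that uz by (auto simp: mem_carrier_E b_def w_def)
    ultimately have "orthonormal_basis_of_perp n u b"
      by (simp add: orthonormal_basis_of_perp_def)
    then show ?thesis by blast
  qed
qed

definition perp_norm :: "nat \<Rightarrow> (nat \<Rightarrow> real) \<Rightarrow> real" where
  "perp_norm n x = sqrt (\<Sum>i\<in>{1..<n}. (x i)\<^sup>2)"

lemma dot_self_eq: "n > 0 \<Longrightarrow> dot n x x = (x 0)\<^sup>2 + (perp_norm n x)\<^sup>2"
proof -
  assume "n > 0"
  then have "{..<n} = insert 0 {1..<n}" by auto
  then show ?thesis
    by (simp add: dot_def perp_norm_def sum_nonneg power2_eq_square)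
qed

lemma perp_norm_nonneg: "perp_norm n x \<ge> 0"
  by (simp add: perp_norm_def sum_nonneg)

text \<open>The last identity is the squared length of the projection of \<open>e1\<close> to the
  hyperplane: \<open>b\<close> completed by \<open>u\<close> is an orthonormal basis, and the
  squares of its first coordinates sum to 1.\<close>

lemma basis_combination:
  assumes b: "orthonormal_basis_of_perp n u b" and u: "u \<in> unit_sphere n"
  shows "(\<Sum>i<n - 1. c i *\<^sub>R b i) \<in> carrier_E n"
    and "(\<Sum>i<n - 1. c i *\<^sub>R b i) k = (\<Sum>i<n - 1. c i * b i k)"
    and "dot n (\<Sum>i<n - 1. c i *\<^sub>R b i) (\<Sum>i<n - 1. c i *\<^sub>R b i) = (\<Sum>i<n - 1. (c i)\<^sup>2)"
    and "(\<Sum>i<n - 1. (b i 0)\<^sup>2) = 1 - (u 0)\<^sup>2"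
proof -
  show app: "(\<Sum>i<n - 1. c i *\<^sub>R b i) k = (\<Sum>i<n - 1. c i * b i k)" for k
    by (simp add: sum_fun_apply scaleR_fun_def)
  show "(\<Sum>i<n - 1. c i *\<^sub>R b i) \<in> carrier_E n"
    using b by (auto simp: mem_carrier_E app orthonormal_basis_of_perp_def simp del: One_nat_def)
  have "dot n (\<Sum>i<n - 1. c i *\<^sub>R b i) (\<Sum>i<n - 1. c i *\<^sub>R b i)
      = (\<Sum>l<n. \<Sum>i<n-1. \<Sum>j<n-1. c i * c j * (b i l * b j l))"
    by (simp add: dot_def app sum_product algebra_simps del: One_nat_def)
  also have "\<dots> = (\<Sum>i<n-1. \<Sum>l<n. \<Sum>j<n-1. c i * c j * (b i l * b j l))"
    by (rule sum.swap)
  also have "\<dots> = (\<Sum>i<n-1. \<Sum>j<n-1. c i * c j * dot n (b i) (b j))"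
  proof (rule sum.cong[OF refl])
    fix i
    show "(\<Sum>l<n. \<Sum>j<n-1. c i * c j * (b i l * b j l)) = (\<Sum>j<n-1. c i * c j * dot n (b i) (b j))"
      by (subst sum.swap) (simp add: dot_def sum_distrib_left)
  qed
  also have "\<dots> = (\<Sum>i<n-1. \<Sum>j<n-1. if j = i then c i * c i else 0)"
    using b by (intro sum.cong) (auto simp: orthonormal_basis_of_perp_def)
  also have "\<dots> = (\<Sum>i<n-1. (c i)\<^sup>2)"
    by (simp add: power2_eq_square)
  finally show "dot n (\<Sum>i<n - 1. c i *\<^sub>R b i) (\<Sum>i<n - 1. c i *\<^sub>R b i) = (\<Sum>i<n - 1. (c i)\<^sup>2)" .
  have un: "dot n u u = 1" using u by (simp add: unit_sphere_def enorm_def)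
  then have n: "n > 0" by (cases n) (auto simp: dot_def)
  define v where "v i = (if i < n - 1 then b i else u)" for i
  have comm: "dot n x y = dot n y x" for x y by (simp add: dot_def mult.commute)
  have "(\<Sum>i<n. (v i 0)\<^sup>2) = 1"
  proof (rule orthonormal_columns[OF _ n])
    have ub: "dot n (b i) u = 0" "dot n u (b i) = 0" if "i < n - 1" for i
      using b that comm[of u "b i"] by (auto simp: orthonormal_basis_of_perp_def)
    show "dot n (v i) (v j) = (if i = j then 1 else 0)" if "i < n" "j < n" for i j
    proof (cases "i < n - 1 \<and> j < n - 1")
      case True
      then show ?thesis using b by (simp add: v_def orthonormal_basis_of_perp_def)
    next
      case False
      then have "i = n - 1 \<or> j = n - 1" using that by auto
      then show ?thesis using ub un that by (auto simp: v_def)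
    qed
  qed
  moreover have "{..<n} = insert (n - 1) {..<n - 1}" using n by auto
  ultimately show "(\<Sum>i<n - 1. (b i 0)\<^sup>2) = 1 - (u 0)\<^sup>2"
    by (simp add: v_def)
qed

text \<open>The integral of |z| over the unit ball of dimension n - 2. The factor |z| is the
  Jacobian of the substitution t = |z| \<sigma> in \<open>section_volume_profile\<close>. As a
  common factor of all section volumes it is later absorbed into a linear map, provided that it is
  positive and finite.\<close>

definition cone_const :: "nat \<Rightarrow> ennreal" where
  "cone_const n = (\<integral>\<^sup>+z. ennreal (if (\<Sum>k\<in>{1..<n - 1}. (z k)\<^sup>2) \<le> 1 then sqrt (\<Sum>k\<in>{1..<n - 1}. (z k)\<^sup>2) else 0)
     \<partial>(\<Pi>\<^sub>M k\<in>{1..<n - 1}. lborel))"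

lemma cone_const_finite: "cone_const n < \<infinity>"
proof -
  interpret product_sigma_finite "\<lambda>_. lborel :: real measure" by standard
  let ?I = "{1..<n - 1}"
  let ?M = "\<Pi>\<^sub>M k\<in>?I. (lborel :: real measure)"
  let ?B = "\<Pi>\<^sub>E k\<in>?I. {-1..1::real}"
  have "cone_const n \<le> (\<integral>\<^sup>+z. indicator ?B z \<partial>?M)"
    unfolding cone_const_def
  proof (rule nn_integral_mono)
    fix z assume z: "z \<in> space ?M"
    show "ennreal (if (\<Sum>k\<in>?I. (z k)\<^sup>2) \<le> 1 then sqrt (\<Sum>k\<in>?I. (z k)\<^sup>2) else 0) \<le> indicator ?B z"
    proof (cases "(\<Sum>k\<in>?I. (z k)\<^sup>2) \<le> 1")
      case True
      have "z k \<in> {-1..1}" if "k \<in> ?I" for k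
      proof -
        have "(z k)\<^sup>2 \<le> (\<Sum>k\<in>?I. (z k)\<^sup>2)" using that by (intro member_le_sum) auto
        then have "(z k)\<^sup>2 \<le> 1" using True by linarith
        then show ?thesis by (simp add: abs_square_le_1 abs_le_iff)
      qed
      then have "z \<in> ?B" using z by (auto simp: space_PiM PiE_iff)
      then show ?thesis using True by simp
    qed simp
  qed
  also have "\<dots> = emeasure ?M ?B" by (intro nn_integral_indicator sets_PiM_I_finite) auto
  also have "\<dots> = (\<Prod>k\<in>?I. emeasure lborel {-1..1::real})" by (intro emeasure_PiM) auto
  also have "\<dots> = (\<Prod>k\<in>?I. ennreal 2)" by (intro prod.cong) auto
  also have "\<dots> = ennreal (\<Prod>k\<in>?I. 2)" by (intro prod_ennreal) auto
  also have "\<dots> < \<infinity>" by (simp only: ennreal_less_top infinity_ennreal_def)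
  finally show ?thesis .
qed

lemma cone_const_pos:
  assumes "n \<ge> 3" shows "cone_const n > 0"
proof -
  interpret product_sigma_finite "\<lambda>_. lborel :: real measure" by standard
  let ?I = "{1..<n - 1}"
  let ?M = "\<Pi>\<^sub>M k\<in>?I. (lborel :: real measure)"
  \<comment> \<open>The box with sides [\<delta>, 2\<delta>] lies in the unit ball because n
    (2\<delta>)^2 = 1 / n, and |z| is at least \<delta> on it because index 1 is present for
    \<open>n \<ge> 3\<close>.\<close>
  define \<delta> where "\<delta> = 1 / (2 * real n)"
  have \<delta>: "\<delta> > 0" using assms by (simp add: \<delta>_def)
  let ?B = "\<Pi>\<^sub>E k\<in>?I. {\<delta>..2*\<delta>}"
  have "0 < ennreal \<delta> * (\<Prod>k\<in>?I. emeasure lborel {\<delta>..2*\<delta>})"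
    using \<delta> by (simp add: ennreal_zero_less_mult_iff ennreal_power)
  also have "(\<Prod>k\<in>?I. emeasure lborel {\<delta>..2*\<delta>}) = emeasure ?M ?B"
    by (intro emeasure_PiM[symmetric]) auto
  also have "ennreal \<delta> * \<dots> = (\<integral>\<^sup>+z. ennreal \<delta> * indicator ?B z \<partial>?M)"
    by (intro nn_integral_cmult_indicator[symmetric] sets_PiM_I_finite) auto
  also have "\<dots> \<le> cone_const n"
    unfolding cone_const_def
  proof (rule nn_integral_mono)
    fix z
    show "ennreal \<delta> * indicator ?B z \<le> ennreal (if (\<Sum>k\<in>?I. (z k)\<^sup>2) \<le> 1 then sqrt (\<Sum>k\<in>?I. (z k)\<^sup>2) else 0)"
    proof (cases "z \<in> ?B")
      case True
      then have zk: "\<delta> \<le> z k" "z k \<le> 2 * \<delta>" if "k \<in> ?I" for k using that by auto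
      have "(\<Sum>k\<in>?I. (z k)\<^sup>2) \<le> (\<Sum>k\<in>?I. (2*\<delta>)\<^sup>2)"
      proof (intro sum_mono power_mono)
        fix k assume k: "k \<in> ?I"
        show "z k \<le> 2 * \<delta>" "0 \<le> z k" using zk[OF k] \<delta> by linarith+
      qed
      also have "\<dots> \<le> real n * (2*\<delta>)\<^sup>2" using assms by (simp add: mult_right_mono)
      also have "\<dots> = 1 / real n" using assms by (simp add: \<delta>_def power2_eq_square)
      also have "\<dots> \<le> 1" using assms by simp
      finally have 1: "(\<Sum>k\<in>?I. (z k)\<^sup>2) \<le> 1" .
      have "\<delta>\<^sup>2 \<le> (z 1)\<^sup>2" using zk[of 1] assms \<delta> by (intro power_mono) auto
      also have "\<dots> \<le> (\<Sum>k\<in>?I. (z k)\<^sup>2)" using assms by (intro member_le_sum) auto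
      finally have "\<delta> \<le> sqrt (\<Sum>k\<in>?I. (z k)\<^sup>2)" using \<delta> by (simp add: real_le_rsqrt)
      with 1 True show ?thesis by (simp add: ennreal_leI)
    qed simp
  qed
  finally show ?thesis .
qed

lemma cone_const_real:
  assumes "n \<ge> 3"
  obtains \<kappa> where "\<kappa> > 0" "cone_const n = ennreal \<kappa>"
proof (rule that)
  show "enn2real (cone_const n) > 0" "cone_const n = ennreal (enn2real (cone_const n))"
    using cone_const_pos[OF assms] cone_const_finite[of n]
    by (auto simp: enn2real_positive_iff less_top)
qed

text \<open>Discards z = 0, where the substitution t = |z| \<sigma> degenerates.\<close>

lemma AE_PiM_sum_squares_pos:
  assumes "finite I" "I \<noteq> {}"
  shows "AE z in (\<Pi>\<^sub>M k\<in>I. lborel). (\<Sum>k\<in>I. (z k)\<^sup>2 :: real) > 0"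
proof -
  interpret product_sigma_finite "\<lambda>_. lborel :: real measure" by standard
  let ?M = "\<Pi>\<^sub>M k\<in>I. (lborel :: real measure)"
  let ?B = "\<Pi>\<^sub>E k\<in>I. {0::real}"
  have "emeasure ?M ?B = (\<Prod>k\<in>I. emeasure lborel {0::real})"
    using assms by (intro emeasure_PiM) auto
  also have "\<dots> = 0" using assms by (simp add: card_gt_0_iff)
  finally have "emeasure ?M ?B = 0" .
  moreover have "?B \<in> sets ?M" using assms by (intro sets_PiM_I_finite) auto
  ultimately have "?B \<in> null_sets ?M" by (rule null_setsI)
  then show ?thesis
  proof (rule AE_I')
    show "{z \<in> space ?M. \<not> 0 < (\<Sum>k\<in>I. (z k)\<^sup>2)} \<subseteq> ?B"
    proof
      fix z assume "z \<in> {z \<in> space ?M. \<not> 0 < (\<Sum>k\<in>I. (z k)\<^sup>2)}"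
      then have z: "z \<in> space ?M" and "\<not> 0 < (\<Sum>k\<in>I. (z k)\<^sup>2)" by auto
      then have "(\<Sum>k\<in>I. (z k)\<^sup>2) = 0" by (simp add: order_antisym not_less sum_nonneg)
      then have "\<forall>k\<in>I. z k = 0" using assms by (simp add: sum_nonneg_eq_0_iff)
      then show "z \<in> ?B" using z by (intro PiE_I) (auto simp: space_PiM PiE_iff extensional_def)
    qed
  qed
qed

text \<open>The slope is undefined on the axis, which therefore gets its own radius \<rho>. It is
  left existential because the axis contributes nothing to a section volume.\<close>

definition has_profile :: "nat \<Rightarrow> (nat \<Rightarrow> real) set \<Rightarrow> (real \<Rightarrow> real) \<Rightarrow> bool" where
  "has_profile n L G \<longleftrightarrow> G \<in> borel_measurable borel \<and> (\<forall>m. G m \<ge> 0) \<and> (\<exists>\<rho>. \<forall>x\<in>carrier_E n.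
     x \<in> L \<longleftrightarrow> (if perp_norm n x = 0 then \<bar>x 0\<bar> \<le> \<rho> else perp_norm n x \<le> G (x 0 / perp_norm n x)))"

text \<open>On the hyperplane let t be the coordinate along the projection of \<open>e1\<close> and
  z the other n - 2 coordinates. The first coordinate of a point is then \<beta> t and its squared
  norm t^2 + |z|^2. With t = |z| \<sigma> the distance from the axis is |z| sqrt(1 + \<alpha>^2
  \<sigma>^2), so the slope depends on \<sigma> alone and membership reads |z| <= g(\<sigma>).
  Integrating |z| over that ball leaves \<open>cone_const n\<close> times a power of g.\<close>

lemma section_volume_profile:
  assumes prof: "has_profile n L G" and n: "n \<ge> 3" and u: "u \<in> unit_sphere n"
  shows "section_volume n L u = enn2real (cone_const n *
    (\<integral>\<^sup>+\<sigma>. ennreal ((G (sqrt (1 - (u 0)\<^sup>2) * \<sigma> / sqrt (1 + (u 0)\<^sup>2 * \<sigma>\<^sup>2)) / sqrt (1 + (u 0)\<^sup>2 * \<sigma>\<^sup>2)) ^ (n - 1)) \<partial>lborel))"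
proof -
  from prof have [measurable]: "G \<in> borel_measurable borel" and G0: "\<And>m. G m \<ge> 0"
    by (auto simp: has_profile_def)
  from prof obtain \<rho> where L: "\<And>x. x \<in> carrier_E n \<Longrightarrow>
      x \<in> L \<longleftrightarrow> (if perp_norm n x = 0 then \<bar>x 0\<bar> \<le> \<rho> else perp_norm n x \<le> G (x 0 / perp_norm n x))"
    unfolding has_profile_def by blast
  define b where "b = (SOME b. orthonormal_basis_of_perp n u b)"
  have b: "orthonormal_basis_of_perp n u b"
    unfolding b_def by (rule someI_ex[OF orthonormal_basis_of_perp_exists[OF u]])
  note bc = basis_combination[OF b u]
  define I where "I = {1..<n - 1}"
  have I: "{..<n - 1} = insert 0 I" "finite I" "I \<noteq> {}" "0 \<notin> I" "card I = n - 2"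
    using n by (auto simp: I_def)
  let ?M = "\<lambda>I. \<Pi>\<^sub>M k\<in>I. (lborel :: real measure)"
  define \<alpha> where "\<alpha> = u 0"
  define \<beta> where "\<beta> = sqrt (1 - \<alpha>\<^sup>2)"
  have "(\<Sum>i<n - 1. (b i 0)\<^sup>2) \<ge> 0" by (intro sum_nonneg) auto
  then have \<alpha>1: "\<alpha>\<^sup>2 \<le> 1" using bc(4) by (simp add: \<alpha>_def)
  then have \<beta>2: "\<beta>\<^sup>2 = 1 - \<alpha>\<^sup>2" by (simp add: \<beta>_def)
  \<comment> \<open>Here \<open>p\<close> stands for the first coordinate and \<open>s\<close> for
    the squared norm, so \<open>s - p\<^sup>2\<close> is the squared distance from the axis.\<close>
  define P where "P p s \<longleftrightarrow> (if s - p\<^sup>2 \<le> 0 then \<bar>p\<bar> \<le> \<rho> else sqrt (s - p\<^sup>2) \<le> G (p / sqrt (s - p\<^sup>2)))" for p s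
  define F :: "real \<times> real \<Rightarrow> ennreal" where "F w = (if P (fst w) (snd w) then 1 else 0)" for w
  have Fm[measurable]: "F \<in> borel_measurable borel"
    unfolding F_def P_def borel_prod[symmetric] by measurable
  have mem: "(\<Sum>i<n - 1. c i *\<^sub>R b i) \<in> L \<longleftrightarrow> P (\<Sum>i<n-1. c i * b i 0) (\<Sum>i<n-1. (c i)\<^sup>2)" for c
  proof -
    let ?x = "\<Sum>i<n - 1. c i *\<^sub>R b i"
    have "(perp_norm n ?x)\<^sup>2 = (\<Sum>i<n-1. (c i)\<^sup>2) - (\<Sum>i<n-1. c i * b i 0)\<^sup>2"
      using dot_self_eq[of n ?x] n bc(3)[of c] bc(2)[of c 0] by simp
    then have "perp_norm n ?x = sqrt ((\<Sum>i<n-1. (c i)\<^sup>2) - (\<Sum>i<n-1. c i * b i 0)\<^sup>2)"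
      "(\<Sum>i<n-1. (c i)\<^sup>2) - (\<Sum>i<n-1. c i * b i 0)\<^sup>2 \<ge> 0"
      using perp_norm_nonneg[of n ?x] by (metis real_sqrt_unique, metis zero_le_power2)
    then show ?thesis
      unfolding L[OF bc(1)] P_def bc(2) by auto
  qed
  define g where "g \<sigma> = G (\<beta> * \<sigma> / sqrt (1 + \<alpha>\<^sup>2 * \<sigma>\<^sup>2)) / sqrt (1 + \<alpha>\<^sup>2 * \<sigma>\<^sup>2)" for \<sigma>
  have [measurable]: "g \<in> borel_measurable borel" unfolding g_def by measurable
  have pos: "1 + \<alpha>\<^sup>2 * \<sigma>\<^sup>2 > 0" for \<sigma> by (simp add: add_pos_nonneg)
  have g0: "g \<sigma> \<ge> 0" for \<sigma> using pos[of \<sigma>] G0 by (simp add: g_def)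
  let ?S = "\<lambda>z. (\<Sum>k\<in>I. (z k)\<^sup>2) :: real"
  have "emeasure (?M {..<n - 1}) {c \<in> space (?M {..<n - 1}). (\<Sum>i<n - 1. c i *\<^sub>R b i) \<in> L}
      = (\<integral>\<^sup>+c. F (\<Sum>i<n-1. c i * b i 0, \<Sum>i<n-1. (c i)\<^sup>2) \<partial>?M {..<n - 1})"
  proof -
    have "{c \<in> space (?M {..<n - 1}). (\<Sum>i<n - 1. c i *\<^sub>R b i) \<in> L} =
       (\<lambda>c. F (\<Sum>i<n-1. c i * b i 0, \<Sum>i<n-1. (c i)\<^sup>2)) -` {1} \<inter> space (?M {..<n - 1})"
      by (auto simp: mem F_def simp del: One_nat_def split: if_splits)
    also have "\<dots> \<in> sets (?M {..<n - 1})"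
      by measurable
    finally have "emeasure (?M {..<n - 1}) {c \<in> space (?M {..<n - 1}). (\<Sum>i<n - 1. c i *\<^sub>R b i) \<in> L}
      = (\<integral>\<^sup>+c. indicator {c \<in> space (?M {..<n - 1}). (\<Sum>i<n - 1. c i *\<^sub>R b i) \<in> L} c \<partial>?M {..<n - 1})"
      by simp
    also have "\<dots> = (\<integral>\<^sup>+c. F (\<Sum>i<n-1. c i * b i 0, \<Sum>i<n-1. (c i)\<^sup>2) \<partial>?M {..<n - 1})"
      by (intro nn_integral_cong) (auto simp: F_def mem indicator_def simp del: One_nat_def)
    finally show ?thesis .
  qed
  also have "\<dots> = (\<integral>\<^sup>+z. \<integral>\<^sup>+t. F (\<beta> * t, t\<^sup>2 + ?S z) \<partial>lborel \<partial>?M I)"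
    using bc(4) unfolding I(1) \<beta>_def \<alpha>_def
    by (subst nn_integral_PiM_linear_form[OF I(2,4) Fm]) simp
  also have "\<dots> = (\<integral>\<^sup>+z. \<integral>\<^sup>+\<sigma>. ennreal (if ?S z \<le> (g \<sigma>)\<^sup>2 then sqrt (?S z) else 0) \<partial>lborel \<partial>?M I)"
  proof (rule nn_integral_cong_AE)
    have "(\<integral>\<^sup>+t. F (\<beta> * t, t\<^sup>2 + ?S z) \<partial>lborel)
       = (\<integral>\<^sup>+\<sigma>. ennreal (if ?S z \<le> (g \<sigma>)\<^sup>2 then sqrt (?S z) else 0) \<partial>lborel)" if S: "?S z > 0" for z
    proof -
      let ?R = "sqrt (?S z)"
      have "(\<integral>\<^sup>+t. F (\<beta> * t, t\<^sup>2 + ?S z) \<partial>lborel)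
        = ennreal \<bar>?R\<bar> * (\<integral>\<^sup>+\<sigma>. F (\<beta> * (0 + ?R * \<sigma>), (0 + ?R * \<sigma>)\<^sup>2 + ?S z) \<partial>lborel)"
        using S by (intro nn_integral_real_affine) auto
      also have "\<dots> = (\<integral>\<^sup>+\<sigma>. ennreal ?R * F (\<beta> * (0 + ?R * \<sigma>), (0 + ?R * \<sigma>)\<^sup>2 + ?S z) \<partial>lborel)"
        using S by (simp add: nn_integral_cmult)
      also have "\<dots> = (\<integral>\<^sup>+\<sigma>. ennreal (if ?S z \<le> (g \<sigma>)\<^sup>2 then sqrt (?S z) else 0) \<partial>lborel)"
      proof (rule nn_integral_cong)
        fix \<sigma>
        let ?w = "sqrt (1 + \<alpha>\<^sup>2 * \<sigma>\<^sup>2)"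
        have w: "?w > 0" using pos by simp
        have "(0 + ?R * \<sigma>)\<^sup>2 + ?S z - (\<beta> * (0 + ?R * \<sigma>))\<^sup>2 = ?S z * (1 + (1 - \<beta>\<^sup>2) * \<sigma>\<^sup>2)"
          using S by (simp add: power_mult_distrib algebra_simps)
        also have "\<dots> = ?S z * (1 + \<alpha>\<^sup>2 * \<sigma>\<^sup>2)" by (simp add: \<beta>2)
        finally have e: "(0 + ?R * \<sigma>)\<^sup>2 + ?S z - (\<beta> * (0 + ?R * \<sigma>))\<^sup>2 = ?S z * (1 + \<alpha>\<^sup>2 * \<sigma>\<^sup>2)" .
        have "?S z * (1 + \<alpha>\<^sup>2 * \<sigma>\<^sup>2) > 0" using S pos by simp
        then have "P (\<beta> * (0 + ?R * \<sigma>)) ((0 + ?R * \<sigma>)\<^sup>2 + ?S z) \<longleftrightarrow>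
            ?R * ?w \<le> G (\<beta> * (?R * \<sigma>) / (?R * ?w))"
          unfolding P_def e by (simp add: real_sqrt_mult)
        also have "\<beta> * (?R * \<sigma>) / (?R * ?w) = \<beta> * \<sigma> / ?w" using S by simp
        also have "?R * ?w \<le> G (\<beta> * \<sigma> / ?w) \<longleftrightarrow> ?R \<le> g \<sigma>"
          using w by (simp add: g_def pos_le_divide_eq)
        also have "\<dots> \<longleftrightarrow> ?S z \<le> (g \<sigma>)\<^sup>2"
          using g0[of \<sigma>] S by (simp add: real_sqrt_le_iff' less_imp_le)
        finally show "ennreal ?R * F (\<beta> * (0 + ?R * \<sigma>), (0 + ?R * \<sigma>)\<^sup>2 + ?S z)
          = ennreal (if ?S z \<le> (g \<sigma>)\<^sup>2 then sqrt (?S z) else 0)"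
          by (simp add: F_def)
      qed
      finally show ?thesis .
    qed
    then show "AE z in ?M I. (\<integral>\<^sup>+t. F (\<beta> * t, t\<^sup>2 + ?S z) \<partial>lborel)
       = (\<integral>\<^sup>+\<sigma>. ennreal (if ?S z \<le> (g \<sigma>)\<^sup>2 then sqrt (?S z) else 0) \<partial>lborel)"
      using AE_PiM_sum_squares_pos[OF I(2,3)] by (auto elim!: eventually_mono)
  qed
  also have "\<dots> = (\<integral>\<^sup>+\<sigma>. \<integral>\<^sup>+z. ennreal (if ?S z \<le> (g \<sigma>)\<^sup>2 then sqrt (?S z) else 0) \<partial>?M I \<partial>lborel)"
  proof -
    interpret I: finite_product_sigma_finite "\<lambda>_. lborel :: real measure" I
      by standard (rule I)
    interpret P: pair_sigma_finite "?M I" "lborel :: real measure" by standard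
    show ?thesis
      by (rule P.Fubini'[symmetric]) measurable
  qed
  also have "\<dots> = (\<integral>\<^sup>+\<sigma>. cone_const n * ennreal ((g \<sigma>) ^ (n - 1)) \<partial>lborel)"
  proof (rule nn_integral_cong)
    fix \<sigma>
    show "(\<integral>\<^sup>+z. ennreal (if ?S z \<le> (g \<sigma>)\<^sup>2 then sqrt (?S z) else 0) \<partial>?M I) = cone_const n * ennreal ((g \<sigma>) ^ (n - 1))"
    proof (cases "g \<sigma> = 0")
      case True
      have "(if ?S z \<le> (g \<sigma>)\<^sup>2 then sqrt (?S z) else 0) = 0" for z
        using True sum_nonneg[of I "\<lambda>k. (z k)\<^sup>2"] by auto
      then show ?thesis using True n by (simp add: zero_power)
    next
      case False
      then have gp: "g \<sigma> > 0" using g0[of \<sigma>] by simp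
      have "(\<lambda>S. ennreal (if S \<le> (g \<sigma>)\<^sup>2 then sqrt S else 0)) \<in> borel_measurable borel"
        by measurable
      \<comment> \<open>Scaling the n - 2 coordinates gives exponent n - 2; the weight |z| in the
        integrand supplies the remaining factor.\<close>
      from nn_integral_PiM_scale[OF I(2) this gp]
      have "(\<integral>\<^sup>+z. ennreal (if ?S z \<le> (g \<sigma>)\<^sup>2 then sqrt (?S z) else 0) \<partial>?M I) =
        ennreal ((g \<sigma>) ^ (n - 2)) * (\<integral>\<^sup>+z. ennreal (if (g \<sigma>)\<^sup>2 * ?S z \<le> (g \<sigma>)\<^sup>2 then sqrt ((g \<sigma>)\<^sup>2 * ?S z) else 0) \<partial>?M I)"
        by (simp add: I(5))
      also have "(\<integral>\<^sup>+z. ennreal (if (g \<sigma>)\<^sup>2 * ?S z \<le> (g \<sigma>)\<^sup>2 then sqrt ((g \<sigma>)\<^sup>2 * ?S z) else 0) \<partial>?M I)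
        = (\<integral>\<^sup>+z. ennreal (g \<sigma>) * ennreal (if ?S z \<le> 1 then sqrt (?S z) else 0) \<partial>?M I)"
        using gp by (intro nn_integral_cong) (auto simp: real_sqrt_mult ennreal_mult[symmetric] sum_nonneg)
      also have "\<dots> = ennreal (g \<sigma>) * cone_const n"
        unfolding cone_const_def I_def[symmetric] by (rule nn_integral_cmult) measurable
      finally have e: "(\<integral>\<^sup>+z. ennreal (if ?S z \<le> (g \<sigma>)\<^sup>2 then sqrt (?S z) else 0) \<partial>?M I)
        = ennreal ((g \<sigma>) ^ (n - 2)) * (ennreal (g \<sigma>) * cone_const n)" .
      show ?thesis
      proof -
        have "(g \<sigma>) ^ (n - 1) = (g \<sigma>) ^ (n - 2) * g \<sigma>"
          proof -
          have "n - 1 = Suc (n - 2)" using n by simp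
          then show ?thesis by (simp only: power_Suc2)
        qed
        then show ?thesis
          unfolding e using gp by (simp add: ennreal_mult mult_ac)
      qed
    qed
  qed
  also have "\<dots> = cone_const n * (\<integral>\<^sup>+\<sigma>. ennreal ((g \<sigma>) ^ (n - 1)) \<partial>lborel)"
    by (rule nn_integral_cmult) measurable
  finally show ?thesis
    unfolding section_volume_def Let_def b_def[symmetric] measure_def g_def \<beta>_def \<alpha>_def by simp
qed

section \<open>The transform of even convex profiles\<close>

text \<open>Serves twice: as the Jacobian of the passage from \<sigma> to the slope, and as the
  antiderivative that evaluates the bathtub integral in \<open>transform_bounds\<close>.\<close>

lemma DERIV_slope:
  fixes k x :: real
  assumes "k \<ge> 0"
  shows "((\<lambda>x. x / sqrt (1 + k * x\<^sup>2)) has_real_derivative 1 / (sqrt (1 + k * x\<^sup>2)) ^ 3) (at x)"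
proof -
  have p: "1 + k * x\<^sup>2 > 0" using assms by (simp add: add_pos_nonneg)
  define w where "w = sqrt (1 + k * x\<^sup>2)"
  have w: "w > 0" "w\<^sup>2 = 1 + k * x\<^sup>2" using p by (auto simp: w_def)
  have "((\<lambda>x. x / sqrt (1 + k * x\<^sup>2)) has_real_derivative
      (1 * w - x * (k * (2 * x) * (inverse w / 2))) / (w * w)) (at x)"
    unfolding w_def using p by (auto intro!: derivative_eq_intros)
  also have "(1 * w - x * (k * (2 * x) * (inverse w / 2))) / (w * w) = (w\<^sup>2 - k * x\<^sup>2) / w ^ 3"
    using w(1) by (simp add: field_simps power2_eq_square power3_eq_cube)
  also have "\<dots> = 1 / w ^ 3" by (simp add: w)
  finally show ?thesis by (simp add: w_def)
qed

text \<open>With x = \<beta> \<sigma> the new variable is u = x / w, where w^2 = 1 + k x^2. Then 1 -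
  k u^2 = w^(-2) and du = w^(-3) dx, so w^(-q) dx = (1 - k u^2)^((q - 3) / 2) du. The image of the
  line is k u^2 < 1, which is the reason for the truncation at 0.\<close>

lemma nn_integral_slope_substitution:
  fixes G :: "real \<Rightarrow> real" and \<alpha> \<beta> :: real and q :: nat
  assumes [measurable]: "G \<in> borel_measurable borel" and G0: "\<And>m. G m \<ge> 0" and \<beta>: "\<beta> > 0"
  shows "(\<integral>\<^sup>+\<sigma>. ennreal ((G (\<beta> * \<sigma> / sqrt (1 + \<alpha>\<^sup>2 * \<sigma>\<^sup>2)) / sqrt (1 + \<alpha>\<^sup>2 * \<sigma>\<^sup>2)) ^ q) \<partial>lborel)
    = ennreal (1 / \<beta>) * (\<integral>\<^sup>+u. ennreal (G u ^ q * max 0 (1 - (\<alpha> / \<beta>)\<^sup>2 * u\<^sup>2) powr ((real q - 3) / 2)) \<partial>lborel)"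
proof -
  define k where "k = (\<alpha> / \<beta>)\<^sup>2"
  have k: "k \<ge> 0" by (simp add: k_def)
  define w where "w x = sqrt (1 + k * x\<^sup>2)" for x
  have p: "1 + k * x\<^sup>2 > 0" for x :: real using k by (simp add: add_pos_nonneg)
  have w: "w x > 0" and w2: "(w x)\<^sup>2 = 1 + k * x\<^sup>2" for x using p[of x] by (auto simp: w_def)
  define g where "g x = x / w x" for x
  define f where "f u = G u ^ q * max 0 (1 - k * u\<^sup>2) powr ((real q - 3) / 2)" for u
  have [measurable]: "f \<in> borel_measurable borel" "g \<in> borel_measurable borel" "w \<in> borel_measurable borel"
    unfolding f_def g_def w_def by measurable
  have dg: "(g has_real_derivative 1 / w x ^ 3) (at x)" for x
    using DERIV_slope[OF k, of x] by (simp add: g_def[abs_def] w_def)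
  have mono_g: "g x \<le> g y" if "x \<le> y" for x y
  proof (rule DERIV_nonneg_imp_nondecreasing[OF that])
    show "\<exists>y. (g has_real_derivative y) (at z) \<and> 0 \<le> y" for z
      using dg[of z] w[of z] by (intro exI[of _ "1 / w z ^ 3"]) (simp add: less_imp_le)
  qed
  have kg: "1 - k * (g x)\<^sup>2 = 1 / (w x)\<^sup>2" for x
  proof -
    have "(w x)\<^sup>2 * (1 - k * (g x)\<^sup>2) = (w x)\<^sup>2 - k * x\<^sup>2"
      using w[of x] by (simp add: g_def power_divide right_diff_distrib)
    also have "\<dots> = 1" by (simp add: w2)
    finally show ?thesis using w[of x] by (simp add: field_simps)
  qed
  have fg: "f (g x) * (1 / w x ^ 3) = (G (g x) / w x) ^ q" for x
  proof -
    have "max 0 (1 - k * (g x)\<^sup>2) powr ((real q - 3) / 2) = (w x powr (- 2)) powr ((real q - 3) / 2)"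
      using w[of x] by (simp add: kg powr_minus inverse_eq_divide powr_numeral)
    also have "\<dots> = w x powr (3 - real q)"
    proof -
      have "- 2 * ((real q - 3) / 2) = 3 - real q" by simp
      then show ?thesis by (simp only: powr_powr)
    qed
    also have "\<dots> = w x ^ 3 / w x ^ q"
      using w[of x] by (simp add: powr_diff powr_realpow)
    finally show ?thesis
      using w[of x] by (simp add: f_def power_divide)
  qed
  have lhs: "(\<integral>\<^sup>+\<sigma>. ennreal ((G (\<beta> * \<sigma> / sqrt (1 + \<alpha>\<^sup>2 * \<sigma>\<^sup>2)) / sqrt (1 + \<alpha>\<^sup>2 * \<sigma>\<^sup>2)) ^ q) \<partial>lborel)
    = ennreal (1 / \<beta>) * (\<integral>\<^sup>+x. ennreal ((G (g x) / w x) ^ q) \<partial>lborel)"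
  proof -
    have "(\<integral>\<^sup>+\<sigma>. ennreal ((G (\<beta> * \<sigma> / sqrt (1 + \<alpha>\<^sup>2 * \<sigma>\<^sup>2)) / sqrt (1 + \<alpha>\<^sup>2 * \<sigma>\<^sup>2)) ^ q) \<partial>lborel)
      = ennreal \<bar>1 / \<beta>\<bar> * (\<integral>\<^sup>+x. ennreal ((G (\<beta> * (0 + 1 / \<beta> * x) / sqrt (1 + \<alpha>\<^sup>2 * (0 + 1 / \<beta> * x)\<^sup>2))
          / sqrt (1 + \<alpha>\<^sup>2 * (0 + 1 / \<beta> * x)\<^sup>2)) ^ q) \<partial>lborel)"
      using \<beta> by (intro nn_integral_real_affine) auto
    moreover have "\<alpha>\<^sup>2 * (0 + 1 / \<beta> * x)\<^sup>2 = k * x\<^sup>2" for x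
      by (simp add: k_def power_divide)
    ultimately show ?thesis
      using \<beta> by (simp add: g_def w_def)
  qed
  \<comment> \<open>The change of variables is made on [-N, N]; monotone convergence then covers the
    whole line, the images of these intervals exhausting k u^2 < 1.\<close>
  have sub: "(\<integral>\<^sup>+u. ennreal (f u) * indicator {g (- real N)..g (real N)} u \<partial>lborel)
     = (\<integral>\<^sup>+x. ennreal ((G (g x) / w x) ^ q) * indicator {- real N..real N} x \<partial>lborel)" for N
  proof -
    have "(\<integral>\<^sup>+u. ennreal (f u * indicator {g (- real N)..g (real N)} u) \<partial>lborel)
     = (\<integral>\<^sup>+x. ennreal (f (g x) * (1 / w x ^ 3) * indicator {- real N..real N} x) \<partial>lborel)"
    proof (rule nn_integral_substitution)
      show "set_borel_measurable borel {g (- real N)..g (real N)} f"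
        unfolding set_borel_measurable_def by measurable
      show "continuous_on {- real N..real N} (\<lambda>x. 1 / w x ^ 3)"
      proof -
        have "sqrt (1 + k * x\<^sup>2) \<noteq> 0" for x using w[of x] by (simp add: w_def)
        then show ?thesis unfolding w_def by (intro continuous_intros ballI) simp_all
      qed
    qed (use dg w in \<open>auto simp: less_imp_le\<close>)
    then show ?thesis
      unfolding fg by (simp add: ennreal_mult'' ennreal_indicator)
  qed
  have "(\<lambda>N. \<integral>\<^sup>+u. ennreal (f u) * indicator {g (- real N)..g (real N)} u \<partial>lborel) \<longlonglongrightarrow> (\<integral>\<^sup>+u. ennreal (f u) \<partial>lborel)"
  proof (rule nn_integral_LIMSEQ)
    show "incseq (\<lambda>N u. ennreal (f u) * indicator {g (- real N)..g (real N)} u)"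
    proof (intro incseq_SucI le_funI mult_left_mono)
      fix N :: nat and u :: real
      have "g (- real (Suc N)) \<le> g (- real N)" "g (real N) \<le> g (real (Suc N))"
        by (intro mono_g, simp)+
      then show "(indicator {g (- real N)..g (real N)} u :: ennreal) \<le> indicator {g (- real (Suc N))..g (real (Suc N))} u"
        by (auto split: split_indicator)
    qed auto
    show "(\<lambda>N. ennreal (f u) * indicator {g (- real N)..g (real N)} u) \<longlonglongrightarrow> ennreal (f u)" for u
    proof (cases "k * u\<^sup>2 < 1")
      case True
      define x where "x = u / sqrt (1 - k * u\<^sup>2)"
      have "1 + k * x\<^sup>2 = 1 / (1 - k * u\<^sup>2)"
        using True by (simp add: x_def power_divide field_simps)
      then have gx: "g x = u"
        using True by (simp add: g_def w_def x_def real_sqrt_divide)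
      have "\<forall>\<^sub>F N in sequentially. ennreal (f u) * indicator {g (- real N)..g (real N)} u = ennreal (f u)"
        using eventually_ge_at_top[of "nat \<lceil>\<bar>x\<bar>\<rceil>"]
      proof eventually_elim
        case (elim N)
        then have "\<bar>x\<bar> \<le> real N" by linarith
        then have "g (- real N) \<le> g x" "g x \<le> g (real N)" by (intro mono_g, linarith)+
        then show ?case using gx by simp
      qed
      then show ?thesis by (rule tendsto_eventually)
    next
      case False
      \<comment> \<open>\<open>0 powr a\<close> is 0 for every exponent, so the endpoints k u^2 = 1
        cause no trouble even when the exponent is not positive.\<close>
      then have "f u = 0" by (simp add: f_def max_def)
      then show ?thesis by simp
    qed
  qed measurable
  moreover have "(\<lambda>N. \<integral>\<^sup>+x. ennreal ((G (g x) / w x) ^ q) * indicator {- real N..real N} x \<partial>lborel)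
      \<longlonglongrightarrow> (\<integral>\<^sup>+x. ennreal ((G (g x) / w x) ^ q) \<partial>lborel)"
  proof (rule nn_integral_LIMSEQ)
    show "incseq (\<lambda>N x. ennreal ((G (g x) / w x) ^ q) * indicator {- real N..real N} x)"
      by (intro incseq_SucI le_funI mult_left_mono) (auto split: split_indicator)
    show "(\<lambda>N. ennreal ((G (g x) / w x) ^ q) * indicator {- real N..real N} x) \<longlonglongrightarrow> ennreal ((G (g x) / w x) ^ q)" for x
    proof -
      have "\<forall>\<^sub>F N in sequentially. ennreal ((G (g x) / w x) ^ q) * indicator {- real N..real N} x = ennreal ((G (g x) / w x) ^ q)"
        using eventually_ge_at_top[of "nat \<lceil>\<bar>x\<bar>\<rceil>"]
      proof eventually_elim
        case (elim N)
        then have "\<bar>x\<bar> \<le> real N" by linarith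
        then show ?case by (auto simp: abs_le_iff)
      qed
      then show ?thesis by (rule tendsto_eventually)
    qed
  qed measurable
  ultimately have "(\<integral>\<^sup>+u. ennreal (f u) \<partial>lborel) = (\<integral>\<^sup>+x. ennreal ((G (g x) / w x) ^ q) \<partial>lborel)"
    unfolding sub by (rule LIMSEQ_unique)
  then show ?thesis unfolding lhs f_def k_def by simp
qed

section \<open>The common integrable majorant and the absolute constants built from its mass\<close>

lemma integrable_inverse_quadratic:
  fixes c :: real
  assumes "c > 0"
  shows "integrable lborel (\<lambda>x. 1 / (1 + c * x\<^sup>2))"
proof -
  have pos: "1 + x\<^sup>2 > 0" for x :: real by (simp add: add_pos_nonneg)
  have "(\<integral>\<^sup>+x. ennreal (1 / (1 + x\<^sup>2)) * indicator {0..} x \<partial>lborel) = pi / 2 - arctan 0"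
    by (rule nn_integral_FTC_atLeast)
       (auto intro!: derivative_eq_intros tendsto_arctan_at_top simp: power2_eq_square inverse_eq_divide)
  then have half: "(\<integral>\<^sup>+x. ennreal (1 / (1 + x\<^sup>2)) * indicator {0..} x \<partial>lborel) < \<infinity>" by simp
  have "(\<integral>\<^sup>+x. ennreal (1 / (1 + x\<^sup>2)) * indicator {..0} x \<partial>lborel)
      = (\<integral>\<^sup>+x. ennreal (1 / (1 + x\<^sup>2)) * indicator {0..} x \<partial>lborel)"
    by (subst nn_integral_real_affine[of _ "-1" 0]) (auto intro!: nn_integral_cong split: split_indicator)
  with half have "(\<integral>\<^sup>+x. ennreal (1 / (1 + x\<^sup>2)) * indicator {..0} x \<partial>lborel) + (\<integral>\<^sup>+x. ennreal (1 / (1 + x\<^sup>2)) * indicator {0..} x \<partial>lborel) < \<infinity>"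
    by simp
  also have "(\<integral>\<^sup>+x. ennreal (1 / (1 + x\<^sup>2)) * indicator {..0} x \<partial>lborel) + (\<integral>\<^sup>+x. ennreal (1 / (1 + x\<^sup>2)) * indicator {0..} x \<partial>lborel)
     = (\<integral>\<^sup>+x. ennreal (1 / (1 + x\<^sup>2)) * indicator {..0} x + ennreal (1 / (1 + x\<^sup>2)) * indicator {0..} x \<partial>lborel)"
    by (rule nn_integral_add[symmetric]) auto
  finally have "(\<integral>\<^sup>+x. ennreal (1 / (1 + x\<^sup>2)) * indicator {..0} x + ennreal (1 / (1 + x\<^sup>2)) * indicator {0..} x \<partial>lborel) < \<infinity>" .
  moreover have "(\<integral>\<^sup>+x. ennreal (1 / (1 + x\<^sup>2)) \<partial>lborel) \<le>
     (\<integral>\<^sup>+x. ennreal (1 / (1 + x\<^sup>2)) * indicator {..0} x + ennreal (1 / (1 + x\<^sup>2)) * indicator {0..} x \<partial>lborel)"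
    by (intro nn_integral_mono) (auto split: split_indicator)
  ultimately have fin: "(\<integral>\<^sup>+x. ennreal (1 / (1 + x\<^sup>2)) \<partial>lborel) < \<infinity>" by (rule le_less_trans[rotated])
  have "integrable lborel (\<lambda>x::real. 1 / (1 + x\<^sup>2))"
    using fin pos by (intro integrableI_nonneg) (auto simp: less_imp_le)
  from lborel_integrable_real_affine[OF this, of "sqrt c" 0] assms
  show ?thesis by (simp add: power_mult_distrib)
qed

text \<open>The value is \<pi>. It is the mass of the majorant of all moment integrands in
  \<open>moment_bounds\<close> and so enters every constant derived from them.\<close>

definition cauchy_mass :: real where
  "cauchy_mass = (\<integral>x. 1 / (1 + x\<^sup>2) \<partial>lborel)"

lemma integral_scaled_cauchy:
  fixes t :: real
  assumes "t > 0"
  shows "integrable lborel (\<lambda>x. 1 / (1 + (x / t)\<^sup>2))"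
    and "(\<integral>x. 1 / (1 + (x / t)\<^sup>2) \<partial>lborel) = t * cauchy_mass"
proof -
  show "integrable lborel (\<lambda>x. 1 / (1 + (x / t)\<^sup>2))"
    using integrable_inverse_quadratic[of "1 / t\<^sup>2"] assms by (simp add: power_divide)
  have "cauchy_mass = \<bar>1 / t\<bar> *\<^sub>R (\<integral>x. 1 / (1 + (0 + 1 / t * x)\<^sup>2) \<partial>lborel)"
    unfolding cauchy_mass_def using assms by (intro lborel_integral_real_affine) auto
  then show "(\<integral>x. 1 / (1 + (x / t)\<^sup>2) \<partial>lborel) = t * cauchy_mass"
    using assms by (simp add: field_simps)
qed

lemma cauchy_mass_pos: "cauchy_mass > 0"
proof -
  have "0 < (\<integral>x. 1 / 2 * indicator {0..1::real} x \<partial>lborel :: real)" by simp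
  also have "\<dots> \<le> cauchy_mass"
    unfolding cauchy_mass_def
  proof (rule integral_mono)
    show "integrable lborel (\<lambda>x::real. 1 / (1 + x\<^sup>2))"
      using integrable_inverse_quadratic[of 1] by simp
    show "1 / 2 * indicator {0..1} x \<le> 1 / (1 + x\<^sup>2)" for x :: real
    proof (cases "x \<in> {0..1}")
      case True
      then have "x\<^sup>2 \<le> 1" by (intro power_le_one) auto
      moreover have "0 < 1 + x\<^sup>2" by (simp add: add_pos_nonneg)
      ultimately show ?thesis using True by (simp add: field_simps)
    qed (simp add: add_nonneg_nonneg)
  qed simp
  finally show ?thesis .
qed

text \<open>Write D = 2 * 12^6 * \<open>cauchy_mass\<close>, the constant of
  \<open>moment_bounds\<close>. There \<open>moment 4 * moment 0\<close> is at most D^2 t^6, while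
  \<open>moment 2\<close> is at least 2/9 t^3; this gives the ratio 81 D^2 / 4. It is halved by the
  coefficient of the quadratic term in \<open>exp_minus_upper\<close>.\<close>

definition upper_const :: real where
  "upper_const = 81 * (2 * 12 ^ 6 * cauchy_mass)\<^sup>2 / 8"

text \<open>With the same D, the product with 27 D / 8 is 1/6. The number 27 D / 8 bounds
  \<open>moment 2\<close> by the cube of \<open>moment 0\<close>, and 1/6 is the coefficient of d
  m^2 M^2 in the quantity \<open>k * L\<^sup>2\<close> of the bathtub estimate.\<close>

definition decay_const :: real where
  "decay_const = 4 / (81 * (2 * 12 ^ 6 * cauchy_mass))"

section \<open>Elementary estimates for the kernel and the exponential\<close>

lemma kernel_lower:
  fixes z d :: real
  assumes "z \<ge> 0" "d \<ge> 1"
  shows "1 - d * z \<le> max 0 (1 - z) powr d"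
proof (cases "z < 1")
  case True
  have "(1 - 0) powr d - 1 + d * 0 \<le> (1 - z) powr d - 1 + d * z"
  proof (rule DERIV_nonneg_imp_nondecreasing[OF assms(1)])
    fix x assume x: "0 \<le> x" "x \<le> z"
    have "((\<lambda>x. (1 - x) powr d - 1 + d * x) has_real_derivative d * (1 - (1 - x) powr (d - 1))) (at x)"
      using x True by (auto intro!: derivative_eq_intros simp: algebra_simps)
    moreover have "(1 - x) powr (d - 1) \<le> 1 powr (d - 1)"
      using x True assms by (intro powr_mono2) auto
    ultimately show "\<exists>y. ((\<lambda>x. (1 - x) powr d - 1 + d * x) has_real_derivative y) (at x) \<and> 0 \<le> y"
      using assms by (intro exI[of _ "d * (1 - (1 - x) powr (d - 1))"]) auto
  qed
  then show ?thesis using True by simp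
next
  case False
  then have "1 * 1 \<le> d * z" using assms by (intro mult_mono) auto
  then show ?thesis using False by simp
qed

lemma kernel_upper:
  fixes z d :: real
  assumes "z \<ge> 0" "d \<ge> 1"
  shows "max 0 (1 - z) powr d \<le> exp (- (d * z))"
proof -
  have "max 0 (1 - z) powr d \<le> exp (- z) powr d"
    using exp_ge_add_one_self[of "- z"] assms by (intro powr_mono2) (auto simp: max_def)
  then show ?thesis by (simp add: exp_powr_real mult.commute)
qed

lemma exp_minus_upper:
  fixes y :: real
  assumes "y \<ge> 0"
  shows "exp (- y) \<le> 1 - y + y\<^sup>2 / 2"
proof -
  have "(1 - 0 + 0\<^sup>2 / 2) - exp (- 0) \<le> (1 - y + y\<^sup>2 / 2) - exp (- y)"
  proof (rule DERIV_nonneg_imp_nondecreasing[OF assms])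
    fix x :: real assume "0 \<le> x"
    have "((\<lambda>x. 1 - x + x\<^sup>2 / 2 - exp (- x)) has_real_derivative (- 1 + x + exp (- x))) (at x)"
      by (auto intro!: derivative_eq_intros)
    moreover have "0 \<le> - 1 + x + exp (- x)" using exp_ge_add_one_self[of "- x"] by simp
    ultimately show "\<exists>y. ((\<lambda>x. 1 - x + x\<^sup>2 / 2 - exp (- x)) has_real_derivative y) (at x) \<and> 0 \<le> y"
      by blast
  qed
  then show ?thesis by simp
qed

text \<open>The inequality exp(2y/3) >= 1 + 2y/3 raised to the power 3/2. The cube is dictated by
  \<open>DERIV_slope\<close>: for y proportional to x^2 the right-hand side has an elementary
  antiderivative, unlike the Gaussian.\<close>

lemma exp_minus_le_slope:
  fixes y :: real
  assumes "y \<ge> 0"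
  shows "exp (- y) \<le> 1 / (sqrt (1 + 2 * y / 3)) ^ 3"
proof -
  have "sqrt (1 + 2 * y / 3) \<le> sqrt (exp (y / 3 + y / 3))"
    using exp_ge_add_one_self[of "2 * y / 3"] by (intro real_sqrt_le_mono) simp
  also have "\<dots> = exp (y / 3)" by (subst exp_add) simp
  finally have "(sqrt (1 + 2 * y / 3)) ^ 3 \<le> exp (y / 3) ^ 3"
    using assms by (intro power_mono) auto
  also have "\<dots> = exp y" by (simp add: exp_of_nat_mult[symmetric])
  finally have "1 / exp y \<le> 1 / (sqrt (1 + 2 * y / 3)) ^ 3"
    using assms by (intro divide_left_mono) (auto intro!: mult_pos_pos zero_less_power)
  then show ?thesis by (simp add: exp_minus inverse_eq_divide)
qed

text \<open>\<open>\<psi>\<close> models the reciprocal of a profile, that is, the gauge of a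
  symmetric convex body of revolution on the points (m, 1); \<open>coercive\<close> reflects
  boundedness. \<open>q\<close> is the dimension n - 1 of a hyperplane.\<close>

locale even_convex_profile =
  fixes \<psi> :: "real \<Rightarrow> real" and q :: nat
  assumes convex: "convex_on UNIV \<psi>" and even: "\<And>x. \<psi> (- x) = \<psi> x" and pos: "\<psi> 0 > 0"
    and coercive: "\<exists>c>0. \<forall>x. c * \<bar>x\<bar> \<le> \<psi> x" and q: "q \<ge> 12"
begin

lemma psi_ge: "\<psi> 0 \<le> \<psi> x"
  using convex_onD[OF convex, of "1/2" x "- x"] by (simp add: even)

lemma psi_pos: "\<psi> x > 0"
  using psi_ge[of x] pos by linarith

lemma psi_abs: "\<psi> \<bar>x\<bar> = \<psi> x"
  by (simp add: abs_if even)

text \<open>Used in two directions: as an upper bound at \<open>s\<close> it yields monotonicity in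
  the absolute value, and solved for \<open>\<psi> x\<close> it yields linear growth beyond a point
  where \<open>\<psi>\<close> has risen above \<open>\<psi> 0\<close>.\<close>

lemma psi_chord:
  assumes "0 < x" "0 \<le> s" "s \<le> x"
  shows "x * \<psi> s \<le> s * \<psi> x + (x - s) * \<psi> 0"
proof -
  have "\<psi> s \<le> (1 - s / x) * \<psi> 0 + s / x * \<psi> x"
    using convex_onD[OF convex, of "s / x" 0 x] assms by simp
  then have "x * \<psi> s \<le> x * ((1 - s / x) * \<psi> 0 + s / x * \<psi> x)"
    using assms by (intro mult_left_mono) auto
  also have "\<dots> = s * \<psi> x + (x - s) * \<psi> 0"
    using assms by (simp add: field_simps)
  finally show ?thesis .
qed

lemma psi_mono:
  assumes "\<bar>s\<bar> \<le> \<bar>x\<bar>" shows "\<psi> s \<le> \<psi> x"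
proof (cases "x = 0")
  case False
  have "\<bar>x\<bar> * \<psi> \<bar>s\<bar> \<le> \<bar>s\<bar> * \<psi> \<bar>x\<bar> + (\<bar>x\<bar> - \<bar>s\<bar>) * \<psi> 0"
    using False assms by (intro psi_chord) auto
  also have "\<dots> \<le> \<bar>s\<bar> * \<psi> \<bar>x\<bar> + (\<bar>x\<bar> - \<bar>s\<bar>) * \<psi> \<bar>x\<bar>"
    using assms by (intro add_left_mono mult_left_mono psi_ge) auto
  also have "\<dots> = \<bar>x\<bar> * \<psi> \<bar>x\<bar>" by (simp add: algebra_simps)
  finally show ?thesis using False by (simp add: psi_abs)
qed (use assms in auto)

lemma psi_continuous: "continuous_on A \<psi>"
  using convex_on_continuous[OF open_UNIV convex] continuous_on_subset by blast

lemma psi_measurable [measurable]: "\<psi> \<in> borel_measurable borel"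
  by (intro borel_measurable_continuous_onI psi_continuous)

section \<open>The normalised weight and its moments\<close>

definition weight :: "real \<Rightarrow> real" where
  "weight x = (\<psi> 0 / \<psi> x) ^ q"

lemma weight_measurable [measurable]: "weight \<in> borel_measurable borel"
  unfolding weight_def by measurable

lemma weight_pos: "weight x > 0"
  using pos psi_pos by (simp add: weight_def)

lemma weight_le_1: "weight x \<le> 1"
  unfolding weight_def using pos psi_pos[of x] psi_ge[of x] by (intro power_le_one) auto

text \<open>The width \<open>t\<close> is where \<open>\<psi>\<close> has grown by the factor 1 +
  1/q, so the weight there is at least 1/e. Beyond \<open>t\<close>, extending the chord from 0
  gives \<open>\<psi> x / \<psi> 0\<close> at least 1 + |x| / (t q), whose q-th power beats a fixed
  power of |x| / t uniformly in q.\<close>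

lemma weight_bounds:
  obtains t where "t > 0" "\<And>x. \<bar>x\<bar> \<le> t \<Longrightarrow> 1 / 3 \<le> weight x"
    "\<And>x. t \<le> \<bar>x\<bar> \<Longrightarrow> weight x \<le> (12 * t / \<bar>x\<bar>) ^ 6"
proof -
  define v where "v = \<psi> 0 * (1 + 1 / real q)"
  obtain c where c: "c > 0" "\<And>x. c * \<bar>x\<bar> \<le> \<psi> x" using coercive by blast
  have v: "v > 0" "\<psi> 0 < v" using pos q by (auto simp: v_def intro!: mult_pos_pos add_pos_nonneg)
  have "v \<le> \<psi> (v / c)" using c(2)[of "v / c"] c(1) v by simp
  then obtain t where t: "0 \<le> t" "\<psi> t = v"
    using IVT'[of \<psi> 0 v "v / c"] v c psi_continuous by (auto simp: less_imp_le)
  then have t0: "t > 0" using v by (cases "t = 0") auto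
  show thesis
  proof
    show "t > 0" by fact
    show "1 / 3 \<le> weight x" if "\<bar>x\<bar> \<le> t" for x
    proof -
      have "(1 + 1 / real q) ^ q \<le> exp (1 / real q) ^ q"
        by (intro power_mono) auto
      also have "\<dots> = exp 1" using q by (simp add: exp_of_nat_mult[symmetric])
      also have "\<dots> \<le> 3" by (rule exp_le)
      finally have "1 / 3 \<le> 1 / (1 + 1 / real q) ^ q"
        using q by (simp add: field_simps)
      also have "\<dots> = (\<psi> 0 / \<psi> t) ^ q" using pos by (simp add: t v_def power_divide)
      also have "\<dots> \<le> weight x"
        unfolding weight_def using psi_mono[of x t] that pos psi_pos[of x] psi_pos[of t] t0
        by (intro power_mono divide_left_mono) auto
      finally show ?thesis .
    qed
    show "weight x \<le> (12 * t / \<bar>x\<bar>) ^ 6" if x: "t \<le> \<bar>x\<bar>" for x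
    proof -
      define y where "y = \<bar>x\<bar> / t"
      have y: "y > 0" using t0 x by (simp add: y_def)
      have "\<bar>x\<bar> * \<psi> t \<le> t * \<psi> \<bar>x\<bar> + (\<bar>x\<bar> - t) * \<psi> 0"
        using x t0 by (intro psi_chord) auto
      then have "\<psi> 0 * (1 + y / real q) * t \<le> \<psi> x * t"
        using t0 by (simp add: t v_def y_def psi_abs algebra_simps)
      then have "\<psi> 0 * (1 + y / real q) \<le> \<psi> x" using t0 by simp
      then have "\<psi> 0 / \<psi> x \<le> 1 / (1 + y / real q)"
        using psi_pos[of x] y pos by (simp add: field_simps add_pos_nonneg)
      then have "weight x \<le> (1 / (1 + y / real q)) ^ q"
        unfolding weight_def using pos psi_pos[of x] by (intro power_mono) auto
      also have "\<dots> \<le> (12 / y) ^ 6"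
      proof -
        \<comment> \<open>Bernoulli on each of six blocks of \<open>k\<close> factors gives at least
          y / 12 per block, because \<open>q\<close> is at most 12 k. The sixth power is enough for
          moments up to order 4: it leaves y^(-2), which is integrable.\<close>
        define k where "k = q div 6"
        have k: "6 * k \<le> q" "real q \<le> 12 * real k" using q by (auto simp: k_def) 
        have "y / 12 \<le> real k * (y / real q)"
          using k y q by (simp add: field_simps)
        also have "\<dots> \<le> (1 + y / real q) ^ k"
        proof -
          have "0 \<le> y / real q" using y by simp
          then have "- 1 \<le> y / real q" by linarith
          from Bernoulli_inequality[OF this, of k] show ?thesis by linarith
        qed
        finally have "(y / 12) ^ 6 \<le> ((1 + y / real q) ^ k) ^ 6"
          using y by (intro power_mono) auto
        also have "\<dots> = (1 + y / real q) ^ (6 * k)" by (simp add: power_mult[symmetric] mult.commute)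
        also have "\<dots> \<le> (1 + y / real q) ^ q" using k y by (intro power_increasing) auto
        finally have "1 / (1 + y / real q) ^ q \<le> 1 / (y / 12) ^ 6"
          using y by (intro divide_left_mono) (auto intro!: mult_pos_pos zero_less_power add_pos_nonneg)
        then show ?thesis by (simp add: power_divide)
      qed
      finally show ?thesis using y by (simp add: y_def)
    qed
  qed
qed

definition moment :: "nat \<Rightarrow> real" where
  "moment k = (\<integral>x. x ^ k * weight x \<partial>lborel)"

text \<open>In the variable |x| / t all integrands lie below one Cauchy density: the weight is at
  most 1 inside the width and decays like the sixth power outside. The lower bounds use only the
  part of the weight on [-t, t], where it is at least 1/3.\<close>

lemma moment_bounds:
  defines "D \<equiv> 2 * 12 ^ 6 * cauchy_mass"
  obtains t where "t > 0"
    "\<forall>k\<in>{0, 2, 4}. integrable lborel (\<lambda>x. x ^ k * weight x)"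
    "\<forall>k\<in>{0, 2, 4}. moment k \<le> D * t ^ Suc k"
    "2 / 3 * t \<le> moment 0" "2 / 9 * t ^ 3 \<le> moment 2"
proof -
  obtain t where t: "t > 0" "\<And>x. \<bar>x\<bar> \<le> t \<Longrightarrow> 1 / 3 \<le> weight x"
    "\<And>x. t \<le> \<bar>x\<bar> \<Longrightarrow> weight x \<le> (12 * t / \<bar>x\<bar>) ^ 6"
    using weight_bounds by metis
  have bnd: "\<bar>x\<bar> ^ k * weight x \<le> 2 * 12 ^ 6 * t ^ k * (1 / (1 + (x / t)\<^sup>2))" if k: "k \<le> 4" for x k
  proof -
    define y where "y = \<bar>x\<bar> / t"
    have y: "y \<ge> 0" "\<bar>x\<bar> = t * y" using t(1) by (auto simp: y_def)
    have y2: "(x / t)\<^sup>2 = y\<^sup>2" by (simp add: y_def power_divide)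
    have "y ^ k * weight x \<le> 2 * 12 ^ 6 * (1 / (1 + y\<^sup>2))"
    proof (cases "y \<le> 1")
      case True
      have "y ^ k * weight x \<le> 1 * 1"
        using True y weight_le_1[of x] weight_pos[of x] by (intro mult_mono power_le_one) (auto simp: less_imp_le)
      also have "\<dots> \<le> 2 * 12 ^ 6 * (1 / (1 + y\<^sup>2))"
      proof -
        have "y\<^sup>2 \<le> 1" using True y by (intro power_le_one) auto
        moreover have "0 < 1 + y\<^sup>2" by (simp add: add_pos_nonneg)
        ultimately show ?thesis by (simp add: field_simps)
      qed
      finally show ?thesis .
    next
      case False
      then have y1: "y > 1" by simp
      then have "t \<le> \<bar>x\<bar>" using t(1) by (simp add: y(2))
      then have d: "weight x \<le> (12 / y) ^ 6" using t(3)[of x] t(1) by (simp add: y(2))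
      have "y ^ k * weight x \<le> y ^ 4 * (12 / y) ^ 6"
        using y1 d k weight_pos[of x] by (intro mult_mono power_increasing) (auto simp: less_imp_le)
      also have "\<dots> = 12 ^ 6 * (1 / y\<^sup>2)"
        using y1 by (simp add: field_simps power_divide power_add[symmetric])
      also have "\<dots> \<le> 12 ^ 6 * (2 / (1 + y\<^sup>2))"
      proof (intro mult_left_mono)
        have "1 \<le> y\<^sup>2" using y1 by (simp add: one_le_power)
        then have "2 / (y\<^sup>2 + y\<^sup>2) \<le> 2 / (1 + y\<^sup>2)"
          by (intro divide_left_mono) (auto intro!: mult_pos_pos add_pos_pos)
        then show "1 / y\<^sup>2 \<le> 2 / (1 + y\<^sup>2)" by simp
      qed simp
      finally show ?thesis by simp
    qed
    then have "t ^ k * (y ^ k * weight x) \<le> t ^ k * (2 * 12 ^ 6 * (1 / (1 + y\<^sup>2)))"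
      using t(1) by (intro mult_left_mono) auto
    then show ?thesis unfolding y2 by (simp add: y(2) power_mult_distrib mult_ac)
  qed
  note int_c = integral_scaled_cauchy[OF t(1)]
  have ev: "x ^ k = \<bar>x\<bar> ^ k" if "k \<in> {0, 2, 4}" for k and x :: real
    using that by (auto simp: power_even_abs)
  have int: "integrable lborel (\<lambda>x. x ^ k * weight x)" if k: "k \<in> {0, 2, 4}" for k
  proof (rule Bochner_Integration.integrable_bound)
    show "integrable lborel (\<lambda>x. 2 * 12 ^ 6 * t ^ k * (1 / (1 + (x / t)\<^sup>2)))"
      using int_c by (intro integrable_mult_right)
    show "AE x in lborel. norm (x ^ k * weight x) \<le> norm (2 * 12 ^ 6 * t ^ k * (1 / (1 + (x / t)\<^sup>2)))"
    proof (rule AE_I2)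
      fix x :: real
      have "norm (x ^ k * weight x) = \<bar>x\<bar> ^ k * weight x"
        using weight_pos[of x] by (simp add: abs_mult power_abs)
      also have "\<dots> \<le> 2 * 12 ^ 6 * t ^ k * (1 / (1 + (x / t)\<^sup>2))"
        using k by (intro bnd) auto
      also have "\<dots> \<le> norm \<dots>" unfolding real_norm_def by (rule abs_ge_self)
      finally show "norm (x ^ k * weight x) \<le> norm (2 * 12 ^ 6 * t ^ k * (1 / (1 + (x / t)\<^sup>2)))" .
    qed
  qed measurable
  show thesis
  proof
    show "t > 0" by fact
    show "\<forall>k\<in>{0, 2, 4}. integrable lborel (\<lambda>x. x ^ k * weight x)"
      using int by blast
    show "\<forall>k\<in>{0, 2, 4}. moment k \<le> D * t ^ Suc k"
    proof
      fix k :: nat assume k: "k \<in> {0, 2, 4}"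
      have "moment k \<le> (\<integral>x. 2 * 12 ^ 6 * t ^ k * (1 / (1 + (x / t)\<^sup>2)) \<partial>lborel)"
        unfolding moment_def
      proof (rule integral_mono)
        show "integrable lborel (\<lambda>x. 2 * 12 ^ 6 * t ^ k * (1 / (1 + (x / t)\<^sup>2)))"
          using int_c by (intro integrable_mult_right)
        show "x ^ k * weight x \<le> 2 * 12 ^ 6 * t ^ k * (1 / (1 + (x / t)\<^sup>2))" for x
        proof -
          have "k \<le> 4" using k by auto
          from bnd[OF this, of x] show ?thesis by (simp only: ev[OF k, of x])
        qed
      qed (rule int[OF k])
      also have "\<dots> = 2 * 12 ^ 6 * t ^ k * (t * cauchy_mass)"
        unfolding int_c(2)[symmetric] by (rule integral_mult_right_zero)
      finally show "moment k \<le> D * t ^ Suc k" by (simp add: D_def mult_ac)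
    qed
    have low: "(F t - F (- t)) / 3 \<le> moment k"
      if k: "k \<in> {0, 2, 4}" and F: "\<And>x. (F has_real_derivative x ^ k) (at x)" for F k
    proof -
      have nn: "0 \<le> x ^ k" for x :: real using ev[OF k, of x] by simp
      have "(F t - F (- t)) / 3 = (\<integral>x. (x ^ k * indicator {- t..t} x) / 3 \<partial>lborel)"
        using t(1) by (subst Bochner_Integration.integral_divide_zero, subst integral_FTC_Icc_nonneg[of _ _ _ F])
          (auto intro!: F nn)
      also have "\<dots> \<le> moment k"
        unfolding moment_def
      proof (rule integral_mono)
        show "integrable lborel (\<lambda>x. (x ^ k * indicator {- t..t} x) / 3)"
          using t(1) by (intro Bochner_Integration.integrable_divide_zero integrable_FTC_Icc_nonneg[of _ _ _ F]) (auto intro!: F nn)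
        show "(x ^ k * indicator {- t..t} x) / 3 \<le> x ^ k * weight x" for x
        proof (cases "x \<in> {- t..t}")
          case True
          then have "1 / 3 \<le> weight x" by (intro t(2)) auto
          from mult_left_mono[OF this nn[of x]] True show ?thesis by simp
        next
          case False
          then show ?thesis using nn[of x] weight_pos[of x] by (simp add: less_imp_le)
        qed
      qed (rule int[OF k])
      finally show ?thesis .
    qed
    have "(t - (- t)) / 3 \<le> moment 0"
      by (rule low[of 0 "\<lambda>x. x"]) (auto intro!: derivative_eq_intros)
    then show "2 / 3 * t \<le> moment 0" by simp
    have "(t ^ 3 / 3 - (- t) ^ 3 / 3) / 3 \<le> moment 2"
      by (rule low[of 2 "\<lambda>x. x ^ 3 / 3"]) (auto intro!: derivative_eq_intros)
    then show "2 / 9 * t ^ 3 \<le> moment 2" by (simp add: power3_eq_cube)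
  qed
qed

section \<open>The transform: quadratic approximation and decay\<close>

definition kernel_exponent :: real where
  "kernel_exponent = (real q - 3) / 2"

text \<open>The integral J of the overview divided by its factor \<open>(1 / \<psi> 0) ^ q\<close>.
  The normalisation bounds the weight by 1, which the bathtub estimate requires.\<close>

definition transform :: "real \<Rightarrow> real" where
  "transform m = (\<integral>u. weight u * max 0 (1 - m\<^sup>2 * u\<^sup>2) powr kernel_exponent \<partial>lborel)"

lemma kernel_exponent_ge_1: "kernel_exponent \<ge> 1"
  using q by (simp add: kernel_exponent_def)

lemma transform_integrable:
  "integrable lborel (\<lambda>u. weight u * max 0 (1 - m\<^sup>2 * u\<^sup>2) powr kernel_exponent)"
proof (rule Bochner_Integration.integrable_bound)
  show "integrable lborel weight"
  proof (rule moment_bounds)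
    assume "\<forall>k\<in>{0, 2, 4}. integrable lborel (\<lambda>x. x ^ k * weight x)"
    then show ?thesis by force
  qed
  show "AE u in lborel. norm (weight u * max 0 (1 - m\<^sup>2 * u\<^sup>2) powr kernel_exponent) \<le> norm (weight u)"
  proof (rule AE_I2)
    fix u :: real
    have "max 0 (1 - m\<^sup>2 * u\<^sup>2) powr kernel_exponent \<le> 1 powr kernel_exponent"
      using kernel_exponent_ge_1 by (intro powr_mono2) auto
    then have "weight u * max 0 (1 - m\<^sup>2 * u\<^sup>2) powr kernel_exponent \<le> weight u"
      using weight_pos[of u] by (simp add: mult_left_le)
    then show "norm (weight u * max 0 (1 - m\<^sup>2 * u\<^sup>2) powr kernel_exponent) \<le> norm (weight u)"
      using weight_pos[of u] by (simp add: abs_mult)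
  qed
qed measurable

text \<open>The first two bounds pin down the quadratic term: Bernoulli below, the expansion of the
  exponential above, with the fourth moment controlled by the square of the second. The quartic
  bound is useless for large \<open>m\<close>, so the third one supplies decay for the tail.
  \<open>M\<close> is the mass of the weight and \<open>\<mu>\<close> is
  \<open>kernel_exponent\<close> times its second moment divided by \<open>M\<close>.\<close>

lemma transform_bounds:
  obtains M \<mu> where "M > 0" "\<mu> > 0"
    "\<forall>m. M * (1 - \<mu> * m\<^sup>2) \<le> transform m \<and>
       transform m \<le> M * (1 - \<mu> * m\<^sup>2 + upper_const * (\<mu> * m\<^sup>2)\<^sup>2) \<and>
       transform m \<le> M / sqrt (1 + decay_const * (\<mu> * m\<^sup>2))"
proof -
  define D where "D = 2 * 12 ^ 6 * cauchy_mass"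
  have D: "D > 0" using cauchy_mass_pos by (simp add: D_def)
  obtain t where t: "t > 0"
    and int: "\<forall>k\<in>{0, 2, 4}. integrable lborel (\<lambda>x. x ^ k * weight x)"
    and up: "\<forall>k\<in>{0, 2, 4}. moment k \<le> D * t ^ Suc k"
    and lo: "2 / 3 * t \<le> moment 0" "2 / 9 * t ^ 3 \<le> moment 2"
    by (rule moment_bounds[folded D_def])
  define M where "M = moment 0"
  define \<mu>\<^sub>2 where "\<mu>\<^sub>2 = moment 2 / M"
  define d where "d = kernel_exponent"
  have d: "d \<ge> 1" using kernel_exponent_ge_1 by (simp add: d_def)
  have M: "M > 0" using lo(1) t by (simp add: M_def)
  have m2: "moment 2 > 0" using lo(2) t by (intro less_le_trans[OF _ lo(2)]) simp
  have int0: "integrable lborel weight" and int2: "integrable lborel (\<lambda>x. x\<^sup>2 * weight x)"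
    and int4: "integrable lborel (\<lambda>x. x ^ 4 * weight x)"
    using int by force+
  have M0: "M = (\<integral>x. weight x \<partial>lborel)" by (simp add: M_def moment_def)
  have M2: "(\<integral>x. x\<^sup>2 * weight x \<partial>lborel) = \<mu>\<^sub>2 * M" using M by (simp add: \<mu>\<^sub>2_def moment_def)
  show thesis
  proof
    show "M > 0" by fact
    show "d * \<mu>\<^sub>2 > 0" using d M m2 by (simp add: \<mu>\<^sub>2_def)
    show "\<forall>m. M * (1 - d * \<mu>\<^sub>2 * m\<^sup>2) \<le> transform m \<and>
       transform m \<le> M * (1 - d * \<mu>\<^sub>2 * m\<^sup>2 + upper_const * (d * \<mu>\<^sub>2 * m\<^sup>2)\<^sup>2) \<and>
       transform m \<le> M / sqrt (1 + decay_const * (d * \<mu>\<^sub>2 * m\<^sup>2))"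
    proof (intro allI conjI)
      fix m :: real
      define s where "s = d * \<mu>\<^sub>2 * m\<^sup>2"
      have "s \<ge> 0" using d M m2 by (simp add: s_def \<mu>\<^sub>2_def)
      have I1: "(\<integral>u. weight u - d * m\<^sup>2 * (u\<^sup>2 * weight u) \<partial>lborel) = M - d * m\<^sup>2 * (\<mu>\<^sub>2 * M)"
        using int0 int2 by (subst Bochner_Integration.integral_diff) (auto simp: M0[symmetric] M2)
      have "M * (1 - s) = (\<integral>u. weight u - d * m\<^sup>2 * (u\<^sup>2 * weight u) \<partial>lborel)"
        unfolding I1 by (simp add: s_def algebra_simps)
      also have "\<dots> \<le> transform m"
        unfolding transform_def
      proof (rule integral_mono)
        show "integrable lborel (\<lambda>u. weight u - d * m\<^sup>2 * (u\<^sup>2 * weight u))"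
          using int0 int2 by auto
        show "integrable lborel (\<lambda>u. weight u * max 0 (1 - m\<^sup>2 * u\<^sup>2) powr kernel_exponent)"
          by (rule transform_integrable)
        fix u :: real
        have "1 - d * (m\<^sup>2 * u\<^sup>2) \<le> max 0 (1 - m\<^sup>2 * u\<^sup>2) powr kernel_exponent"
          unfolding d_def[symmetric] by (rule kernel_lower) (use d in auto)
        then have "weight u * (1 - d * (m\<^sup>2 * u\<^sup>2)) \<le> weight u * max 0 (1 - m\<^sup>2 * u\<^sup>2) powr kernel_exponent"
          using weight_pos[of u] by (intro mult_left_mono) auto
        then show "weight u - d * m\<^sup>2 * (u\<^sup>2 * weight u) \<le> weight u * max 0 (1 - m\<^sup>2 * u\<^sup>2) powr kernel_exponent"
          by (simp add: algebra_simps)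
      qed
      finally show "M * (1 - d * \<mu>\<^sub>2 * m\<^sup>2) \<le> transform m" by (simp add: s_def)
      have "transform m \<le> (\<integral>u. weight u - d * m\<^sup>2 * (u\<^sup>2 * weight u) + (d * m\<^sup>2)\<^sup>2 / 2 * (u ^ 4 * weight u) \<partial>lborel)"
        unfolding transform_def
      proof (rule integral_mono)
        show "integrable lborel (\<lambda>u. weight u - d * m\<^sup>2 * (u\<^sup>2 * weight u) + (d * m\<^sup>2)\<^sup>2 / 2 * (u ^ 4 * weight u))"
          using int0 int2 int4 by auto
        show "integrable lborel (\<lambda>u. weight u * max 0 (1 - m\<^sup>2 * u\<^sup>2) powr kernel_exponent)"
          by (rule transform_integrable)
        fix u :: real
        have "max 0 (1 - m\<^sup>2 * u\<^sup>2) powr kernel_exponent \<le> 1 - d * (m\<^sup>2 * u\<^sup>2) + (d * (m\<^sup>2 * u\<^sup>2))\<^sup>2 / 2"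
          unfolding d_def[symmetric] using d by (intro order_trans[OF kernel_upper exp_minus_upper]) auto
        then have "weight u * max 0 (1 - m\<^sup>2 * u\<^sup>2) powr kernel_exponent
            \<le> weight u * (1 - d * (m\<^sup>2 * u\<^sup>2) + (d * (m\<^sup>2 * u\<^sup>2))\<^sup>2 / 2)"
          using weight_pos[of u] by (intro mult_left_mono) auto
        also have "\<dots> = weight u - d * m\<^sup>2 * (u\<^sup>2 * weight u) + (d * m\<^sup>2)\<^sup>2 / 2 * (u ^ 4 * weight u)"
          by (simp add: algebra_simps power_mult_distrib)
        finally show "weight u * max 0 (1 - m\<^sup>2 * u\<^sup>2) powr kernel_exponent
            \<le> weight u - d * m\<^sup>2 * (u\<^sup>2 * weight u) + (d * m\<^sup>2)\<^sup>2 / 2 * (u ^ 4 * weight u)" .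
      qed
      also have "\<dots> = M * (1 - s) + (d * m\<^sup>2)\<^sup>2 / 2 * moment 4"
      proof -
        have "(\<integral>u. weight u - d * m\<^sup>2 * (u\<^sup>2 * weight u) \<partial>lborel) = M * (1 - s)"
          unfolding I1 by (simp add: s_def algebra_simps)
        then show ?thesis
          using int0 int2 int4 by (subst Bochner_Integration.integral_add) (auto simp: moment_def)
      qed
      also have "\<dots> \<le> M * (1 - s) + M * (upper_const * s\<^sup>2)"
      proof -
        have "moment 4 * M \<le> (D * t ^ 5) * (D * t)"
          using bspec[OF up, of 4] bspec[OF up, of 0] M t D unfolding M_def by (intro mult_mono) auto
        also have "\<dots> = 81 * D\<^sup>2 / 4 * (2 / 9 * t ^ 3)\<^sup>2"
          by (simp add: power2_eq_square power3_eq_cube) (simp add: eval_nat_numeral)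
        also have "\<dots> \<le> 81 * D\<^sup>2 / 4 * (moment 2)\<^sup>2"
          using lo(2) t by (intro mult_left_mono power_mono) auto
        also have "\<dots> = 2 * upper_const * (\<mu>\<^sub>2 * M)\<^sup>2"
          using M by (simp add: upper_const_def D_def \<mu>\<^sub>2_def)
        finally have "moment 4 \<le> 2 * upper_const * \<mu>\<^sub>2\<^sup>2 * M"
          using M by (simp add: power2_eq_square)
        then have "(d * m\<^sup>2)\<^sup>2 / 2 * moment 4 \<le> (d * m\<^sup>2)\<^sup>2 / 2 * (2 * upper_const * \<mu>\<^sub>2\<^sup>2 * M)"
          by (intro mult_left_mono) auto
        also have "\<dots> = M * (upper_const * s\<^sup>2)"
          by (simp add: s_def power_mult_distrib)
        finally show ?thesis by simp
      qed
      finally show "transform m \<le> M * (1 - d * \<mu>\<^sub>2 * m\<^sup>2 + upper_const * (d * \<mu>\<^sub>2 * m\<^sup>2)\<^sup>2)"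
        by (simp add: s_def distrib_left)
      \<comment> \<open>Bathtub principle: among densities bounded by 1 with mass \<open>M\<close>, the integral against an even
        decreasing function is largest for the indicator of \<open>[-M/2, M/2]\<close>.\<close>
      define k where "k = 2 * (d * m\<^sup>2) / 3"
      define L where "L = M / 2"
      have k: "k \<ge> 0" and L: "L > 0" using d M by (auto simp: k_def L_def)
      define h where "h x = 1 / (sqrt (1 + k * x\<^sup>2)) ^ 3" for x
      have [measurable]: "h \<in> borel_measurable borel" unfolding h_def by measurable
      have p: "1 + k * x\<^sup>2 > 0" for x :: real using k by (simp add: add_pos_nonneg)
      have h_mono: "h x \<le> h y" if "\<bar>y\<bar> \<le> \<bar>x\<bar>" for x y
      proof -
        have "y\<^sup>2 \<le> x\<^sup>2" using that by (simp add: abs_le_square_iff)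
        then have "1 + k * y\<^sup>2 \<le> 1 + k * x\<^sup>2" using k by (simp add: mult_left_mono)
        then show ?thesis
          unfolding h_def using p[of x] p[of y] by (intro divide_left_mono power_mono) auto
      qed
      have h0: "h x \<ge> 0" "h x \<le> 1" for x
        using h_mono[of 0 x] p[of x] by (auto simp: h_def)
      have inth: "integrable lborel (\<lambda>u. weight u * h u)"
        by (rule Bochner_Integration.integrable_bound[OF int0])
           (use h0 weight_pos in \<open>auto simp: abs_mult less_imp_le mult_left_le\<close>)
      have hI: "has_bochner_integral lborel (\<lambda>x. h x * indicator {-L..L} x) (L / sqrt (1 + k * L\<^sup>2) - (-L) / sqrt (1 + k * (-L)\<^sup>2))"
        using L k p unfolding h_def
        by (intro has_bochner_integral_FTC_Icc_nonneg DERIV_slope) (auto simp: less_imp_le)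
      have intI: "integrable lborel (indicator {-L..L} :: real \<Rightarrow> real)"
        using L by (intro integrable_real_indicator) auto
      have "transform m \<le> (\<integral>u. weight u * h u \<partial>lborel)"
        unfolding transform_def
      proof (rule integral_mono)
        fix u :: real
        have "max 0 (1 - m\<^sup>2 * u\<^sup>2) powr kernel_exponent \<le> 1 / (sqrt (1 + 2 * (d * (m\<^sup>2 * u\<^sup>2)) / 3)) ^ 3"
          unfolding d_def[symmetric] using d by (intro order_trans[OF kernel_upper exp_minus_le_slope]) auto
        also have "\<dots> = h u" by (simp add: h_def k_def mult_ac)
        finally show "weight u * max 0 (1 - m\<^sup>2 * u\<^sup>2) powr kernel_exponent \<le> weight u * h u"
          using weight_pos[of u] by (intro mult_left_mono) auto
      qed (use inth transform_integrable in auto)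
      \<comment> \<open>Pointwise this says that (weight - indicator) and (h - h(L)) never have the
        same strict sign. The correction term integrates to 0 because
        \<open>2 * L = M\<close>.\<close>
      also have "\<dots> \<le> (\<integral>u. h u * indicator {-L..L} u + h L * (weight u - indicator {-L..L} u) \<partial>lborel)"
      proof (rule integral_mono[OF inth])
        show "integrable lborel (\<lambda>u. h u * indicator {-L..L} u + h L * (weight u - indicator {-L..L} u))"
          using hI int0 intI
          by (intro Bochner_Integration.integrable_add integrable_mult_right Bochner_Integration.integrable_diff)
            (auto simp: has_bochner_integral_iff)
        show "weight u * h u \<le> h u * indicator {-L..L} u + h L * (weight u - indicator {-L..L} u)" for u
        proof (cases "u \<in> {-L..L}")
          case True
          then have "h L \<le> h u" using L by (intro h_mono) auto
          then have "(1 - weight u) * h L \<le> (1 - weight u) * h u"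
            using weight_le_1[of u] by (intro mult_left_mono) auto
          then show ?thesis using True by (simp add: algebra_simps)
        next
          case False
          then have "h u \<le> h L" using L by (intro h_mono) auto
          then show ?thesis
            using False mult_left_mono[of "h u" "h L" "weight u"] weight_pos[of u] by (simp add: mult.commute)
        qed
      qed
      also have "\<dots> = M / sqrt (1 + k * L\<^sup>2)"
      proof -
        have "(\<integral>u. h L * (weight u - indicator {-L..L} u) \<partial>lborel) = h L * (M - 2 * L)"
          using int0 intI L by (simp add: M0[symmetric])
        moreover have "(\<integral>u. h u * indicator {-L..L} u \<partial>lborel) = 2 * L / sqrt (1 + k * L\<^sup>2)"
          using hI by (simp add: has_bochner_integral_iff)
        ultimately show ?thesis
          using hI int0 intI
          by (subst Bochner_Integration.integral_add) (auto simp: has_bochner_integral_iff L_def)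
      qed
      also have "\<dots> \<le> M / sqrt (1 + decay_const * s)"
      proof -
        have "moment 2 \<le> D * t ^ 3" using bspec[OF up, of 2] by (simp add: numeral_3_eq_3)
        also have "\<dots> = D * 27 / 8 * (2 / 3 * t) ^ 3" by (simp add: power3_eq_cube)
        also have "\<dots> \<le> D * 27 / 8 * M ^ 3"
          using lo(1) t D unfolding M_def by (intro mult_left_mono power_mono) auto
        finally have m2M: "moment 2 \<le> D * 27 / 8 * M ^ 3" .
        have dc: "decay_const = 4 / (81 * D)" by (simp only: decay_const_def D_def)
        have "decay_const * \<mu>\<^sub>2 \<le> decay_const * (D * 27 / 8 * M ^ 3 / M)"
          unfolding \<mu>\<^sub>2_def using D M m2M by (intro mult_left_mono divide_right_mono) (auto simp: dc)
        also have "\<dots> = M\<^sup>2 / 6"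
          using D M by (simp add: dc power2_eq_square power3_eq_cube)
        finally have "decay_const * \<mu>\<^sub>2 \<le> M\<^sup>2 / 6" .
        then have "d * m\<^sup>2 * (decay_const * \<mu>\<^sub>2) \<le> d * m\<^sup>2 * (M\<^sup>2 / 6)"
          using d by (intro mult_left_mono) auto
        then have "decay_const * s \<le> k * L\<^sup>2"
          by (simp add: s_def k_def L_def power_divide mult_ac)
        moreover have "decay_const * s \<ge> 0" using D \<open>s \<ge> 0\<close> by (simp add: dc)
        ultimately show ?thesis using M by (intro divide_left_mono) (auto intro!: mult_pos_pos)
      qed
      finally show "transform m \<le> M / sqrt (1 + decay_const * (d * \<mu>\<^sub>2 * m\<^sup>2))" by (simp add: s_def)
    qed
  qed
qed

end

section \<open>Gaussian envelopes\<close>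

text \<open>The denominator comes from 1 - s >= exp(- s / (1 - s)) with s at most w^2 / q. Outside
  w^2 < q the linear lower bound for the transform may be negative, hence the value 0.\<close>

definition env_lower :: "nat \<Rightarrow> real \<Rightarrow> real" where
  "env_lower q w = (if w\<^sup>2 < real q then exp (- w\<^sup>2 / (1 - w\<^sup>2 / real q)) else 0)"

text \<open>The first term is close to the Gaussian for fixed \<open>w\<close> but grows without
  bound in the tail; the second is an integrable majorant independent of \<open>q\<close>. Capping
  the rate at 1 keeps the second term above exp(- w^2), so the limit of the minimum is the
  Gaussian.\<close>

definition env_upper :: "nat \<Rightarrow> real \<Rightarrow> real" where
  "env_upper q w = min (exp (- w\<^sup>2 + (4 + upper_const) * w ^ 4 / real q)) (1 / (1 + min decay_const 1 / 3 * w\<^sup>2))"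

lemma env_measurable [measurable]:
  "env_lower q \<in> borel_measurable borel" "env_upper q \<in> borel_measurable borel"
  unfolding env_lower_def env_upper_def by measurable

lemma upper_const_nonneg: "upper_const \<ge> 0"
  by (simp add: upper_const_def)

lemma decay_const_pos: "decay_const > 0"
  using cauchy_mass_pos by (simp add: decay_const_def)

lemma exp_minus_le_inverse: "exp (- x) \<le> 1 / (1 + c * x)" if "x \<ge> 0" "0 \<le> c" "c \<le> 1" for x c :: real
proof -
  have "c * x \<le> 1 * x" using that by (intro mult_right_mono) auto
  then have "1 + c * x \<le> exp x" using exp_ge_add_one_self[of x] by linarith
  then have "1 / exp x \<le> 1 / (1 + c * x)"
    using that by (intro divide_left_mono) (auto intro!: mult_pos_pos add_pos_nonneg)
  then show ?thesis by (simp add: exp_minus inverse_eq_divide)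
qed

text \<open>Dominated convergence for both envelopes under the tail term of
  \<open>env_upper\<close>. Since the two limits coincide and are positive, the ratio of the
  integrals tends to 1.\<close>

lemma env_integrals_tendsto:
  shows "(\<lambda>q. \<integral>w. env_lower q w \<partial>lborel) \<longlonglongrightarrow> (\<integral>w. exp (- w\<^sup>2) \<partial>lborel)"
    and "(\<lambda>q. \<integral>w. env_upper q w \<partial>lborel) \<longlonglongrightarrow> (\<integral>w. exp (- w\<^sup>2) \<partial>lborel)"
    and "\<And>q. integrable lborel (env_lower q)"
    and "\<And>q. integrable lborel (env_upper q)"
    and "(\<integral>w. exp (- w\<^sup>2) \<partial>lborel :: real) > 0"
proof -
  define c where "c = min decay_const 1 / 3"
  have c: "c > 0" "c \<le> 1" using decay_const_pos by (auto simp: c_def)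
  have dom: "integrable lborel (\<lambda>w. 1 / (1 + c * w\<^sup>2))"
    using integrable_inverse_quadratic[OF c(1)] .
  have expc: "exp (- w\<^sup>2) \<le> 1 / (1 + c * w\<^sup>2)" for w :: real
    using c by (intro exp_minus_le_inverse) auto
  have lim0: "(\<lambda>q. a / real q) \<longlonglongrightarrow> 0" for a :: real
    by (rule lim_const_over_n)
  have lower_bound: "norm (env_lower q w) \<le> 1 / (1 + c * w\<^sup>2)" for q w
  proof (cases "w\<^sup>2 < real q")
    case True
    moreover from this have "0 < real q" using zero_le_power2[of w] by linarith
    ultimately have "0 < 1 - w\<^sup>2 / real q" "1 - w\<^sup>2 / real q \<le> 1" by (auto simp: divide_less_eq)
    then have "w\<^sup>2 \<le> w\<^sup>2 / (1 - w\<^sup>2 / real q)"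
      by (simp add: pos_le_divide_eq mult_left_le)
    then have "env_lower q w \<le> exp (- w\<^sup>2)" using True by (simp add: env_lower_def)
    then show ?thesis using expc[of w] by (simp add: env_lower_def)
  next
    case False
    then show ?thesis using c by (simp add: env_lower_def)
  qed
  have upper_bound: "norm (env_upper q w) \<le> 1 / (1 + c * w\<^sup>2)" for q w
  proof -
    have "0 \<le> env_upper q w" using c by (simp add: env_upper_def c_def[symmetric])
    moreover have "env_upper q w \<le> 1 / (1 + c * w\<^sup>2)" by (simp add: env_upper_def c_def[symmetric])
    ultimately show ?thesis by simp
  qed
  have lower_lim: "(\<lambda>q. env_lower q w) \<longlonglongrightarrow> exp (- w\<^sup>2)" for w
  proof (rule Lim_transform_eventually)
    have "(\<lambda>q. exp (- w\<^sup>2 / (1 - w\<^sup>2 / real q))) \<longlonglongrightarrow> exp (- w\<^sup>2 / (1 - 0))"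
      by (intro tendsto_intros lim0) auto
    then show "(\<lambda>q. exp (- w\<^sup>2 / (1 - w\<^sup>2 / real q))) \<longlonglongrightarrow> exp (- w\<^sup>2)" by simp
    show "\<forall>\<^sub>F q in sequentially. exp (- w\<^sup>2 / (1 - w\<^sup>2 / real q)) = env_lower q w"
      using eventually_gt_at_top[of "nat \<lceil>w\<^sup>2\<rceil>"]
    proof eventually_elim
      case (elim q)
      then have "w\<^sup>2 < real q" by linarith
      then show ?case by (simp add: env_lower_def)
    qed
  qed
  have upper_lim: "(\<lambda>q. env_upper q w) \<longlonglongrightarrow> exp (- w\<^sup>2)" for w
  proof -
    have "(\<lambda>q. env_upper q w) \<longlonglongrightarrow> min (exp (- w\<^sup>2 + 0)) (1 / (1 + c * w\<^sup>2))"
      unfolding env_upper_def c_def[symmetric] by (intro tendsto_intros lim0)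
    then show ?thesis using expc[of w] by (simp add: min_absorb1)
  qed
  have m: "(\<lambda>w::real. exp (- w\<^sup>2)) \<in> borel_measurable lborel" by measurable
  note dl = integral_dominated_convergence[OF m _ dom, of env_lower]
    and du = integral_dominated_convergence[OF m _ dom, of env_upper]
  show "(\<lambda>q. \<integral>w. env_lower q w \<partial>lborel) \<longlonglongrightarrow> (\<integral>w. exp (- w\<^sup>2) \<partial>lborel)"
    using lower_lim lower_bound by (intro dl) auto
  show "(\<lambda>q. \<integral>w. env_upper q w \<partial>lborel) \<longlonglongrightarrow> (\<integral>w. exp (- w\<^sup>2) \<partial>lborel)"
    using upper_lim upper_bound by (intro du) auto
  show "integrable lborel (env_lower q)" for q
    by (rule Bochner_Integration.integrable_bound[OF dom], measurable, rule AE_I2,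
        rule order_trans[OF lower_bound], simp only: real_norm_def abs_ge_self)
  show "integrable lborel (env_upper q)" for q
    by (rule Bochner_Integration.integrable_bound[OF dom], measurable, rule AE_I2,
        rule order_trans[OF upper_bound], simp only: real_norm_def abs_ge_self)
  have "0 < (\<integral>w. exp (- 1) * indicator {0..1::real} w \<partial>lborel :: real)" by simp
  also have "\<dots> \<le> (\<integral>w. exp (- w\<^sup>2) \<partial>lborel)"
  proof (rule integral_mono)
    show "integrable lborel (\<lambda>w::real. exp (- w\<^sup>2))"
      by (rule Bochner_Integration.integrable_bound[OF dom], measurable, rule AE_I2)
         (use expc c in \<open>simp add: add_pos_nonneg less_imp_le\<close>)
    show "exp (- 1) * indicator {0..1} w \<le> exp (- w\<^sup>2)" for w :: real
      by (auto split: split_indicator intro: power_le_one)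
  qed simp
  finally show "(\<integral>w. exp (- w\<^sup>2) \<partial>lborel :: real) > 0" .
qed

text \<open>In the application \<open>w\<close> is the rescaled \<sigma>, \<open>y\<close> is
  \<alpha>^2 \<sigma>^2, \<open>s\<close> is \<mu> m^2 and \<open>T\<close> is
  \<open>transform m / M\<close>. The number \<open>l\<close> is the share of the \<alpha>-term in
  the Gaussian rate: q y / 2 is \<open>l * w\<^sup>2\<close>, and q s is
  \<open>(1 - l) * w\<^sup>2\<close> up to the factor 1 / (1 + y). The two factors thus share the
  exponent w^2, whatever the direction.\<close>

lemma integrand_lower:
  fixes T w l :: real and q :: nat
  defines "y \<equiv> 2 * l * w\<^sup>2 / real q"
  defines "s \<equiv> (1 - l) * w\<^sup>2 / (real q * (1 + y))"
  assumes q: "q \<ge> 12" and l: "0 \<le> l" "l \<le> 1" and T: "1 - s \<le> T" "0 \<le> T"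
  shows "env_lower q w \<le> (T / sqrt (1 + y)) ^ q"
proof (cases "w\<^sup>2 < real q")
  case True
  have y: "y \<ge> 0" using l by (simp add: y_def)
  define r where "r = 1 - w\<^sup>2 / real q"
  have r: "0 < r" "r \<le> 1" using True q by (auto simp: r_def divide_less_eq)
  have s: "s \<ge> 0" using l y by (simp add: s_def)
  have qs: "real q * s \<le> (1 - l) * w\<^sup>2"
  proof -
    have "real q * s = (1 - l) * w\<^sup>2 / (1 + y)" using q by (simp add: s_def)
    also have "\<dots> \<le> (1 - l) * w\<^sup>2 / 1" using y l by (intro divide_left_mono) auto
    finally show ?thesis by simp
  qed
  have "(1 - l) * w\<^sup>2 \<le> 1 * w\<^sup>2" using l by (intro mult_right_mono) auto
  with qs have "real q * s \<le> w\<^sup>2" by simp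
  then have sr: "r \<le> 1 - s" using q by (simp add: r_def field_simps)
  have "exp (- s / r) \<le> exp (- s / (1 - s))"
    using sr r s by (simp add: divide_left_mono)
  also have "\<dots> \<le> 1 - s"
  proof -
    have p: "1 - s > 0" using sr r by simp
    have "1 / (1 - s) = 1 + s / (1 - s)" using p by (simp add: field_simps)
    also have "\<dots> \<le> exp (s / (1 - s))" by (rule exp_ge_add_one_self)
    finally have "1 / exp (s / (1 - s)) \<le> 1 - s"
      using p by (simp add: field_simps)
    then show ?thesis by (simp add: exp_minus inverse_eq_divide)
  qed
  also have "\<dots> \<le> T" by fact
  finally have 1: "exp (- s / r) \<le> T" .
  have "sqrt (1 + y) \<le> sqrt (exp (y / 2 + y / 2))"
    using exp_ge_add_one_self[of y] by (intro real_sqrt_le_mono) simp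
  also have "\<dots> = exp (y / 2)" by (subst exp_add) simp
  \<comment> \<open>Enlarging this exponent by 1 / r costs little and puts both factors over the
    same denominator, so that only s + y / 2 has to be compared with w^2.\<close>
  also have "\<dots> \<le> exp (y / 2 / r)"
    using y r mult_left_le[of r "y / 2"] by (simp add: pos_le_divide_eq)
  finally have 2: "sqrt (1 + y) \<le> exp (y / 2 / r)" .
  have "exp (- s / r - y / 2 / r) = exp (- s / r) / exp (y / 2 / r)" by (rule exp_diff)
  also have "\<dots> \<le> T / sqrt (1 + y)"
    using 1 2 T y by (intro frac_le) auto
  finally have "exp (- s / r - y / 2 / r) ^ q \<le> (T / sqrt (1 + y)) ^ q"
    by (intro power_mono) auto
  moreover have "env_lower q w \<le> exp (- s / r - y / 2 / r) ^ q"
  proof -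
    have "real q * (y / 2) = l * w\<^sup>2" using q by (simp add: y_def)
    then have "real q * (s + y / 2) \<le> w\<^sup>2" using qs by (simp add: algebra_simps)
    then have "real q * (s + y / 2) / r \<le> w\<^sup>2 / r" using r by (intro divide_right_mono) auto
    then have "- w\<^sup>2 / r \<le> real q * (- s / r - y / 2 / r)"
      by (simp add: add_divide_distrib algebra_simps)
    then show ?thesis
      using True by (simp add: env_lower_def r_def[symmetric] exp_of_nat_mult[symmetric])
  qed
  ultimately show ?thesis by linarith
next
  case False
  have "y \<ge> 0" using l by (simp add: y_def)
  then show ?thesis using False T by (simp add: env_lower_def)
qed

text \<open>The quartic bound on \<open>T\<close> together with ln(1 + y) >= y - y^2 gives the
  Gaussian branch of the envelope; the decay bound on \<open>T\<close> gives the tail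
  branch.\<close>

lemma integrand_upper:
  fixes T w l :: real and q :: nat
  defines "y \<equiv> 2 * l * w\<^sup>2 / real q"
  defines "s \<equiv> (1 - l) * w\<^sup>2 / (real q * (1 + y))"
  assumes q: "q \<ge> 12" and l: "0 \<le> l" "l \<le> 1" and T0: "0 \<le> T"
    and T1: "T \<le> 1 - s + upper_const * s\<^sup>2" and T2: "T \<le> 1 / sqrt (1 + decay_const * s)"
  shows "(T / sqrt (1 + y)) ^ q \<le> env_upper q w"
proof -
  have y: "y \<ge> 0" using l by (simp add: y_def)
  have s: "s \<ge> 0" using l y by (simp add: s_def)
  have q0: "real q > 0" using q by simp
  have qs: "real q * s = (1 - l) * w\<^sup>2 / (1 + y)" using q by (simp add: s_def)
  have qy: "real q * y = 2 * l * w\<^sup>2" using q by (simp add: y_def)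
  have lw: "0 \<le> l * w\<^sup>2" "l * w\<^sup>2 \<le> w\<^sup>2" "0 \<le> (1 - l) * w\<^sup>2" "(1 - l) * w\<^sup>2 \<le> w\<^sup>2"
    using l mult_right_mono[of l 1 "w\<^sup>2"] mult_right_mono[of "1 - l" 1 "w\<^sup>2"] by simp_all
  have w4: "w ^ 4 = w\<^sup>2 * w\<^sup>2" by (simp add: power_add[symmetric])
  have "(T / sqrt (1 + y)) ^ q \<le> exp (- w\<^sup>2 + (4 + upper_const) * w ^ 4 / real q)"
  proof -
    have "T \<le> exp (- s + upper_const * s\<^sup>2)"
      using T1 exp_ge_add_one_self[of "- s + upper_const * s\<^sup>2"] by linarith
    moreover have "exp (y / 2 - y\<^sup>2 / 2) \<le> sqrt (1 + y)"
    proof -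
      have "y - y\<^sup>2 \<le> y / (1 + y)"
      proof -
        have "(y - y\<^sup>2) * (1 + y) = y - y * y\<^sup>2" by (simp add: algebra_simps power2_eq_square)
        also have "\<dots> \<le> y" using y by simp
        finally show ?thesis using y by (simp add: pos_le_divide_eq)
      qed
      then have "exp (y - y\<^sup>2) \<le> exp (y / (1 + y))" by simp
      also have "\<dots> \<le> 1 + y"
      proof -
        have "1 / (1 + y) = 1 + (- (y / (1 + y)))" using y by (simp add: field_simps)
        also have "\<dots> \<le> exp (- (y / (1 + y)))" by (rule exp_ge_add_one_self)
        also have "\<dots> = 1 / exp (y / (1 + y))" by (simp add: exp_minus inverse_eq_divide)
        finally show ?thesis using y by (simp add: field_simps)
      qed
      finally have "sqrt (exp ((y / 2 - y\<^sup>2 / 2) + (y / 2 - y\<^sup>2 / 2))) \<le> sqrt (1 + y)"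
        by (intro real_sqrt_le_mono) simp
      then show ?thesis by (subst (asm) exp_add) simp
    qed
    ultimately have "T / sqrt (1 + y) \<le> exp (- s + upper_const * s\<^sup>2) / exp (y / 2 - y\<^sup>2 / 2)"
      using T0 by (intro frac_le) auto
    also have "\<dots> = exp ((- s + upper_const * s\<^sup>2) - (y / 2 - y\<^sup>2 / 2))" by (rule exp_diff[symmetric])
    finally have "(T / sqrt (1 + y)) ^ q \<le> exp ((- s + upper_const * s\<^sup>2) - (y / 2 - y\<^sup>2 / 2)) ^ q"
      using T0 y by (intro power_mono) auto
    also have "\<dots> = exp (real q * ((- s + upper_const * s\<^sup>2) - (y / 2 - y\<^sup>2 / 2)))"
      by (rule exp_of_nat_mult[symmetric])
    also have "\<dots> \<le> exp (- w\<^sup>2 + (4 + upper_const) * w ^ 4 / real q)"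
    proof -
      \<comment> \<open>The errors add up to the constant in \<open>env_upper\<close>: 2 from
        replacing 1 / (1 + y) by 1 - y in \<open>s\<close>, \<open>upper_const\<close> from the s^2
        term, and half of 4 from the y^2 term, each times w^4 / q.\<close>
      have a: "(1 - l) * w\<^sup>2 - 2 * w ^ 4 / real q \<le> real q * s"
      proof -
        have "((1 - l) * w\<^sup>2) * (1 - y) * (1 + y) \<le> (1 - l) * w\<^sup>2"
        proof -
          have "((1 - l) * w\<^sup>2) * ((1 - y) * (1 + y)) \<le> ((1 - l) * w\<^sup>2) * 1"
            by (intro mult_left_mono lw) (simp add: algebra_simps)
          then show ?thesis by (simp add: mult.assoc)
        qed
        then have "((1 - l) * w\<^sup>2) * (1 - y) \<le> real q * s"
          using y unfolding qs by (simp add: pos_le_divide_eq)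
        moreover have "((1 - l) * w\<^sup>2) * y \<le> 2 * w ^ 4 / real q"
        proof -
          have "((1 - l) * w\<^sup>2) * y \<le> w\<^sup>2 * (2 * w\<^sup>2 / real q)"
            unfolding y_def using lw l q0 by (intro mult_mono divide_right_mono) auto
          also have "\<dots> = 2 * w ^ 4 / real q" by (simp add: power4_eq_xxxx power2_eq_square)
          finally show ?thesis .
        qed
        ultimately show ?thesis by (simp add: right_diff_distrib)
      qed
      have b: "real q * s\<^sup>2 \<le> w ^ 4 / real q"
      proof -
        have "real q * s \<le> (1 - l) * w\<^sup>2 / 1"
          unfolding qs using y lw by (intro divide_left_mono) auto
        then have h: "real q * s \<le> w\<^sup>2" using lw by simp
        have "(real q * s) * (real q * s) \<le> w\<^sup>2 * w\<^sup>2"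
          by (rule mult_mono[OF h h]) (use s in auto)
        then have "real q * s\<^sup>2 * real q \<le> w ^ 4"
          unfolding w4 power2_eq_square[of s] by (simp only: mult_ac)
        then show ?thesis using q0 by (simp add: pos_le_divide_eq)
      qed
      have c: "real q * y\<^sup>2 \<le> 4 * w ^ 4 / real q"
      proof -
        have h: "real q * y \<le> 2 * w\<^sup>2" using lw qy by simp
        have "(real q * y) * (real q * y) \<le> (2 * w\<^sup>2) * (2 * w\<^sup>2)"
          by (rule mult_mono[OF h h]) (use y in auto)
        then have "real q * y\<^sup>2 * real q \<le> 4 * w ^ 4"
          unfolding w4 power2_eq_square[of y] by (simp add: mult_ac)
        then show ?thesis using q0 by (simp add: pos_le_divide_eq)
      qed
      have "upper_const * (real q * s\<^sup>2) \<le> upper_const * (w ^ 4 / real q)"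
        using b upper_const_nonneg by (intro mult_left_mono)
      moreover have "real q * ((- s + upper_const * s\<^sup>2) - (y / 2 - y\<^sup>2 / 2))
          = - (real q * s) + upper_const * (real q * s\<^sup>2) - real q * y / 2 + real q * y\<^sup>2 / 2"
        by (simp add: algebra_simps)
      moreover have "(4 + upper_const) * w ^ 4 / real q = 4 * w ^ 4 / real q + upper_const * (w ^ 4 / real q)"
        by (simp add: algebra_simps add_divide_distrib)
      moreover have "(1 - l) * w\<^sup>2 + real q * y / 2 = w\<^sup>2" unfolding qy by (simp add: algebra_simps)
      ultimately have "real q * ((- s + upper_const * s\<^sup>2) - (y / 2 - y\<^sup>2 / 2)) \<le> - w\<^sup>2 + (4 + upper_const) * w ^ 4 / real q"
        using a c by linarith
      then show ?thesis by simp
    qed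
    finally show ?thesis .
  qed
  moreover have "(T / sqrt (1 + y)) ^ q \<le> 1 / (1 + min decay_const 1 / 3 * w\<^sup>2)"
  proof -
    \<comment> \<open>\<open>T\<close> decays at rate \<open>decay_const\<close> and the root at
      rate 2, in proportions 1 - l and l. The common lower rate \<open>c\<close> makes the product
      at least 1 + z independently of l.\<close>
    define c where "c = min decay_const 1"
    have c: "c > 0" "c \<le> 1" "c \<le> decay_const" using decay_const_pos by (auto simp: c_def)
    define z where "z = c * w\<^sup>2 / real q"
    have z: "z \<ge> 0" using c by (simp add: z_def)
    have zle: "1 + z \<le> (1 + decay_const * s) * (1 + y)"
    proof -
      have "s * (1 + y) = (1 - l) * w\<^sup>2 / real q" using y by (simp add: s_def)
      then have "(1 + decay_const * s) * (1 + y) = 1 + y + decay_const * ((1 - l) * w\<^sup>2 / real q)"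
        by (simp add: algebra_simps)
      also have "\<dots> \<ge> 1 + c * (l * w\<^sup>2 / real q) + c * ((1 - l) * w\<^sup>2 / real q)"
      proof -
        have "c * (l * w\<^sup>2 / real q) \<le> 2 * (l * w\<^sup>2 / real q)" using c l by (intro mult_right_mono) auto
        moreover have "c * ((1 - l) * w\<^sup>2 / real q) \<le> decay_const * ((1 - l) * w\<^sup>2 / real q)"
          using c l by (intro mult_right_mono) auto
        ultimately show ?thesis by (simp add: y_def)
      qed
      also have "1 + c * (l * w\<^sup>2 / real q) + c * ((1 - l) * w\<^sup>2 / real q) = 1 + z"
        by (simp add: z_def algebra_simps add_divide_distrib diff_divide_distrib)
      finally show ?thesis .
    qed
    have ds: "1 + decay_const * s > 0" using decay_const_pos s by (simp add: add_pos_nonneg)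
    have "T / sqrt (1 + y) \<le> (1 / sqrt (1 + decay_const * s)) / sqrt (1 + y)"
      using T2 y by (intro divide_right_mono) auto
    also have "\<dots> = 1 / sqrt ((1 + decay_const * s) * (1 + y))"
      by (simp add: real_sqrt_mult)
    also have "\<dots> \<le> 1 / sqrt (1 + z)"
      using zle z ds y by (intro divide_left_mono) (auto intro!: mult_pos_pos)
    finally have "(T / sqrt (1 + y)) ^ q \<le> (1 / sqrt (1 + z)) ^ q"
      using T0 y by (intro power_mono) auto
    also have "\<dots> = 1 / sqrt ((1 + z) ^ q)" by (simp add: power_divide real_sqrt_power)
    also have "\<dots> \<le> 1 / (1 + c / 3 * w\<^sup>2)"
    proof -
      \<comment> \<open>Half of the exponent is spent on the square root; \<open>q\<close> being at
        most 3 k produces the 3 in \<open>env_upper\<close>.\<close>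
      define k where "k = q div 2"
      have k: "2 * k \<le> q" "real q \<le> 3 * real k" using q by (auto simp: k_def)
      have "1 + c / 3 * w\<^sup>2 \<le> 1 + real k * z"
      proof -
        have "c / 3 * w\<^sup>2 = real q / 3 * z" using q0 by (simp add: z_def)
        also have "\<dots> \<le> real k * z" using k z by (intro mult_right_mono) auto
        finally show ?thesis by simp
      qed
      also have "\<dots> \<le> (1 + z) ^ k" using z by (intro Bernoulli_inequality) auto
      also have "\<dots> = sqrt ((1 + z) ^ (2 * k))"
      proof -
        have "(1 + z) ^ (2 * k) = ((1 + z) ^ k)\<^sup>2" by (metis power_mult mult.commute)
        then show ?thesis using z by simp
      qed
      also have "\<dots> \<le> sqrt ((1 + z) ^ q)"
        using k z by (intro real_sqrt_le_mono power_increasing) auto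
      finally show ?thesis using c z
        by (intro divide_left_mono) (auto intro!: mult_pos_pos add_pos_nonneg)
    qed
    finally show ?thesis by (simp add: c_def)
  qed
  ultimately show ?thesis by (simp add: env_upper_def)
qed

section \<open>The second transform, uniformly in the direction\<close>

context even_convex_profile
begin

lemma transform_nonneg: "transform m \<ge> 0"
  unfolding transform_def by (intro Bochner_Integration.integral_nonneg) (simp add: weight_pos less_imp_le)

lemma transform_measurable [measurable]: "transform \<in> borel_measurable borel"
  unfolding transform_def by measurable

text \<open>With \<open>w = A * \<sigma>\<close> and \<open>A\<close> the root of the quadratic
  form, the integrand becomes \<open>M ^ q\<close> times a function caught between the two
  envelopes. Body and direction then survive only in the prefactor \<open>M ^ q / A\<close>. The
  case \<beta> = 0 is included, because no slope substitution is made.\<close>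

lemma double_transform_bounds:
  obtains A\<^sub>1 A\<^sub>2 B where "A\<^sub>1 > 0" "A\<^sub>2 > 0" "B > 0"
    "\<forall>\<alpha> \<beta>. \<alpha>\<^sup>2 + \<beta>\<^sup>2 = 1 \<longrightarrow>
      ennreal (B * (\<integral>w. env_lower q w \<partial>lborel) / sqrt (A\<^sub>1 * \<alpha>\<^sup>2 + A\<^sub>2 * \<beta>\<^sup>2))
      \<le> (\<integral>\<^sup>+\<sigma>. ennreal ((transform (\<beta> * \<sigma> / sqrt (1 + \<alpha>\<^sup>2 * \<sigma>\<^sup>2)) / sqrt (1 + \<alpha>\<^sup>2 * \<sigma>\<^sup>2)) ^ q) \<partial>lborel) \<and>
      (\<integral>\<^sup>+\<sigma>. ennreal ((transform (\<beta> * \<sigma> / sqrt (1 + \<alpha>\<^sup>2 * \<sigma>\<^sup>2)) / sqrt (1 + \<alpha>\<^sup>2 * \<sigma>\<^sup>2)) ^ q) \<partial>lborel)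
      \<le> ennreal (B * (\<integral>w. env_upper q w \<partial>lborel) / sqrt (A\<^sub>1 * \<alpha>\<^sup>2 + A\<^sub>2 * \<beta>\<^sup>2))"
proof -
  obtain M \<mu> where M: "M > 0" and \<mu>: "\<mu> > 0"
    and bounds: "\<forall>m. M * (1 - \<mu> * m\<^sup>2) \<le> transform m \<and>
       transform m \<le> M * (1 - \<mu> * m\<^sup>2 + upper_const * (\<mu> * m\<^sup>2)\<^sup>2) \<and>
       transform m \<le> M / sqrt (1 + decay_const * (\<mu> * m\<^sup>2))"
    by (rule transform_bounds)
  have lo: "M * (1 - \<mu> * m\<^sup>2) \<le> transform m"
    and up1: "transform m \<le> M * (1 - \<mu> * m\<^sup>2 + upper_const * (\<mu> * m\<^sup>2)\<^sup>2)"
    and up2: "transform m \<le> M / sqrt (1 + decay_const * (\<mu> * m\<^sup>2))" for m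
    using bounds by auto
  \<comment> \<open>The Gaussian rates of the two factors: q / 2 from
    \<open>(1 + \<alpha>\<^sup>2 * \<sigma>\<^sup>2)\<close> to the power - q / 2, and q \<mu> from
    the q-th power of 1 - \<mu> m^2.\<close>
  define A\<^sub>1 where "A\<^sub>1 = real q / 2"
  define A\<^sub>2 where "A\<^sub>2 = real q * \<mu>"
  have A12: "A\<^sub>1 > 0" "A\<^sub>2 > 0" using q \<mu> by (auto simp: A\<^sub>1_def A\<^sub>2_def)
  have key: "\<exists>I. (\<integral>\<^sup>+\<sigma>. ennreal ((transform (\<beta> * \<sigma> / sqrt (1 + \<alpha>\<^sup>2 * \<sigma>\<^sup>2)) / sqrt (1 + \<alpha>\<^sup>2 * \<sigma>\<^sup>2)) ^ q) \<partial>lborel)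
      = ennreal (M ^ q / sqrt (A\<^sub>1 * \<alpha>\<^sup>2 + A\<^sub>2 * \<beta>\<^sup>2)) * I \<and>
      ennreal (\<integral>w. env_lower q w \<partial>lborel) \<le> I \<and> I \<le> ennreal (\<integral>w. env_upper q w \<partial>lborel)"
    if ab: "\<alpha>\<^sup>2 + \<beta>\<^sup>2 = 1" for \<alpha> \<beta>
  proof -
    define A where "A = sqrt (A\<^sub>1 * \<alpha>\<^sup>2 + A\<^sub>2 * \<beta>\<^sup>2)"
    have "A\<^sub>1 * \<alpha>\<^sup>2 + A\<^sub>2 * \<beta>\<^sup>2 > 0"
    proof (cases "\<alpha> = 0")
      case True
      then show ?thesis using ab A12 by simp
    next
      case False
      then show ?thesis using A12 by (intro add_pos_nonneg) auto
    qed
    then have A: "A > 0" "A\<^sup>2 = A\<^sub>1 * \<alpha>\<^sup>2 + A\<^sub>2 * \<beta>\<^sup>2" by (auto simp: A_def)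
    define l where "l = A\<^sub>1 * \<alpha>\<^sup>2 / A\<^sup>2"
    have "l + A\<^sub>2 * \<beta>\<^sup>2 / A\<^sup>2 = A\<^sup>2 / A\<^sup>2"
      unfolding l_def by (simp only: add_divide_distrib[symmetric] A(2)[symmetric])
    then have l1: "1 - l = A\<^sub>2 * \<beta>\<^sup>2 / A\<^sup>2" using A(1) by simp
    have l: "0 \<le> l" "l \<le> 1"
    proof -
      show "0 \<le> l" using A12 by (simp add: l_def)
      have "0 \<le> 1 - l" unfolding l1 using A12 by simp
      then show "l \<le> 1" by simp
    qed
    define f where "f w = (transform (\<beta> * (w / A) / sqrt (1 + \<alpha>\<^sup>2 * (w / A)\<^sup>2)) / M / sqrt (1 + \<alpha>\<^sup>2 * (w / A)\<^sup>2)) ^ q" for w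
    have fb: "env_lower q w \<le> f w \<and> f w \<le> env_upper q w" for w
    proof -
      define y where "y = 2 * l * w\<^sup>2 / real q"
      define s where "s = (1 - l) * w\<^sup>2 / (real q * (1 + y))"
      have yeq: "\<alpha>\<^sup>2 * (w / A)\<^sup>2 = y"
        using q A(1) by (simp add: y_def l_def A\<^sub>1_def power_divide)
      have y: "y \<ge> 0" using l by (simp add: y_def)
      define m where "m = \<beta> * (w / A) / sqrt (1 + y)"
      have seq: "\<mu> * m\<^sup>2 = s"
      proof -
        have "\<mu> * m\<^sup>2 = \<mu> * (\<beta>\<^sup>2 * (w\<^sup>2 / A\<^sup>2)) / (1 + y)"
          using y by (simp add: m_def power_divide power_mult_distrib)
        also have "\<dots> = s"
          using q unfolding s_def l1 A\<^sub>2_def by simp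
        finally show ?thesis .
      qed
      define T where "T = transform m / M"
      have f: "f w = (T / sqrt (1 + y)) ^ q" by (simp add: f_def yeq T_def m_def)
      have T0: "T \<ge> 0" using transform_nonneg M by (simp add: T_def)
      have "1 - s \<le> T" using lo[of m] M by (simp add: T_def seq pos_le_divide_eq mult.commute)
      moreover have "T \<le> 1 - s + upper_const * s\<^sup>2"
        using up1[of m] M by (simp add: T_def seq pos_divide_le_eq mult.commute)
      moreover have "T \<le> 1 / sqrt (1 + decay_const * s)"
        using divide_right_mono[OF up2[of m], of M] M by (simp add: T_def seq)
      ultimately show ?thesis
        using integrand_lower[OF q l, of w T] integrand_upper[OF q l T0, of w] T0
        unfolding f y_def s_def by blast
    qed
    have fm [measurable]: "f \<in> borel_measurable borel" unfolding f_def by measurable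
    have e0: "0 \<le> env_lower q w" for w by (simp add: env_lower_def)
    have e1: "0 \<le> env_upper q w" for w using fb[of w] e0[of w] by linarith
    let ?g = "\<lambda>\<sigma>. ennreal ((transform (\<beta> * \<sigma> / sqrt (1 + \<alpha>\<^sup>2 * \<sigma>\<^sup>2)) / sqrt (1 + \<alpha>\<^sup>2 * \<sigma>\<^sup>2)) ^ q)"
    have "(\<integral>\<^sup>+\<sigma>. ?g \<sigma> \<partial>lborel) = ennreal \<bar>1 / A\<bar> * (\<integral>\<^sup>+w. ?g (0 + 1 / A * w) \<partial>lborel)"
      using A by (intro nn_integral_real_affine) auto
    also have "(\<integral>\<^sup>+w. ?g (0 + 1 / A * w) \<partial>lborel) = (\<integral>\<^sup>+w. ennreal (M ^ q) * ennreal (f w) \<partial>lborel)"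
    proof (rule nn_integral_cong)
      fix w
      have "transform (\<beta> * (w / A) / sqrt (1 + \<alpha>\<^sup>2 * (w / A)\<^sup>2)) / sqrt (1 + \<alpha>\<^sup>2 * (w / A)\<^sup>2)
        = M * (transform (\<beta> * (w / A) / sqrt (1 + \<alpha>\<^sup>2 * (w / A)\<^sup>2)) / M / sqrt (1 + \<alpha>\<^sup>2 * (w / A)\<^sup>2))"
        using M by simp
      then have "(transform (\<beta> * (w / A) / sqrt (1 + \<alpha>\<^sup>2 * (w / A)\<^sup>2)) / sqrt (1 + \<alpha>\<^sup>2 * (w / A)\<^sup>2)) ^ q = M ^ q * f w"
        unfolding f_def by (simp only: power_mult_distrib)
      moreover have "0 + 1 / A * w = w / A" by simp
      ultimately have "?g (0 + 1 / A * w) = ennreal (M ^ q * f w)" by (simp only:)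
      then show "?g (0 + 1 / A * w) = ennreal (M ^ q) * ennreal (f w)"
        using M by (simp add: ennreal_mult')
    qed
    also have "\<dots> = ennreal (M ^ q) * (\<integral>\<^sup>+w. ennreal (f w) \<partial>lborel)"
      by (rule nn_integral_cmult) measurable
    finally have "(\<integral>\<^sup>+\<sigma>. ?g \<sigma> \<partial>lborel) = ennreal (M ^ q / A) * (\<integral>\<^sup>+w. ennreal (f w) \<partial>lborel)"
      using A M by (simp add: mult.assoc[symmetric] ennreal_mult'[symmetric])
    moreover have "ennreal (\<integral>w. env_lower q w \<partial>lborel) \<le> (\<integral>\<^sup>+w. ennreal (f w) \<partial>lborel)"
      using env_integrals_tendsto(3)[of q] e0 fb
      by (subst nn_integral_eq_integral[symmetric]) (auto intro!: nn_integral_mono ennreal_leI)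
    moreover have "(\<integral>\<^sup>+w. ennreal (f w) \<partial>lborel) \<le> ennreal (\<integral>w. env_upper q w \<partial>lborel)"
      using env_integrals_tendsto(4)[of q] e1 fb
      by (subst nn_integral_eq_integral[symmetric]) (auto intro!: nn_integral_mono ennreal_leI)
    ultimately show ?thesis unfolding A_def by blast
  qed
  have nn: "0 \<le> M ^ q / sqrt (A\<^sub>1 * \<alpha>\<^sup>2 + A\<^sub>2 * \<beta>\<^sup>2)" for \<alpha> \<beta>
    using M A12 by simp
  have split: "ennreal (M ^ q * X / sqrt (A\<^sub>1 * \<alpha>\<^sup>2 + A\<^sub>2 * \<beta>\<^sup>2))
      = ennreal (M ^ q / sqrt (A\<^sub>1 * \<alpha>\<^sup>2 + A\<^sub>2 * \<beta>\<^sup>2)) * ennreal X" for X \<alpha> \<beta>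
    using ennreal_mult'[OF nn, of \<alpha> \<beta> X] by simp
  show thesis
  proof (rule that[OF A12, of "M ^ q"], goal_cases)
    case 1
    show "M ^ q > 0" using M by simp
  next
    case 2
    show ?case
    proof (intro allI impI conjI)
      fix \<alpha> \<beta> :: real
      assume "\<alpha>\<^sup>2 + \<beta>\<^sup>2 = 1"
      from key[OF this] obtain I where
        I: "(\<integral>\<^sup>+\<sigma>. ennreal ((transform (\<beta> * \<sigma> / sqrt (1 + \<alpha>\<^sup>2 * \<sigma>\<^sup>2)) / sqrt (1 + \<alpha>\<^sup>2 * \<sigma>\<^sup>2)) ^ q) \<partial>lborel)
        = ennreal (M ^ q / sqrt (A\<^sub>1 * \<alpha>\<^sup>2 + A\<^sub>2 * \<beta>\<^sup>2)) * I"
        "ennreal (\<integral>w. env_lower q w \<partial>lborel) \<le> I" "I \<le> ennreal (\<integral>w. env_upper q w \<partial>lborel)"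
        by blast
      show "ennreal (M ^ q * (\<integral>w. env_lower q w \<partial>lborel) / sqrt (A\<^sub>1 * \<alpha>\<^sup>2 + A\<^sub>2 * \<beta>\<^sup>2))
        \<le> (\<integral>\<^sup>+\<sigma>. ennreal ((transform (\<beta> * \<sigma> / sqrt (1 + \<alpha>\<^sup>2 * \<sigma>\<^sup>2)) / sqrt (1 + \<alpha>\<^sup>2 * \<sigma>\<^sup>2)) ^ q) \<partial>lborel)"
        unfolding I(1) split
        by (intro mult_left_mono I) simp
      show "(\<integral>\<^sup>+\<sigma>. ennreal ((transform (\<beta> * \<sigma> / sqrt (1 + \<alpha>\<^sup>2 * \<sigma>\<^sup>2)) / sqrt (1 + \<alpha>\<^sup>2 * \<sigma>\<^sup>2)) ^ q) \<partial>lborel)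
        \<le> ennreal (M ^ q * (\<integral>w. env_upper q w \<partial>lborel) / sqrt (A\<^sub>1 * \<alpha>\<^sup>2 + A\<^sub>2 * \<beta>\<^sup>2))"
        unfolding I(1) split
        by (intro mult_left_mono I) simp
    qed
  qed
qed

end

section \<open>Profiles of convex bodies of revolution\<close>

text \<open>Points of the plane of the first two coordinates. By \<open>revolution_mem_iff\<close>
  this meridian plane determines a set of revolution.\<close>

definition pt :: "real \<Rightarrow> real \<Rightarrow> nat \<Rightarrow> real" where
  "pt a b i = (if i = 0 then a else if i = 1 then b else 0)"

lemma pt_arith: "c *\<^sub>R pt a b = pt (c * a) (c * b)" "pt a b + pt a' b' = pt (a + a') (b + b')"
  "- pt a b = pt (- a) (- b)"
  by (auto simp: pt_def fun_eq_iff scaleR_fun_def)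

lemma pt_carrier: "n \<ge> 2 \<Longrightarrow> pt a b \<in> carrier_E n"
  by (auto simp: mem_carrier_E pt_def)

lemma perp_norm_pt: "n \<ge> 2 \<Longrightarrow> perp_norm n (pt a b) = \<bar>b\<bar>"
proof -
  assume "n \<ge> 2"
  then have "(\<Sum>i\<in>{1..<n}. (pt a b i)\<^sup>2) = (\<Sum>i\<in>{1..<n}. if i = 1 then b\<^sup>2 else 0)"
    by (intro sum.cong) (auto simp: pt_def)
  with \<open>n \<ge> 2\<close> show ?thesis by (simp add: perp_norm_def)
qed

section \<open>Reflections and the reduction to the meridian plane\<close>

lemma dot_commute: "dot n x y = dot n y x"
  by (simp add: dot_def mult.commute)

lemma dot_diff_scaleR: "dot n (x - c *\<^sub>R w) y = dot n x y - c * dot n w y"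
  "dot n y (x - c *\<^sub>R w) = dot n y x - c * dot n y w"
  by (simp_all add: dot_def scaleR_fun_def sum_distrib_left sum_subtractf algebra_simps)

lemma householder_orthogonal:
  assumes w: "w \<in> carrier_E n" and N: "dot n w w > 0"
  defines "T \<equiv> \<lambda>y. y - (2 * dot n w y / dot n w w) *\<^sub>R w"
  shows "T \<in> orthogonal_maps n" and "\<And>y. T (T y) = y"
proof -
  have Td: "T y = y - (2 * dot n w y / dot n w w) *\<^sub>R w" for y
    by (simp add: T_def)
  have carrier: "T y \<in> carrier_E n" if "y \<in> carrier_E n" for y
    using that w by (auto simp: mem_carrier_E T_def scaleR_fun_def)
  have wT: "dot n w (T y) = - dot n w y" for y
    using N by (simp add: T_def dot_diff_scaleR)
  show TT: "T (T y) = y" for y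
  proof -
    have "T (T y) = T y + (2 * dot n w y / dot n w w) *\<^sub>R w"
      unfolding Td[of "T y"] wT by simp
    then show ?thesis by (simp add: T_def)
  qed
  have "linear T"
  proof (rule linearI)
    show "T (x + y) = T x + T y" for x y
      by (simp add: T_def dot_def fun_eq_iff scaleR_fun_def distrib_left sum.distrib add_divide_distrib algebra_simps)
    have "dot n w (c *\<^sub>R x) = c * dot n w x" for c x
      by (simp add: dot_def scaleR_fun_def sum_distrib_left algebra_simps)
    then show "T (c *\<^sub>R x) = c *\<^sub>R T x" for c x
      by (simp add: T_def scaleR_diff_right)
  qed
  moreover have "bij_betw T (carrier_E n) (carrier_E n)"
    by (rule bij_betw_byWitness[where f' = T]) (use TT carrier in auto)
  moreover have "dot n (T x) (T y) = dot n x y" for x y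
  proof -
    have "dot n (T x) (T y) = dot n x (T y) - 2 * dot n w x / dot n w w * dot n w (T y)"
      unfolding Td[of x] by (rule dot_diff_scaleR)
    also have "\<dots> = dot n x y - 2 * dot n w y / dot n w w * dot n x w + 2 * dot n w x / dot n w w * dot n w y"
      unfolding wT by (simp add: T_def dot_diff_scaleR)
    finally show ?thesis by (simp add: dot_commute[of n x w])
  qed
  ultimately show "T \<in> orthogonal_maps n" by (simp add: orthogonal_maps_def GL_def)
qed

text \<open>The point \<open>x\<close> and its representative \<open>p\<close> in the meridian plane
  have equal norm and equal first coordinate. The reflection along \<open>w = x - p\<close>
  therefore exchanges them and fixes \<open>e1\<close>, so it preserves \<open>K\<close>.\<close>

lemma revolution_mem_iff:
  assumes rev: "of_revolution n K" and n: "n \<ge> 2" and x: "x \<in> carrier_E n"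
  shows "x \<in> K \<longleftrightarrow> pt (x 0) (perp_norm n x) \<in> K"
proof -
  define p where "p = pt (x 0) (perp_norm n x)"
  define w where "w = x - p"
  have p: "p \<in> carrier_E n" using n by (simp add: p_def pt_carrier)
  have w: "w \<in> carrier_E n" using x p by (auto simp: mem_carrier_E w_def)
  have w0: "w 0 = 0" by (simp add: w_def p_def pt_def)
  have eqn: "dot n p p = dot n x x"
    using n by (simp add: dot_self_eq p_def perp_norm_pt) (simp add: pt_def)
  show ?thesis
  proof (cases "x = p")
    case True
    then show ?thesis by (simp add: p_def)
  next
    case False
    then obtain i where i: "w i \<noteq> 0" by (auto simp: w_def fun_eq_iff)
    then have "i < n" using w unfolding mem_carrier_E by (meson not_less)
    then have "(w i)\<^sup>2 \<le> dot n w w"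
      unfolding dot_def power2_eq_square by (intro member_le_sum) auto
    moreover have "0 < (w i)\<^sup>2" using i by simp
    ultimately have N: "dot n w w > 0" by linarith
    define T where "T y = y - (2 * dot n w y / dot n w w) *\<^sub>R w" for y
    have Teq: "T = (\<lambda>y. y - (2 * dot n w y / dot n w w) *\<^sub>R w)" by (rule ext) (rule T_def)
    have T: "T \<in> orthogonal_maps n" and TT: "T (T y) = y" for y
      unfolding Teq by (rule householder_orthogonal[OF w N])+
    have "dot n w e1 = w 0"
      using n by (simp add: dot_def e1_def if_distrib[of "\<lambda>x. _ * x"] cong: if_cong)
    then have "T e1 = e1" using w0 by (simp add: T_def)
    then have TK: "T ` K = K" using rev T by (auto simp: of_revolution_def)
    have wx: "dot n w y = dot n x y - dot n p y" for y
      using dot_diff_scaleR(1)[of n x 1 p y] by (simp add: w_def)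
    \<comment> \<open>Equality of the norms gives (w, w) = 2 (w, x), so the reflection subtracts
      exactly \<open>w\<close> from \<open>x\<close>.\<close>
    have "dot n w w = dot n x w - dot n p w" by (rule wx)
    also have "\<dots> = dot n w x - dot n w p" by (simp only: dot_commute[of n x w] dot_commute[of n p w])
    also have "\<dots> = (dot n x x - dot n p x) - (dot n x p - dot n p p)" by (simp only: wx)
    also have "\<dots> = 2 * (dot n x x - dot n p x)" by (simp add: eqn dot_commute[of n x p])
    also have "\<dots> = 2 * dot n w x" by (simp only: wx)
    finally have "T x = x - 1 *\<^sub>R w" using N by (simp add: T_def)
    then have Tx: "T x = p" by (simp add: w_def)
    have "p \<in> K" if "x \<in> K" using that Tx TK by blast
    moreover have "x \<in> K" if "p \<in> K" using that Tx TK TT[of x] by (metis imageI)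
    ultimately show ?thesis by (auto simp: p_def)
  qed
qed

locale revolution_body =
  fixes n :: nat and K :: "(nat \<Rightarrow> real) set"
  assumes n: "n \<ge> 13" and body: "body n K" and symmetric: "symmetric_set K"
    and conv: "convex K" and rev: "of_revolution n K"
begin

lemma K_carrier: "K \<subseteq> carrier_E n"
  using body by (auto simp: body_def compactin_def)

lemma K_compact: "compact K"
proof -
  have "compactin (powertop_real UNIV) K"
    using body by (simp add: body_def Euclidean_space_def compactin_subtopology)
  then show ?thesis by (simp add: euclidean_product_topology)
qed

lemma pt_reflect: "pt a b \<in> K \<longleftrightarrow> pt a (- b) \<in> K" "pt a b \<in> K \<longleftrightarrow> pt (- a) b \<in> K"
proof -
  have n2: "n \<ge> 2" using n by simp
  show 1: "pt a b \<in> K \<longleftrightarrow> pt a (- b) \<in> K" for a b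
    using revolution_mem_iff[OF rev n2 pt_carrier[OF n2], of a b]
      revolution_mem_iff[OF rev n2 pt_carrier[OF n2], of a "- b"]
    by (simp add: perp_norm_pt[OF n2] pt_def)
  have "pt a b \<in> K \<longleftrightarrow> - pt a b \<in> K"
    using symmetric unfolding symmetric_set_def by (metis imageE imageI minus_minus)
  then show "pt a b \<in> K \<longleftrightarrow> pt (- a) b \<in> K"
    using 1[of "- a" b] by (simp add: pt_arith)
qed

lemma zero_K: "pt 0 0 \<in> K"
proof -
  obtain x where x: "x \<in> K" using body by (auto simp: body_def)
  then have "- x \<in> K" using symmetric unfolding symmetric_set_def by blast
  then have "(1/2) *\<^sub>R x + (1/2) *\<^sub>R (- x) \<in> K" using x conv by (intro convexD) auto
  moreover have "(1/2) *\<^sub>R x + (1/2) *\<^sub>R (- x) = pt 0 0"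
    by (auto simp: fun_eq_iff scaleR_fun_def pt_def)
  ultimately show ?thesis by simp
qed

text \<open>The origin is interior to \<open>K\<close>: an interior point \<open>x\<close> can be
  moved slightly in the given direction, and averaging with \<open>- x\<close> carries half of that
  displacement to the origin.\<close>

lemma ray_pos:
  obtains t where "t > 0" "pt (t * a) (t * b) \<in> K"
proof -
  obtain U where U: "openin (Euclidean_space n) U" "U \<subseteq> K" "U \<noteq> {}"
  proof (rule that)
    show "openin (Euclidean_space n) (Euclidean_space n interior_of K)" by (rule openin_interior_of)
    show "Euclidean_space n interior_of K \<subseteq> K" by (rule interior_of_subset)
    show "Euclidean_space n interior_of K \<noteq> {}" using body unfolding body_def by (metis closure_of_empty)
  qed
  obtain x where x: "x \<in> U" using U by blast
  then have xK: "x \<in> K" "x \<in> carrier_E n" using U K_carrier by auto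
  define f where "f t = x + pt (t * a) (t * b)" for t
  have "continuous_map euclideanreal (Euclidean_space n) f"
    unfolding Euclidean_space_def continuous_map_in_subtopology
  proof
    have "continuous_on UNIV (\<lambda>t. f t i)" for i
      by (cases "i = 0"; cases "i = 1") (auto simp: f_def pt_def intro!: continuous_intros)
    then show "continuous_map euclideanreal (powertop_real UNIV) f"
      by (auto simp: continuous_map_componentwise_UNIV)
    show "f \<in> topspace euclideanreal \<rightarrow> {x. \<forall>i\<ge>n. x i = 0}"
      using xK n by (auto simp: f_def mem_carrier_E pt_def)
  qed
  then have "openin euclideanreal {t \<in> topspace euclideanreal. f t \<in> U}"
    using U(1) by (rule openin_continuous_map_preimage)
  then have "open {t. f t \<in> U}" by simp
  moreover have "f 0 = x" by (auto simp: f_def pt_def fun_eq_iff)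
  ultimately obtain e where e: "e > 0" "ball 0 e \<subseteq> {t. f t \<in> U}"
    using x open_contains_ball[of "{t. f t \<in> U}"] by auto
  have "e / 2 \<in> ball 0 e" using e(1) by simp
  then have "f (e / 2) \<in> K" using e(2) U(2) by blast
  moreover have "- x \<in> K" using xK symmetric unfolding symmetric_set_def by blast
  ultimately have "(1/2) *\<^sub>R f (e / 2) + (1/2) *\<^sub>R (- x) \<in> K" using conv by (intro convexD) auto
  moreover have "(1/2) *\<^sub>R f (e / 2) + (1/2) *\<^sub>R (- x) = pt (e / 4 * a) (e / 4 * b)"
    by (auto simp: fun_eq_iff scaleR_fun_def pt_def f_def field_simps)
  ultimately show thesis using that[of "e / 4"] e(1) by simp
qed

lemma pt_bounded:
  obtains B where "B > 0" "\<And>a b. pt a b \<in> K \<Longrightarrow> \<bar>a\<bar> \<le> B \<and> \<bar>b\<bar> \<le> B"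
proof -
  have "bounded ((\<lambda>x. x i) ` K)" for i
    by (intro compact_imp_bounded compact_continuous_image K_compact
        continuous_on_subset[OF continuous_on_product_coordinates]) simp
  then obtain B0 B1 where B: "\<And>x. x \<in> K \<Longrightarrow> norm (x 0) \<le> B0" "\<And>x. x \<in> K \<Longrightarrow> norm (x 1) \<le> B1"
    unfolding bounded_iff by (metis imageI)
  show thesis
  proof (rule that[of "\<bar>B0\<bar> + \<bar>B1\<bar> + 1"])
    fix a b assume "pt a b \<in> K"
    from B[OF this] show "\<bar>a\<bar> \<le> \<bar>B0\<bar> + \<bar>B1\<bar> + 1 \<and> \<bar>b\<bar> \<le> \<bar>B0\<bar> + \<bar>B1\<bar> + 1"
      by (auto simp: pt_def)
  qed simp
qed

text \<open>\<open>ray m 1\<close> is the profile at slope \<open>m\<close>, and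
  \<open>ray 1 0\<close> is the radius on the axis; both are handled by one supremum along a
  direction of the meridian plane.\<close>

definition ray :: "real \<Rightarrow> real \<Rightarrow> real" where
  "ray a b = Sup {t. 0 \<le> t \<and> pt (t * a) (t * b) \<in> K}"

lemma ray_props:
  assumes ab: "a \<noteq> 0 \<or> b \<noteq> 0"
  shows "ray a b > 0" and "t \<ge> 0 \<Longrightarrow> pt (t * a) (t * b) \<in> K \<longleftrightarrow> t \<le> ray a b"
proof -
  define S where "S = {t. 0 \<le> t \<and> pt (t * a) (t * b) \<in> K}"
  have "closed ((\<lambda>t. pt (t * a) (t * b)) -` K)"
  proof (rule closed_vimage)
    show "closed K" using K_compact by (rule compact_imp_closed)
    show "continuous_on UNIV (\<lambda>t. pt (t * a) (t * b))"
    proof (rule continuous_on_coordinatewise_then_product)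
      show "continuous_on UNIV (\<lambda>t. pt (t * a) (t * b) i)" for i
        by (cases "i = 0"; cases "i = 1") (auto simp: pt_def intro!: continuous_intros)
    qed
  qed
  moreover have "S = {0..} \<inter> (\<lambda>t. pt (t * a) (t * b)) -` K" by (auto simp: S_def)
  ultimately have clS: "closed S" by auto
  obtain B where B: "B > 0" "\<And>a b. pt a b \<in> K \<Longrightarrow> \<bar>a\<bar> \<le> B \<and> \<bar>b\<bar> \<le> B" by (rule pt_bounded) blast
  have bdd: "bdd_above S"
  proof (rule bdd_aboveI)
    fix t assume "t \<in> S"
    then have t: "t \<ge> 0" "\<bar>t * a\<bar> \<le> B" "\<bar>t * b\<bar> \<le> B" using B by (auto simp: S_def)
    show "t \<le> B / (\<bar>a\<bar> + \<bar>b\<bar>) * 2"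
    proof -
      have "t * (\<bar>a\<bar> + \<bar>b\<bar>) \<le> 2 * B" using t by (simp add: abs_mult distrib_left)
      moreover have "\<bar>a\<bar> + \<bar>b\<bar> > 0" using ab by auto
      ultimately show ?thesis by (simp add: field_simps)
    qed
  qed
  obtain t0 where t0: "t0 > 0" "pt (t0 * a) (t0 * b) \<in> K" by (rule ray_pos)
  then have t0S: "t0 \<in> S" by (simp add: S_def)
  have ray: "ray a b = Sup S" by (simp add: ray_def S_def)
  show pos: "ray a b > 0"
    unfolding ray using cSup_upper[OF t0S bdd] t0(1) by linarith
  have "Sup S \<in> S" using t0S bdd clS by (intro closed_contains_Sup) auto
  then have max: "pt (ray a b * a) (ray a b * b) \<in> K" by (simp add: ray S_def)
  assume t: "t \<ge> 0"
  show "pt (t * a) (t * b) \<in> K \<longleftrightarrow> t \<le> ray a b"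
  proof
    assume "pt (t * a) (t * b) \<in> K"
    then show "t \<le> ray a b" unfolding ray using t by (intro cSup_upper bdd) (simp add: S_def)
  next
    assume le: "t \<le> ray a b"
    let ?s = "t / ray a b"
    have "(1 - ?s) *\<^sub>R pt 0 0 + ?s *\<^sub>R pt (ray a b * a) (ray a b * b) \<in> K"
      using max zero_K conv t le pos by (intro convexD) auto
    then show "pt (t * a) (t * b) \<in> K" using pos by (simp add: pt_arith)
  qed
qed

definition psi :: "real \<Rightarrow> real" where
  "psi m = 1 / ray m 1"

lemma ray_1: "ray m 1 > 0" "t \<ge> 0 \<Longrightarrow> pt (t * m) t \<in> K \<longleftrightarrow> t \<le> ray m 1"
  using ray_props(1)[of m 1] ray_props(2)[of m 1 t] by auto

text \<open>\<open>psi\<close> is the gauge of the meridian section on the points (m, 1), so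
  convexity of \<open>K\<close> passes to it, evenness comes from the reflections in
  \<open>pt_reflect\<close>, and boundedness of \<open>K\<close> gives coercivity.\<close>

sublocale even_convex_profile psi "n - 1"
proof
  show "n - 1 \<ge> 12" using n by simp
  show "psi 0 > 0" using ray_1 by (simp add: psi_def)
  have "pt (t * - m) t \<in> K \<longleftrightarrow> pt (t * m) t \<in> K" for t m
    using pt_reflect(2)[of "t * m" t] by simp
  then show "psi (- m) = psi m" for m by (simp add: psi_def ray_def)
  show "convex_on UNIV psi"
  proof (rule convex_onI)
    fix t x y :: real
    assume t: "0 < t" "t < 1"
    \<comment> \<open>The two boundary points are combined with weights proportional to (1 - t) /
      \<open>ray x 1\<close> and t / \<open>ray y 1\<close>. The result has height 1 / D and the
      averaged slope, so the ray there is at least 1 / D.\<close>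
    define D where "D = (1 - t) / ray x 1 + t / ray y 1"
    have D: "D > 0" using t ray_1(1) by (simp add: D_def add_pos_pos)
    let ?u = "(1 - t) / (ray x 1 * D)" and ?v = "t / (ray y 1 * D)"
    have uv: "?u + ?v = 1"
    proof -
      have "?u + ?v = (1 - t) / ray x 1 / D + t / ray y 1 / D" by simp
      also have "\<dots> = D / D" unfolding add_divide_distrib[symmetric] D_def ..
      finally have "?u + ?v = D / D" .
      then show ?thesis using D by simp
    qed
    have "pt (ray x 1 * x) (ray x 1) \<in> K" "pt (ray y 1 * y) (ray y 1) \<in> K"
      using ray_1 less_imp_le by blast+
    then have "?u *\<^sub>R pt (ray x 1 * x) (ray x 1) + ?v *\<^sub>R pt (ray y 1 * y) (ray y 1) \<in> K"
      using conv t D uv ray_1(1)[of x] ray_1(1)[of y] by (intro convexD) auto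
    also have "?u *\<^sub>R pt (ray x 1 * x) (ray x 1) + ?v *\<^sub>R pt (ray y 1 * y) (ray y 1)
      = pt (1 / D * ((1 - t) * x + t * y)) (1 / D)"
      using ray_1(1)[of x] ray_1(1)[of y] D by (simp add: pt_arith add_divide_distrib[symmetric])
    finally have "1 / D \<le> ray ((1 - t) * x + t * y) 1"
      using ray_1(2)[of "1 / D" "(1 - t) * x + t * y"] D by simp
    then have "psi ((1 - t) * x + t * y) \<le> D"
      using D ray_1(1)[of "(1 - t) * x + t * y"] by (simp add: psi_def field_simps)
    then show "psi ((1 - t) *\<^sub>R x + t *\<^sub>R y) \<le> (1 - t) * psi x + t * psi y"
      by (simp add: D_def psi_def)
  qed simp
  obtain B where B: "B > 0" "\<And>a b. pt a b \<in> K \<Longrightarrow> \<bar>a\<bar> \<le> B \<and> \<bar>b\<bar> \<le> B" by (rule pt_bounded) blast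
  have "1 / B * \<bar>x\<bar> \<le> psi x" for x
  proof -
    have "pt (ray x 1 * x) (ray x 1) \<in> K" using ray_1 less_imp_le by blast
    from B(2)[OF this] have "ray x 1 * \<bar>x\<bar> \<le> B" using ray_1(1)[of x] by (simp add: abs_mult)
    then show ?thesis using B(1) ray_1(1)[of x] by (simp add: psi_def field_simps)
  qed
  then show "\<exists>c>0. \<forall>x. c * \<bar>x\<bar> \<le> psi x" using B(1) by (intro exI[of _ "1 / B"]) auto
qed

lemma profile_K: "has_profile n K (\<lambda>m. 1 / psi m)"
  unfolding has_profile_def
proof (intro conjI allI exI[of _ "ray 1 0"] ballI)
  have n2: "n \<ge> 2" using n by simp
  show "(\<lambda>m. 1 / psi m) \<in> borel_measurable borel" by measurable
  show "0 \<le> 1 / psi m" for m using psi_pos[of m] by simp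
  fix x assume x: "x \<in> carrier_E n"
  let ?r = "perp_norm n x"
  note mem = revolution_mem_iff[OF rev n2 x]
  show "x \<in> K \<longleftrightarrow> (if ?r = 0 then \<bar>x 0\<bar> \<le> ray 1 0 else ?r \<le> 1 / psi (x 0 / ?r))"
  proof (cases "?r = 0")
    case True
    have "pt \<bar>x 0\<bar> 0 \<in> K \<longleftrightarrow> pt (x 0) 0 \<in> K"
      using pt_reflect(2)[of "x 0" 0] by (simp add: abs_if)
    then show ?thesis using mem True ray_props(2)[of 1 0 "\<bar>x 0\<bar>"] by simp
  next
    case False
    then have "?r > 0" using perp_norm_nonneg[of n x] by linarith
    then show ?thesis using mem ray_1(2)[of ?r "x 0 / ?r"] by (simp add: psi_def)
  qed
qed

end

section \<open>The double intersection body\<close>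

lemma enorm_eq: "n > 0 \<Longrightarrow> (enorm n x)\<^sup>2 = (x 0)\<^sup>2 + (perp_norm n x)\<^sup>2"
  using dot_self_eq[of n x] by (simp add: enorm_def)

lemma enorm_nonneg: "enorm n x \<ge> 0"
  by (simp add: enorm_def dot_def sum_nonneg)

lemma perp_norm_scaleR: "perp_norm n (c *\<^sub>R x) = \<bar>c\<bar> * perp_norm n x"
  by (simp add: perp_norm_def scaleR_fun_def power_mult_distrib sum_distrib_left[symmetric] real_sqrt_mult)

lemma enorm_eq_0_iff:
  assumes "x \<in> carrier_E n"
  shows "enorm n x = 0 \<longleftrightarrow> x = 0"
proof
  assume "enorm n x = 0"
  then have "(\<Sum>i<n. x i * x i) = 0" by (simp add: enorm_def dot_def)
  then have "x i = 0" if "i < n" for i using that by (subst (asm) sum_nonneg_eq_0_iff) auto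
  moreover have "x i = 0" if "\<not> i < n" for i using assms that by (simp add: mem_carrier_E)
  ultimately show "x = 0" by (metis ext zero_fun_apply)
qed (simp add: enorm_def dot_def)

lemma normalize:
  assumes "x \<in> carrier_E n" "x \<noteq> 0"
  shows "(1 / enorm n x) *\<^sub>R x \<in> unit_sphere n" "enorm n x > 0" "x = enorm n x *\<^sub>R ((1 / enorm n x) *\<^sub>R x)"
proof -
  show p: "enorm n x > 0" using assms enorm_eq_0_iff[of x n] enorm_nonneg[of n x] by linarith
  have "enorm n ((1 / enorm n x) *\<^sub>R x) = 1"
    using p by (simp add: enorm_scaleR)
  moreover have "(1 / enorm n x) *\<^sub>R x \<in> carrier_E n"
    using assms by (simp add: mem_carrier_E scaleR_fun_def)
  ultimately show "(1 / enorm n x) *\<^sub>R x \<in> unit_sphere n"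
    by (simp add: unit_sphere_def)
  show "x = enorm n x *\<^sub>R ((1 / enorm n x) *\<^sub>R x)" using p by simp
qed

lemma mem_intersection_body:
  assumes "x \<in> carrier_E n" "x \<noteq> 0"
  shows "x \<in> intersection_body n L \<longleftrightarrow> enorm n x \<le> section_volume n L ((1 / enorm n x) *\<^sub>R x)"
  using scaleR_in_intersection_body_iff[OF normalize(1,2)[OF assms], of L] normalize(3)[OF assms] by simp

lemma e1_unit_sphere: "n > 0 \<Longrightarrow> e1 \<in> unit_sphere n"
  by (auto simp: unit_sphere_def mem_carrier_E e1_def enorm_def dot_def if_distrib[of "\<lambda>x. x * _"] cong: if_cong)

lemma zero_in_intersection_body:
  assumes "n > 0"
  shows "0 \<in> intersection_body n L"
  unfolding intersection_body_def using section_volume_nonneg[of n L e1] e1_unit_sphere[OF assms]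
  by (auto intro!: exI[of _ 0] exI[of _ e1])

section \<open>Both intersection bodies of K and the approximating ellipsoid\<close>

context revolution_body
begin

text \<open>Needed to apply the section formula a second time: it asks for a profile, and the slope
  substitution shows that off the axis the first section volumes have exactly this form.\<close>

lemma profile_intersection_body:
  obtains c where "c > 0" "has_profile n (intersection_body n K) (\<lambda>m. c * transform m)"
proof -
  have n3: "n \<ge> 3" "n > 0" using n by auto
  obtain \<kappa> where \<kappa>: "\<kappa> > 0" "cone_const n = ennreal \<kappa>" by (rule cone_const_real[OF n3(1)])
  define c where "c = \<kappa> / psi 0 ^ (n - 1)"
  have c: "c > 0" using \<kappa>(1) pos by (simp add: c_def)
  let ?G = "\<lambda>m. 1 / psi m"
  have G: "?G \<in> borel_measurable borel" "\<And>m. ?G m \<ge> 0"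
    using profile_K by (auto simp: has_profile_def)
  have nn: "(\<integral>\<^sup>+u. ennreal (?G u ^ (n - 1) * max 0 (1 - m\<^sup>2 * u\<^sup>2) powr ((real (n - 1) - 3) / 2)) \<partial>lborel)
     = ennreal (transform m / psi 0 ^ (n - 1))" for m
  proof -
    have "(\<integral>\<^sup>+u. ennreal (?G u ^ (n - 1) * max 0 (1 - m\<^sup>2 * u\<^sup>2) powr ((real (n - 1) - 3) / 2)) \<partial>lborel)
      = (\<integral>\<^sup>+u. ennreal (weight u * max 0 (1 - m\<^sup>2 * u\<^sup>2) powr kernel_exponent / psi 0 ^ (n - 1)) \<partial>lborel)"
      using pos by (intro nn_integral_cong) (simp add: weight_def kernel_exponent_def power_divide del: One_nat_def)
    also have "\<dots> = ennreal (transform m / psi 0 ^ (n - 1))"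
      unfolding transform_def using pos transform_integrable weight_pos
      by (subst nn_integral_eq_integral) (auto simp: less_imp_le)
    finally show ?thesis .
  qed
  have vol: "section_volume n K u = c * transform (u 0 / perp_norm n u) / perp_norm n u"
    if u: "u \<in> unit_sphere n" "perp_norm n u > 0" for u
  proof -
    have "(perp_norm n u)\<^sup>2 = 1 - (u 0)\<^sup>2"
      using enorm_eq[OF n3(2), of u] u by (simp add: unit_sphere_def)
    then have r: "sqrt (1 - (u 0)\<^sup>2) = perp_norm n u"
      using u(2) by (metis abs_of_pos real_sqrt_abs)
    have "section_volume n K u = enn2real (ennreal \<kappa> * (ennreal (1 / perp_norm n u) *
        ennreal (transform (u 0 / perp_norm n u) / psi 0 ^ (n - 1))))"
      unfolding section_volume_profile[OF profile_K n3(1) u(1)] r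
        nn_integral_slope_substitution[OF G u(2)] nn \<kappa>(2) ..
    then show ?thesis
      using \<kappa> u(2) pos transform_nonneg[of "u 0 / perp_norm n u"]
      by (simp add: ennreal_mult'[symmetric] c_def mult_ac)
  qed
  \<comment> \<open>On the axis the factor 1 / \<beta> is singular, so the radius is taken from
    \<open>e1\<close> itself. The section formula depends on \<open>u\<close> only through
    \<open>(u 0)\<^sup>2\<close>, hence the opposite pole has the same radius.\<close>
  define \<rho> where "\<rho> = section_volume n K e1"
  have e1: "e1 \<in> unit_sphere n" using n3(2) by (rule e1_unit_sphere)
  have axis: "section_volume n K u = \<rho>" if u: "u \<in> unit_sphere n" "perp_norm n u = 0" for u
  proof -
    have "(u 0)\<^sup>2 = (e1 0)\<^sup>2" using enorm_eq[OF n3(2), of u] u by (simp add: unit_sphere_def e1_def)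
    then show ?thesis
      unfolding \<rho>_def section_volume_profile[OF profile_K n3(1) u(1)]
        section_volume_profile[OF profile_K n3(1) e1] by simp
  qed
  have "has_profile n (intersection_body n K) (\<lambda>m. c * transform m)"
    unfolding has_profile_def
  proof (intro conjI allI exI[of _ \<rho>] ballI)
    show "(\<lambda>m. c * transform m) \<in> borel_measurable borel" by measurable
    show "0 \<le> c * transform m" for m using c transform_nonneg by simp
    fix x assume x: "x \<in> carrier_E n"
    let ?r = "perp_norm n x"
    show "x \<in> intersection_body n K \<longleftrightarrow> (if ?r = 0 then \<bar>x 0\<bar> \<le> \<rho> else ?r \<le> c * transform (x 0 / ?r))"
    proof (cases "x = 0")
      case True
      then show ?thesis using zero_in_intersection_body[OF n3(2)] section_volume_nonneg[of n K e1]
        by (simp add: perp_norm_def \<rho>_def)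
    next
      case False
      note nz = normalize[OF x False]
      let ?u = "(1 / enorm n x) *\<^sub>R x"
      have pu: "perp_norm n ?u = ?r / enorm n x" "?u 0 = x 0 / enorm n x"
        using nz(2) by (simp_all add: perp_norm_scaleR) (simp add: scaleR_fun_def)
      show ?thesis
      proof (cases "?r = 0")
        case True
        have "(enorm n x)\<^sup>2 = \<bar>x 0\<bar>\<^sup>2" using enorm_eq[OF n3(2), of x] True by simp
        then have "enorm n x = \<bar>x 0\<bar>"
          by (rule power2_eq_imp_eq) (use nz(2) in auto)
        moreover have "section_volume n K ?u = \<rho>"
          by (rule axis[OF nz(1)]) (simp add: pu True)
        ultimately show ?thesis using mem_intersection_body[OF x False, of K] True by simp
      next
        case False
        then have r: "?r > 0" using perp_norm_nonneg[of n x] by linarith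
        have "section_volume n K ?u = c * transform (x 0 / ?r) / (?r / enorm n x)"
          using vol[OF nz(1)] r nz(2) unfolding pu by simp
        \<comment> \<open>The factor 1 / \<beta> of the slope substitution is the norm over the
          distance from the axis, so the norm cancels and a condition on that distance
          remains.\<close>
        then have "x \<in> intersection_body n K \<longleftrightarrow> enorm n x \<le> c * transform (x 0 / ?r) / (?r / enorm n x)"
          using mem_intersection_body[OF x \<open>x \<noteq> 0\<close>, of K] by simp
        also have "\<dots> \<longleftrightarrow> ?r \<le> c * transform (x 0 / ?r)"
          using r nz(2) by (simp add: field_simps)
        finally show ?thesis using r by simp
      qed
    qed
  qed
  with c that show thesis by blast
qed

lemma double_section_volume_bounds:
  obtains A\<^sub>1 A\<^sub>2 C where "A\<^sub>1 > 0" "A\<^sub>2 > 0" "C > 0"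
    "\<forall>u\<in>unit_sphere n. let E = sqrt (A\<^sub>1 * (u 0)\<^sup>2 + A\<^sub>2 * (perp_norm n u)\<^sup>2) in
      C * (\<integral>w. env_lower (n - 1) w \<partial>lborel) / E \<le> section_volume n (intersection_body n K) u \<and>
      section_volume n (intersection_body n K) u \<le> C * (\<integral>w. env_upper (n - 1) w \<partial>lborel) / E"
proof -
  define q where "q = n - 1"
  have n3: "n \<ge> 3" "n > 0" using n by auto
  obtain \<kappa> where \<kappa>: "\<kappa> > 0" "cone_const n = ennreal \<kappa>" by (rule cone_const_real[OF n3(1)])
  obtain c where c: "c > 0" and prof: "has_profile n (intersection_body n K) (\<lambda>m. c * transform m)"
    by (rule profile_intersection_body)
  obtain A\<^sub>1 A\<^sub>2 B where A: "A\<^sub>1 > 0" "A\<^sub>2 > 0" "B > 0" and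
    b: "\<forall>\<alpha> \<beta>. \<alpha>\<^sup>2 + \<beta>\<^sup>2 = 1 \<longrightarrow>
      ennreal (B * (\<integral>w. env_lower q w \<partial>lborel) / sqrt (A\<^sub>1 * \<alpha>\<^sup>2 + A\<^sub>2 * \<beta>\<^sup>2))
      \<le> (\<integral>\<^sup>+\<sigma>. ennreal ((transform (\<beta> * \<sigma> / sqrt (1 + \<alpha>\<^sup>2 * \<sigma>\<^sup>2)) / sqrt (1 + \<alpha>\<^sup>2 * \<sigma>\<^sup>2)) ^ q) \<partial>lborel) \<and>
      (\<integral>\<^sup>+\<sigma>. ennreal ((transform (\<beta> * \<sigma> / sqrt (1 + \<alpha>\<^sup>2 * \<sigma>\<^sup>2)) / sqrt (1 + \<alpha>\<^sup>2 * \<sigma>\<^sup>2)) ^ q) \<partial>lborel)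
      \<le> ennreal (B * (\<integral>w. env_upper q w \<partial>lborel) / sqrt (A\<^sub>1 * \<alpha>\<^sup>2 + A\<^sub>2 * \<beta>\<^sup>2))"
    unfolding q_def by (rule double_transform_bounds)
  define C where "C = \<kappa> * c ^ q * B"
  have C: "C > 0" using \<kappa> c A by (simp add: C_def)
  show thesis
  proof (rule that[OF A(1,2) C], unfold q_def[symmetric], intro ballI)
    fix u assume u: "u \<in> unit_sphere n"
    define \<alpha> where "\<alpha> = u 0"
    define \<beta> where "\<beta> = perp_norm n u"
    define E where "E = sqrt (A\<^sub>1 * \<alpha>\<^sup>2 + A\<^sub>2 * \<beta>\<^sup>2)"
    define lo where "lo = (\<integral>w. env_lower q w \<partial>lborel)"
    define up where "up = (\<integral>w. env_upper q w \<partial>lborel)"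
    have lo0: "lo \<ge> 0" unfolding lo_def by (intro Bochner_Integration.integral_nonneg) (simp add: env_lower_def)
    have up0: "up \<ge> 0" unfolding up_def
      using decay_const_pos by (intro Bochner_Integration.integral_nonneg) (simp add: env_upper_def)
    have ab: "\<alpha>\<^sup>2 + \<beta>\<^sup>2 = 1"
      using enorm_eq[OF n3(2), of u] u by (simp add: unit_sphere_def \<alpha>_def \<beta>_def)
    then have \<beta>: "sqrt (1 - \<alpha>\<^sup>2) = \<beta>"
      using perp_norm_nonneg[of n u] by (intro real_sqrt_unique) (auto simp: \<beta>_def[symmetric] algebra_simps)
    define I where "I = (\<integral>\<^sup>+\<sigma>. ennreal ((transform (\<beta> * \<sigma> / sqrt (1 + \<alpha>\<^sup>2 * \<sigma>\<^sup>2)) / sqrt (1 + \<alpha>\<^sup>2 * \<sigma>\<^sup>2)) ^ q) \<partial>lborel)"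
    have I: "ennreal (B * lo / E) \<le> I" "I \<le> ennreal (B * up / E)"
      using b[rule_format, OF ab] by (auto simp: I_def E_def lo_def up_def)
    have "section_volume n (intersection_body n K) u = enn2real (ennreal \<kappa> *
       (\<integral>\<^sup>+\<sigma>. ennreal ((c * transform (\<beta> * \<sigma> / sqrt (1 + \<alpha>\<^sup>2 * \<sigma>\<^sup>2)) / sqrt (1 + \<alpha>\<^sup>2 * \<sigma>\<^sup>2)) ^ q) \<partial>lborel))"
      unfolding section_volume_profile[OF prof n3(1) u] \<alpha>_def[symmetric] \<beta> \<kappa>(2) q_def ..
    also have "(\<integral>\<^sup>+\<sigma>. ennreal ((c * transform (\<beta> * \<sigma> / sqrt (1 + \<alpha>\<^sup>2 * \<sigma>\<^sup>2)) / sqrt (1 + \<alpha>\<^sup>2 * \<sigma>\<^sup>2)) ^ q) \<partial>lborel)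
       = (\<integral>\<^sup>+\<sigma>. ennreal (c ^ q) * ennreal ((transform (\<beta> * \<sigma> / sqrt (1 + \<alpha>\<^sup>2 * \<sigma>\<^sup>2)) / sqrt (1 + \<alpha>\<^sup>2 * \<sigma>\<^sup>2)) ^ q) \<partial>lborel)"
      using c by (intro nn_integral_cong)
        (simp add: ennreal_mult'[symmetric] power_mult_distrib power_divide)
    also have "\<dots> = ennreal (c ^ q) * I"
      unfolding I_def by (rule nn_integral_cmult) measurable
    also have "ennreal \<kappa> * (ennreal (c ^ q) * I) = ennreal (\<kappa> * c ^ q) * I"
      using \<kappa>(1) c by (simp add: ennreal_mult' mult.assoc)
    finally have V: "section_volume n (intersection_body n K) u = enn2real (ennreal (\<kappa> * c ^ q) * I)" .
    have kc: "\<kappa> * c ^ q \<ge> 0" using \<kappa>(1) c by simp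
    have E0: "E \<ge> 0" unfolding E_def using A by simp
    have lower: "ennreal (C * lo / E) \<le> ennreal (\<kappa> * c ^ q) * I"
    proof -
      have "ennreal (C * lo / E) = ennreal (\<kappa> * c ^ q) * ennreal (B * lo / E)"
        using kc by (simp add: ennreal_mult'[symmetric] C_def mult.assoc)
      also have "\<dots> \<le> ennreal (\<kappa> * c ^ q) * I" by (intro mult_left_mono I) simp
      finally show ?thesis .
    qed
    have upper: "ennreal (\<kappa> * c ^ q) * I \<le> ennreal (C * up / E)"
    proof -
      have "ennreal (\<kappa> * c ^ q) * I \<le> ennreal (\<kappa> * c ^ q) * ennreal (B * up / E)" by (intro mult_left_mono I) simp
      also have "\<dots> = ennreal (C * up / E)"
        using kc by (simp add: ennreal_mult'[symmetric] C_def mult.assoc)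
      finally show ?thesis .
    qed
    have "C * lo / E \<le> section_volume n (intersection_body n K) u"
    proof -
      \<comment> \<open>\<open>enn2real\<close> sends infinity to 0, so even this lower bound relies
        on \<open>upper\<close> for finiteness.\<close>
      have "enn2real (ennreal (C * lo / E)) \<le> enn2real (ennreal (\<kappa> * c ^ q) * I)"
        using lower upper by (intro enn2real_mono) (auto simp: top_unique intro: le_less_trans)
      then show ?thesis using C lo0 E0 by (simp add: V)
    qed
    moreover have "section_volume n (intersection_body n K) u \<le> C * up / E"
    proof -
      have "enn2real (ennreal (\<kappa> * c ^ q) * I) \<le> enn2real (ennreal (C * up / E))"
        using upper by (intro enn2real_mono) auto
      then show ?thesis using C up0 E0 by (simp add: V)
    qed
    ultimately show "let E = sqrt (A\<^sub>1 * (u 0)\<^sup>2 + A\<^sub>2 * (perp_norm n u)\<^sup>2) in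
      C * (\<integral>w. env_lower q w \<partial>lborel) / E \<le> section_volume n (intersection_body n K) u \<and>
      section_volume n (intersection_body n K) u \<le> C * (\<integral>w. env_upper q w \<partial>lborel) / E"
      by (simp add: Let_def E_def lo_def up_def \<alpha>_def \<beta>_def)
  qed
qed

text \<open>Up to constants whose ratio is at most \<open>r\<close>, the radial function of the
  double intersection body is \<open>1 / E\<close>, with \<open>E\<close> an ellipsoidal norm. A
  single ellipsoid \<open>E x \<le> R\<close> contains the body, and shrunk by \<open>r\<close> it
  is contained in it.\<close>

lemma banach_mazur_bound:
  assumes lo: "(\<integral>w. env_lower (n - 1) w \<partial>lborel) > 0"
    and r1: "1 \<le> r" and r: "(\<integral>w. env_upper (n - 1) w \<partial>lborel) \<le> r * (\<integral>w. env_lower (n - 1) w \<partial>lborel)"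
  shows "banach_mazur_dist n (intersection_body n (intersection_body n K)) (unit_ball n) \<le> ereal r"
proof -
  define L where "L = intersection_body n (intersection_body n K)"
  define lo where "lo = (\<integral>w. env_lower (n - 1) w \<partial>lborel)"
  have n0: "n > 0" using n by auto
  obtain A\<^sub>1 A\<^sub>2 C where A: "A\<^sub>1 > 0" "A\<^sub>2 > 0" and C: "C > 0"
    and b: "\<forall>u\<in>unit_sphere n. let E = sqrt (A\<^sub>1 * (u 0)\<^sup>2 + A\<^sub>2 * (perp_norm n u)\<^sup>2) in
      C * (\<integral>w. env_lower (n - 1) w \<partial>lborel) / E \<le> section_volume n (intersection_body n K) u \<and>
      section_volume n (intersection_body n K) u \<le> C * (\<integral>w. env_upper (n - 1) w \<partial>lborel) / E"
    by (rule double_section_volume_bounds)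
  define E where "E x = sqrt (A\<^sub>1 * (x 0)\<^sup>2 + A\<^sub>2 * (perp_norm n x)\<^sup>2)" for x
  \<comment> \<open>The upper constant is replaced by \<open>r\<close> times the lower one, so that
    the outer ellipsoid is exactly \<open>r\<close> times the inner one.\<close>
  define R where "R = r * (C * lo)"
  have R: "R > 0" using lo r1 C by (simp add: R_def lo_def)
  have lower: "C * lo / E u \<le> section_volume n (intersection_body n K) u"
    and upper: "section_volume n (intersection_body n K) u \<le> R / E u" if "u \<in> unit_sphere n" for u
  proof -
    have E0: "E u \<ge> 0" using A by (simp add: E_def)
    show "C * lo / E u \<le> section_volume n (intersection_body n K) u"
      using b that by (auto simp: Let_def E_def lo_def)
    have "section_volume n (intersection_body n K) u \<le> C * (\<integral>w. env_upper (n - 1) w \<partial>lborel) / E u"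
      using b that by (auto simp: Let_def E_def)
    also have "\<dots> \<le> C * (r * lo) / E u"
      using r C E0 by (intro divide_right_mono mult_left_mono) (auto simp: lo_def)
    finally show "section_volume n (intersection_body n K) u \<le> R / E u" by (simp add: R_def mult_ac)
  qed
  have E_scale: "E (c *\<^sub>R x) = \<bar>c\<bar> * E x" for c x
  proof -
    have "A\<^sub>1 * ((c *\<^sub>R x) 0)\<^sup>2 + A\<^sub>2 * (perp_norm n (c *\<^sub>R x))\<^sup>2 = c\<^sup>2 * (A\<^sub>1 * (x 0)\<^sup>2 + A\<^sub>2 * (perp_norm n x)\<^sup>2)"
      unfolding perp_norm_scaleR by (simp add: scaleR_fun_def power_mult_distrib algebra_simps)
    then show ?thesis by (simp add: E_def real_sqrt_mult)
  qed
  have E_pos: "E u > 0" if "u \<in> unit_sphere n" for u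
  proof -
    have "(u 0)\<^sup>2 + (perp_norm n u)\<^sup>2 = 1" using enorm_eq[OF n0, of u] that by (simp add: unit_sphere_def)
    then have "u 0 \<noteq> 0 \<or> perp_norm n u \<noteq> 0" by auto
    then have "A\<^sub>1 * (u 0)\<^sup>2 + A\<^sub>2 * (perp_norm n u)\<^sup>2 > 0"
      using A by (auto intro: add_pos_nonneg add_nonneg_pos)
    then show ?thesis by (simp add: E_def)
  qed
  \<comment> \<open>The semi-axes of the ellipsoid \<open>E x \<le> R\<close>, so the diagonal map
    \<open>T\<close> carries the unit ball onto it.\<close>
  define a where "a i = (if i = 0 then R / sqrt A\<^sub>1 else R / sqrt A\<^sub>2)" for i :: nat
  have a: "a i > 0" for i using A R by (simp add: a_def)
  define T where "T x = (\<lambda>i. a i * x i)" for x :: "nat \<Rightarrow> real"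
  have T_GL: "T \<in> GL n"
  proof -
    have "linear T"
      by (rule linearI) (auto simp: T_def fun_eq_iff scaleR_fun_def algebra_simps)
    moreover have "bij_betw T (carrier_E n) (carrier_E n)"
      by (rule bij_betw_byWitness[where f' = "\<lambda>y i. y i / a i"])
        (use a less_imp_neq[OF a] in \<open>auto simp: T_def mem_carrier_E fun_eq_iff\<close>)
    ultimately show ?thesis by (simp add: GL_def)
  qed
  have ball: "y \<in> T ` unit_ball n \<longleftrightarrow> E y \<le> R" if y: "y \<in> carrier_E n" for y
  proof -
    define x where "x = (\<lambda>i. y i / a i)"
    have x: "x \<in> carrier_E n" "T x = y"
      using y a less_imp_neq[OF a] by (auto simp: x_def mem_carrier_E T_def fun_eq_iff)
    have inj: "x' = x" if "T x' = y" for x'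
      using that less_imp_neq[OF a] by (auto simp: x_def T_def fun_eq_iff field_simps)
    have "R\<^sup>2 * (enorm n x)\<^sup>2 = (E y)\<^sup>2"
    proof -
      have "(perp_norm n x)\<^sup>2 = (\<Sum>i\<in>{1..<n}. (y i)\<^sup>2 * (A\<^sub>2 / R\<^sup>2))"
        unfolding perp_norm_def using A R
        by (subst real_sqrt_pow2) (auto intro!: sum_nonneg sum.cong simp: x_def a_def power_divide power_mult_distrib)
      also have "\<dots> = (perp_norm n y)\<^sup>2 * (A\<^sub>2 / R\<^sup>2)"
      proof -
        have "(perp_norm n y)\<^sup>2 = (\<Sum>i\<in>{1..<n}. (y i)\<^sup>2)" by (simp add: perp_norm_def sum_nonneg)
        then show ?thesis by (simp only: sum_distrib_right)
      qed
      finally have "(enorm n x)\<^sup>2 = (y 0)\<^sup>2 * (A\<^sub>1 / R\<^sup>2) + (perp_norm n y)\<^sup>2 * (A\<^sub>2 / R\<^sup>2)"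
        unfolding enorm_eq[OF n0] using A R by (simp add: x_def a_def power_divide power_mult_distrib)
      then show ?thesis using A R by (simp add: E_def field_simps)
    qed
    then have "(R * enorm n x)\<^sup>2 = (E y)\<^sup>2" by (simp add: power_mult_distrib)
    then have "R * enorm n x = E y"
      using R A enorm_nonneg[of n x] by (subst (asm) power2_eq_iff_nonneg) (auto simp: E_def)
    then have "enorm n x \<le> 1 \<longleftrightarrow> E y \<le> R"
      using R by (metis mult_le_cancel_left_pos mult.right_neutral)
    moreover have "y \<in> T ` unit_ball n \<longleftrightarrow> enorm n x \<le> 1"
    proof
      assume "y \<in> T ` unit_ball n"
      then obtain x' where x': "x' \<in> unit_ball n" "T x' = y" by blast
      with inj[OF x'(2)] show "enorm n x \<le> 1" by (simp add: unit_ball_def)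
    next
      assume "enorm n x \<le> 1"
      then have "x \<in> unit_ball n" using x(1) by (simp add: unit_ball_def)
      then show "y \<in> T ` unit_ball n" using x(2) by blast
    qed
    ultimately show ?thesis by simp
  qed
  have carrier_L: "L \<subseteq> carrier_E n"
    by (auto simp: L_def intersection_body_def unit_sphere_def mem_carrier_E scaleR_fun_def)
  have "L \<subseteq> T ` unit_ball n"
  proof
    fix y assume y: "y \<in> L"
    then obtain s u where su: "y = s *\<^sub>R u" "u \<in> unit_sphere n" "0 \<le> s" "s \<le> section_volume n (intersection_body n K) u"
      unfolding L_def intersection_body_def[of n "intersection_body n K"] by blast
    have "s \<le> R / E u" using su(4) upper[OF su(2)] by linarith
    then have "E y \<le> R" using E_pos[OF su(2)] su(1,3) by (simp add: E_scale pos_le_divide_eq)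
    then show "y \<in> T ` unit_ball n" using ball y carrier_L by blast
  qed
  moreover have "T ` unit_ball n \<subseteq> (\<lambda>x. r *\<^sub>R x) ` L"
  proof
    fix y assume y: "y \<in> T ` unit_ball n"
    then have yc: "y \<in> carrier_E n" by (auto simp: unit_ball_def T_def mem_carrier_E)
    then have Ey: "E y \<le> R" using ball y by blast
    have "(1 / r) *\<^sub>R y \<in> L"
    proof (cases "y = 0")
      case True
      then show ?thesis using zero_in_intersection_body[OF n0] by (simp add: L_def)
    next
      case False
      note nz = normalize[OF yc False]
      let ?u = "(1 / enorm n y) *\<^sub>R y"
      have "E y = enorm n y * E ?u" using nz(2) by (simp add: E_scale)
      then have "enorm n y * E ?u \<le> r * (C * lo)" using Ey by (simp add: R_def)
      then have "enorm n y / r \<le> C * lo / E ?u"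
        using E_pos[OF nz(1)] r1 by (simp add: pos_le_divide_eq pos_divide_le_eq mult_ac)
      also have "\<dots> \<le> section_volume n (intersection_body n K) ?u" by (rule lower[OF nz(1)])
      finally have "(enorm n y / r) *\<^sub>R ?u \<in> L"
        unfolding L_def using nz(1,2) r1
        by (subst scaleR_in_intersection_body_iff) auto
      then show ?thesis using nz(2) by simp
    qed
    then have "r *\<^sub>R ((1 / r) *\<^sub>R y) \<in> (\<lambda>x. r *\<^sub>R x) ` L" by (rule imageI)
    then show "y \<in> (\<lambda>x. r *\<^sub>R x) ` L" using r1 by simp
  qed
  ultimately show ?thesis
    unfolding banach_mazur_dist_def L_def[symmetric] using T_GL r1 by (intro Inf_lower) blast
qed

end

text \<open>The envelope integrals involve neither the body nor the direction, so a threshold read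
  off from their common limit serves all bodies at once.\<close>

theorem theorem2:
  fixes \<epsilon> :: real
  assumes "\<epsilon> > 0"
  shows "\<exists>N>0. \<forall>n\<ge>N. \<forall>K. body n K \<and> symmetric_set K \<and> convex K \<and> of_revolution n K \<longrightarrow>
           banach_mazur_dist n (intersection_body n (intersection_body n K)) (unit_ball n)
             \<le> ereal (1 + \<epsilon>)"
proof -
  define g where "g = (\<integral>w. exp (- w\<^sup>2) \<partial>lborel :: real)"
  let ?lo = "\<lambda>q. \<integral>w. env_lower q w \<partial>lborel" and ?up = "\<lambda>q. \<integral>w. env_upper q w \<partial>lborel"
  have g: "g > 0" unfolding g_def by (rule env_integrals_tendsto)
  have lim: "?lo \<longlonglongrightarrow> g" "?up \<longlonglongrightarrow> g" unfolding g_def by (rule env_integrals_tendsto)+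
  \<comment> \<open>A linear combination in place of the quotient: its limit
    \<open>\<epsilon> * g\<close> is positive, and no division by a possibly vanishing
    \<open>?lo q\<close> occurs.\<close>
  have "(\<lambda>q. (1 + \<epsilon>) * ?lo q - ?up q) \<longlonglongrightarrow> (1 + \<epsilon>) * g - g"
    by (intro tendsto_intros lim)
  moreover have "(1 + \<epsilon>) * g - g > 0" using assms g by (simp add: algebra_simps)
  ultimately have "\<forall>\<^sub>F q in sequentially. (1 + \<epsilon>) * ?lo q - ?up q > 0" by (rule order_tendstoD(1))
  moreover have "\<forall>\<^sub>F q in sequentially. ?lo q > 0" by (rule order_tendstoD(1)[OF lim(1) g])
  ultimately have "\<forall>\<^sub>F q in sequentially. ?lo q > 0 \<and> ?up q \<le> (1 + \<epsilon>) * ?lo q"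
    by eventually_elim auto
  then obtain N0 where N0: "\<And>q. q \<ge> N0 \<Longrightarrow> ?lo q > 0 \<and> ?up q \<le> (1 + \<epsilon>) * ?lo q"
    by (auto simp: eventually_sequentially)
  show ?thesis
  \<comment> \<open>The 13 is the dimension bound of \<open>revolution_body\<close>, equivalent to
    an exponent \<open>n - 1\<close> of at least 12; it also absorbs the shift from \<open>n\<close>
    to \<open>n - 1\<close> in the threshold.\<close>
  proof (intro exI[of _ "N0 + 13"] conjI allI impI)
    fix n K
    assume N: "N0 + 13 \<le> n" and K: "body n K \<and> symmetric_set K \<and> convex K \<and> of_revolution n K"
    interpret revolution_body n K by standard (use N K in auto)
    show "banach_mazur_dist n (intersection_body n (intersection_body n K)) (unit_ball n) \<le> ereal (1 + \<epsilon>)"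
    proof (rule banach_mazur_bound)
      have "N0 \<le> n - 1" using N by simp
      from N0[OF this] show "(\<integral>w. env_lower (n - 1) w \<partial>lborel) > 0"
        "(\<integral>w. env_upper (n - 1) w \<partial>lborel) \<le> (1 + \<epsilon>) * (\<integral>w. env_lower (n - 1) w \<partial>lborel)"
        by blast+
    qed (use assms in simp)
  qed simp
qed

end
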